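(* The WSAT$^+$ problem on circuits of genus $g(n) = n^{o(1)}$ is FPT, where $n$ is the number of variables in the circuit.
   Context: A $\Pi_2$ circuit is a Boolean circuit in normalized form of depth at most 2: the output gate is an AND-gate whose inputs are OR-gates or literals (no NOT-gates). Monotone means all input literals are positive. WSAT$^+$ (= WSAT$^+[2]$, weighted monotone CNF-SAT) is the problem: given a monotone $\Pi_2$ circuit $C$ and a parameter $k$, decide whether $C$ has a satisfying assignment of weight (number of variables set to 1) exactly $k$. The genus of a circuit is the genus of its underlying undirected graph after the output gate is removed. The $o(\cdot)$ notation is the effective one: $f(n)=o(g(n))$ means $f(n)\le g(n)/\mu(n)$ for some computable nondecreasing unbounded $\mu$ and all large $n$. *)

theory Defs
  imports
    Complex_Main
    "HOL-Combinatorics.Orbits"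
    "Graph_Theory.Graph_Theory"
begin

section \<open>Computation\<close>

text \<open>
  The machine model is the language WHILE over binary trees with the usual cost measure
  (N. D. Jones, \<^emph>\<open>Computability and Complexity from a Programming Perspective\<close>).
  It is polynomially equivalent to Turing machines: a cons, head or tail costs one step because it is
  a pointer operation, and trees can only be inspected by testing for a leaf.
\<close>

datatype tree = Leaf | Node tree tree

fun hd_tree :: "tree \<Rightarrow> tree" where
  "hd_tree Leaf = Leaf"
| "hd_tree (Node l r) = l"

fun tl_tree :: "tree \<Rightarrow> tree" where
  "tl_tree Leaf = Leaf"
| "tl_tree (Node l r) = r"

fun tree_size :: "tree \<Rightarrow> nat" where
  "tree_size Leaf = 1"
| "tree_size (Node l r) = 1 + tree_size l + tree_size r"

datatype expr = Var nat | LeafE | ConsE expr expr | HdE expr | TlE expr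

type_synonym store = "nat \<Rightarrow> tree"

fun eval_expr :: "expr \<Rightarrow> store \<Rightarrow> tree" where
  "eval_expr (Var v) s = s v"
| "eval_expr LeafE s = Leaf"
| "eval_expr (ConsE a b) s = Node (eval_expr a s) (eval_expr b s)"
| "eval_expr (HdE a) s = hd_tree (eval_expr a s)"
| "eval_expr (TlE a) s = tl_tree (eval_expr a s)"

fun cost_expr :: "expr \<Rightarrow> nat" where
  "cost_expr (Var v) = 1"
| "cost_expr LeafE = 1"
| "cost_expr (ConsE a b) = 1 + cost_expr a + cost_expr b"
| "cost_expr (HdE a) = 1 + cost_expr a"
| "cost_expr (TlE a) = 1 + cost_expr a"

datatype com =
    Skip
  | Assign nat expr
  | Seq com com
  | If expr com com
  | While expr com

text \<open>\<open>exec c s t s'\<close>: started in store \<open>s\<close>, the command \<open>c\<close> halts after time \<open>t\<close> in store \<open>s'\<close>.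
  A leaf is false, every other tree is true.\<close>

inductive exec :: "com \<Rightarrow> store \<Rightarrow> nat \<Rightarrow> store \<Rightarrow> bool" where
  exec_Skip: "exec Skip s 1 s"
| exec_Assign: "exec (Assign v e) s (1 + cost_expr e) (s(v := eval_expr e s))"
| exec_Seq: "exec c1 s1 t1 s2 \<Longrightarrow> exec c2 s2 t2 s3 \<Longrightarrow> exec (Seq c1 c2) s1 (1 + t1 + t2) s3"
| exec_IfTrue:
    "eval_expr e s \<noteq> Leaf \<Longrightarrow> exec c1 s t s' \<Longrightarrow> exec (If e c1 c2) s (1 + cost_expr e + t) s'"
| exec_IfFalse:
    "eval_expr e s = Leaf \<Longrightarrow> exec c2 s t s' \<Longrightarrow> exec (If e c1 c2) s (1 + cost_expr e + t) s'"
| exec_WhileFalse: "eval_expr e s = Leaf \<Longrightarrow> exec (While e c) s (1 + cost_expr e) s"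
| exec_WhileTrue:
    "eval_expr e s1 \<noteq> Leaf \<Longrightarrow> exec c s1 t1 s2 \<Longrightarrow> exec (While e c) s2 t2 s3 \<Longrightarrow>
     exec (While e c) s1 (1 + cost_expr e + t1 + t2) s3"

text \<open>Input and output are passed in variable 0; all other variables start as leaves.\<close>

definition runs :: "com \<Rightarrow> tree \<Rightarrow> nat \<Rightarrow> tree \<Rightarrow> bool" where
  "runs p x t y \<longleftrightarrow> (\<exists>s'. exec p ((\<lambda>_. Leaf)(0 := x)) t s' \<and> s' 0 = y)"

fun enc_nat :: "nat \<Rightarrow> tree" where
  "enc_nat 0 = Leaf"
| "enc_nat (Suc n) = Node Leaf (enc_nat n)"

fun enc_list :: "('a \<Rightarrow> tree) \<Rightarrow> 'a list \<Rightarrow> tree" where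
  "enc_list f [] = Leaf"
| "enc_list f (x # xs) = Node (f x) (enc_list f xs)"

definition computable :: "(nat \<Rightarrow> nat) \<Rightarrow> bool" where
  "computable f \<longleftrightarrow> (\<exists>p. \<forall>n. \<exists>t. runs p (enc_nat n) t (enc_nat (f n)))"

text \<open>
  A parameterized problem is a set \<open>Q\<close> of pairs of an input and a parameter. \<open>fpt_on I Q\<close> says that
  \<open>Q\<close>, restricted to the instances in \<open>I\<close>, is fixed-parameter tractable: the algorithm is only
  required to be correct and fast on inputs from \<open>I\<close>, it need not recognise \<open>I\<close>.
\<close>

definition fpt_on :: "(tree \<times> nat) set \<Rightarrow> (tree \<times> nat) set \<Rightarrow> bool" where
  "fpt_on I Q \<longleftrightarrow>
     (\<exists>p f c. computable f \<and>
        (\<forall>(x, k)\<in>I. \<exists>t y. runs p (Node x (enc_nat k)) t y \<and>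
           t \<le> f k * tree_size x ^ c \<and> (y \<noteq> Leaf \<longleftrightarrow> (x, k) \<in> Q)))"

section \<open>Effective little-o\<close>

definition effective_smallo :: "(nat \<Rightarrow> real) \<Rightarrow> (nat \<Rightarrow> real) \<Rightarrow> bool" where
  "effective_smallo f g \<longleftrightarrow>
     (\<exists>\<mu> :: nat \<Rightarrow> nat. computable \<mu> \<and> mono \<mu> \<and> (\<forall>b. \<exists>n. b < \<mu> n) \<and>
        (\<forall>\<^sub>F n in sequentially. f n \<le> g n / real (\<mu> n)))"

definition n_to_the_o1 :: "(nat \<Rightarrow> real) \<Rightarrow> bool" where
  "n_to_the_o1 g \<longleftrightarrow>
     (\<exists>h. effective_smallo h (\<lambda>_. 1) \<and> (\<forall>\<^sub>F n in sequentially. g n \<le> real n powr h n))"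

section \<open>Genus of a graph\<close>

text \<open>
  An undirected graph is a symmetric digraph, its arcs being the two orientations of each edge.
  A rotation system cyclically orders the arcs leaving each vertex. It determines a
  cellular embedding of every component into a closed orientable surface. The boundaries of the
  faces are the orbits of the arcs under ``reverse, then take the next arc''; in addition, each
  isolated vertex lies in one face of its own sphere.
\<close>

definition rotation_system :: "'a pair_pre_digraph \<Rightarrow> ('a \<times> 'a \<Rightarrow> 'a \<times> 'a) \<Rightarrow> bool" where
  "rotation_system G \<pi> \<longleftrightarrow>
     \<pi> permutes parcs G \<and>
     (\<forall>v\<in>pverts G. out_arcs (with_proj G) v \<noteq> {} \<longrightarrow> cyclic_on \<pi> (out_arcs (with_proj G) v))"

definition num_faces :: "'a pair_pre_digraph \<Rightarrow> ('a \<times> 'a \<Rightarrow> 'a \<times> 'a) \<Rightarrow> nat" where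
  "num_faces G \<pi> =
     card (orbit (\<pi> \<circ> prod.swap) ` parcs G) +
     card {v \<in> pverts G. out_arcs (with_proj G) v = {}}"

text \<open>
  Euler's formula \<open>V - E + F = 2 - 2 g\<close>, summed over the components. The genus of a disconnected
  graph is the sum of the genera of its components.
\<close>

definition graph_genus :: "'a pair_pre_digraph \<Rightarrow> nat" where
  "graph_genus G =
     (LEAST g. \<exists>\<pi>. rotation_system G \<pi> \<and>
        int (card (pverts G)) - int (card (parcs G) div 2) + int (num_faces G \<pi>) =
        2 * int (card (pre_digraph.sccs_verts (with_proj G))) - 2 * int g)"

section \<open>Circuits\<close>

datatype literal = Pos (var: nat) | Neg (var: nat)

datatype and_input = Lit literal | Or "literal list"

text \<open>\<open>Pi2 n is\<close> has the variables \<open>0, \<dots>, n - 1\<close> and an output AND-gate with inputs \<open>is\<close>.\<close>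

datatype pi2 = Pi2 (num_vars: nat) (and_inputs: "and_input list")

fun literals :: "and_input \<Rightarrow> literal set" where
  "literals (Lit l) = {l}"
| "literals (Or ls) = set ls"

definition circuit_literals :: "pi2 \<Rightarrow> literal set" where
  "circuit_literals C = (\<Union>i\<in>set (and_inputs C). literals i)"

definition wf_circuit :: "pi2 \<Rightarrow> bool" where
  "wf_circuit C \<longleftrightarrow> (\<forall>l\<in>circuit_literals C. var l < num_vars C)"

definition monotone_circuit :: "pi2 \<Rightarrow> bool" where
  "monotone_circuit C \<longleftrightarrow> (\<forall>l\<in>circuit_literals C. \<exists>v. l = Pos v)"

text \<open>An assignment is represented by the set of the variables that it sets to 1.\<close>

fun eval_literal :: "nat set \<Rightarrow> literal \<Rightarrow> bool" where
  "eval_literal A (Pos v) \<longleftrightarrow> v \<in> A"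
| "eval_literal A (Neg v) \<longleftrightarrow> v \<notin> A"

fun eval_and_input :: "nat set \<Rightarrow> and_input \<Rightarrow> bool" where
  "eval_and_input A (Lit l) \<longleftrightarrow> eval_literal A l"
| "eval_and_input A (Or ls) \<longleftrightarrow> (\<exists>l\<in>set ls. eval_literal A l)"

definition satisfies :: "nat set \<Rightarrow> pi2 \<Rightarrow> bool" where
  "satisfies A C \<longleftrightarrow> (\<forall>i\<in>set (and_inputs C). eval_and_input A i)"

text \<open>The OR-gates are named by their positions among the inputs of the output gate.\<close>

datatype node = Input literal | OrGate nat | Output

definition or_gates :: "pi2 \<Rightarrow> nat set" where
  "or_gates C = {j. j < length (and_inputs C) \<and> (\<exists>ls. and_inputs C ! j = Or ls)}"

definition wires :: "pi2 \<Rightarrow> (node \<times> node) set" where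
  "wires C =
     {(Input l, OrGate j) | l j. j \<in> or_gates C \<and> l \<in> literals (and_inputs C ! j)} \<union>
     {(Input l, Output) | l. Lit l \<in> set (and_inputs C)} \<union>
     {(OrGate j, Output) | j. j \<in> or_gates C}"

definition circuit_graph :: "pi2 \<Rightarrow> node pair_pre_digraph" where
  "circuit_graph C =
     \<lparr> pverts = Input ` (Pos ` {..<num_vars C} \<union> circuit_literals C) \<union> OrGate ` or_gates C \<union> {Output},
       parcs = wires C \<union> (wires C)\<inverse> \<rparr>"

definition remove_vertex :: "'a \<Rightarrow> 'a pair_pre_digraph \<Rightarrow> 'a pair_pre_digraph" where
  "remove_vertex v G =
     \<lparr> pverts = pverts G - {v}, parcs = {a \<in> parcs G. fst a \<noteq> v \<and> snd a \<noteq> v} \<rparr>"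

definition circuit_genus :: "pi2 \<Rightarrow> nat" where
  "circuit_genus C = graph_genus (remove_vertex Output (circuit_graph C))"

text \<open>
  Numbers are written in unary. As variables are numbered below \<open>n\<close> and a circuit has at
  least \<open>n\<close> nodes, the size of the encoding is polynomially related to the size of the circuit.
\<close>

fun enc_literal :: "literal \<Rightarrow> tree" where
  "enc_literal (Pos v) = Node Leaf (enc_nat v)"
| "enc_literal (Neg v) = Node (Node Leaf Leaf) (enc_nat v)"

fun enc_and_input :: "and_input \<Rightarrow> tree" where
  "enc_and_input (Lit l) = Node Leaf (enc_literal l)"
| "enc_and_input (Or ls) = Node (Node Leaf Leaf) (enc_list enc_literal ls)"

definition enc_circuit :: "pi2 \<Rightarrow> tree" where
  "enc_circuit C = Node (enc_nat (num_vars C)) (enc_list enc_and_input (and_inputs C))"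

lemma enc_nat_inject: "enc_nat m = enc_nat n \<longleftrightarrow> m = n"
proof (induction m arbitrary: n)
  case 0 then show ?case by (cases n) auto
next
  case (Suc m) then show ?case by (cases n) auto
qed

lemma inj_enc_list: "inj f \<Longrightarrow> inj (enc_list f)"
proof (rule injI)
  fix xs ys assume "inj f" "enc_list f xs = enc_list f ys"
  then show "xs = ys"
  proof (induction xs arbitrary: ys)
    case Nil then show ?case by (cases ys) auto
  next
    case (Cons x xs) then show ?case by (cases ys) (auto dest: injD)
  qed
qed

lemma inj_enc_literal: "inj enc_literal"
proof (rule injI)
  fix l m assume "enc_literal l = enc_literal m"
  then show "l = m" by (cases l; cases m) (auto simp: enc_nat_inject)
qed

lemma inj_enc_and_input: "inj enc_and_input"
proof (rule injI)
  fix i j assume "enc_and_input i = enc_and_input j"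
  then show "i = j"
    by (cases i; cases j) (auto dest: injD[OF inj_enc_literal] injD[OF inj_enc_list[OF inj_enc_literal]])
qed

lemma inj_enc_circuit: "inj enc_circuit"
proof (rule injI)
  fix C D assume "enc_circuit C = enc_circuit D"
  then show "C = D"
    by (cases C; cases D)
      (auto simp: enc_circuit_def enc_nat_inject dest: injD[OF inj_enc_list[OF inj_enc_and_input]])
qed

section \<open>Weighted monotone CNF-SAT\<close>

definition wsat_plus :: "(tree \<times> nat) set" where
  "wsat_plus =
     {(enc_circuit C, k) | C k. wf_circuit C \<and> monotone_circuit C \<and>
        (\<exists>A \<subseteq> {..<num_vars C}. card A = k \<and> satisfies A C)}"

definition instances_of_genus :: "(nat \<Rightarrow> real) \<Rightarrow> (tree \<times> nat) set" where
  "instances_of_genus g =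
     {(enc_circuit C, k) | C k. wf_circuit C \<and> monotone_circuit C \<and>
        real (circuit_genus C) \<le> g (num_vars C)}"

end

theory Submission
  imports Defs
begin

text \<open>
  Satisfying a monotone CNF with weight \<open>k\<close> is hitting all clauses with at most \<open>k \<le> n\<close> variables. Call two
  variables equivalent if they occur in the same clauses; only one variable of each class matters. The
  algorithm keeps one variable per class in every clause, branches over the variables of the then
  shortest clause, and removes the clauses that have been hit.

  The shortest clause has \<open>O(1 + g)\<close> variables. Consider the bipartite incidence graph of representative
  variables and clauses, a subgraph of the circuit and hence of genus at most \<open>g\<close>. With \<open>m\<close> clauses,
  at most \<open>m\<close> variables have degree 1. In the subgraph on the variables of degree 2, no two of which have the same
  neighbours, all but \<open>m\<close> faces have length at least 6; in the subgraph on the variables of degree at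
  least 3 all faces have length at least 4. Euler's formula then gives \<open>O(m + g)\<close> edges.

  So the search tree has \<open>O(1 + g)\<^sup>k\<close> nodes. If \<open>g \<le> n powr (1 / \<mu> n)\<close>
  and \<open>k \<le> \<mu> n\<close>, then \<open>g\<^sup>k \<le> n\<close>. Otherwise \<open>n\<close> is below a computable function of \<open>k\<close>.
\<close>

section \<open>Orbits and connected components\<close>

text \<open>The genus is given for the whole circuit, but the sparsity argument is applied to
  subgraphs chosen by the surviving clauses and by degree. So deleting edges must be shown not to
  raise the genus. This is done on permutations: every change of a rotation or of its faces is a
  composition with transpositions, and a transposition merges two cycles or splits one.

  The classes of equivalent variables grow coarser as clauses disappear and are recomputed in every
  search node. This keeps neighbourhoods distinct among the representatives. Without it there is no
  bound: two clauses that share all their variables form a planar graph, however long they are.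

  The program is told neither the genus nor \<open>\<mu>\<close>; they occur only in the estimate of
  its time. But \<open>f\<close> has to be computable and depends on an inverse of
  \<open>\<mu>\<close>. Hence computable functions must be closed under minimization, and an unknown
  program for \<open>\<mu>\<close> must be run as a subroutine.\<close>

lemma card_merge_blocks:
  assumes "finite P" "X \<in> P" "Y \<in> P" "X \<noteq> Y" "X \<noteq> {}"
    and disj: "\<And>A B. A \<in> P \<Longrightarrow> B \<in> P \<Longrightarrow> A \<noteq> B \<Longrightarrow> A \<inter> B = {}"
  shows "card (insert (X \<union> Y) (P - {X, Y})) + 1 = card P"
proof -
  have "X \<union> Y \<notin> P - {X, Y}"
    using disj[of "X \<union> Y" X] assms by auto
  moreover have "card (P - {X, Y}) + 2 = card P"
    using assms card_Diff_subset[of "{X,Y}" P] card_mono[of P "{X,Y}"] by auto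
  ultimately show ?thesis
    using assms(1) by simp
qed

text \<open>The successors of \<open>a\<close> and \<open>b\<close> are exchanged: the new map
  leaves \<open>a\<close> along the cycle of \<open>b\<close> and leaves \<open>b\<close> along the
  cycle of \<open>a\<close>, so it runs through both cycles before it closes up.\<close>

lemma orbit_comp_transpose_merge:
  assumes f: "permutation f" and ba: "b \<notin> orbit f a"
  shows "orbit (f \<circ> transpose a b) a = orbit f a \<union> orbit f b"
    and "orbit (f \<circ> transpose a b) b = orbit f a \<union> orbit f b"
    and "\<And>x. x \<notin> orbit f a \<Longrightarrow> x \<notin> orbit f b \<Longrightarrow> orbit (f \<circ> transpose a b) x = orbit f x"
proof -
  define g where "g = f \<circ> transpose a b"
  have self: "x \<in> orbit f x" for x using f by (rule permutation_self_in_orbit)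
  have ab: "a \<notin> orbit f b" using ba self by (meson orbit_swap)
  have ga: "g a = f b" and gb: "g b = f a" and gx: "\<And>x. x \<noteq> a \<Longrightarrow> x \<noteq> b \<Longrightarrow> g x = f x"
    by (auto simp: g_def transpose_def)
  have sub1: "y \<in> orbit g a" if "y \<in> orbit f b" for y
    using that
  proof induct
    case base
    show ?case using orbit.base[of g a] by (simp add: ga)
  next
    case (step y)
    show ?case
    proof (cases "y = b")
      case True
      then show ?thesis using orbit.base[of g a] by (simp add: ga)
    next
      case False
      then have "g y = f y" using step(1) ab gx by metis
      then show ?thesis using orbit.step[OF step(2)] by simp
    qed
  qed
  have sub2: "y \<in> orbit g b" if "y \<in> orbit f a" for y
    using that
  proof induct
    case base
    show ?case using orbit.base[of g b] by (simp add: gb)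
  next
    case (step y)
    show ?case
    proof (cases "y = a")
      case True
      then show ?thesis using orbit.base[of g b] by (simp add: gb)
    next
      case False
      then have "g y = f y" using step(1) ba gx by metis
      then show ?thesis using orbit.step[OF step(2)] by simp
    qed
  qed
  have closed: "g y \<in> orbit f a \<union> orbit f b" if "y \<in> orbit f a \<union> orbit f b" for y
    using that ga gb gx by (cases "y = a"; cases "y = b") (auto intro: orbit.intros)
  have sup: "orbit g x \<subseteq> orbit f a \<union> orbit f b" if x: "x \<in> orbit f a \<union> orbit f b" for x
  proof
    fix y assume "y \<in> orbit g x"
    then show "y \<in> orbit f a \<union> orbit f b"
      by induct (use closed x in blast)+
  qed
  have ba: "b \<in> orbit g a" and ab: "a \<in> orbit g b" using sub1 sub2 self by auto
  have "orbit f a \<subseteq> orbit g a" using sub2 orbit_trans[OF _ ba] by blast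
  moreover have "orbit f b \<subseteq> orbit g b" using sub1 orbit_trans[OF _ ab] by blast
  ultimately show "orbit (f \<circ> transpose a b) a = orbit f a \<union> orbit f b"
    "orbit (f \<circ> transpose a b) b = orbit f a \<union> orbit f b"
    unfolding g_def[symmetric] using sub1 sub2 sup[of a] sup[of b] self by blast+
  fix x assume "x \<notin> orbit f a" "x \<notin> orbit f b"
  then have "a \<notin> orbit f x" "b \<notin> orbit f x" using self by (meson orbit_swap)+
  then show "orbit (f \<circ> transpose a b) x = orbit f x"
    unfolding g_def[symmetric] using gx by (intro orbit_cong self) metis
qed

text \<open>The stretch from \<open>f b\<close> to the first visit of \<open>a\<close> becomes a
  cycle of its own, because \<open>a\<close> is now sent back to \<open>f b\<close>. Returning to
  \<open>b\<close> within the stretch would give an earlier visit of \<open>a\<close>, so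
  \<open>b\<close> is not on it.\<close>

lemma orbit_comp_transpose_split:
  assumes f: "permutation f" and ba: "b \<in> orbit f a" and ne: "a \<noteq> b"
  shows "b \<notin> orbit (f \<circ> transpose a b) a"
proof -
  let ?g = "f \<circ> transpose a b"
  have ab: "a \<in> orbit f b"
    using ba permutation_self_in_orbit[OF f] by (meson orbit_swap)
  define m where "m = (LEAST i. 0 < i \<and> (f ^^ i) b = a)"
  have ex: "\<exists>i. 0 < i \<and> (f ^^ i) b = a" using ab by (auto simp: orbit_altdef)
  have m: "0 < m" "(f ^^ m) b = a" using LeastI_ex[OF ex] by (auto simp: m_def)
  have least: "(f ^^ i) b \<noteq> a" if "0 < i" "i < m" for i
    using not_less_Least[of i "\<lambda>i. 0 < i \<and> (f ^^ i) b = a"] that by (auto simp: m_def)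
  have nb: "(f ^^ i) b \<noteq> b" if "0 < i" "i \<le> m" for i
  proof
    assume i: "(f ^^ i) b = b"
    show False
    proof (cases "i = m")
      case True then show False using i m ne by simp
    next
      case False
      have "(f ^^ m) b = (f ^^ (m - i)) ((f ^^ i) b)"
        using that funpow_add[of "m - i" i f] by simp
      then show False using least[of "m - i"] that False i m by simp
    qed
  qed
  define X where "X = {(f ^^ i) b | i. 0 < i \<and> i \<le> m}"
  have fb: "f b \<in> X" using m(1) unfolding X_def by (intro CollectI exI[of _ 1]) auto
  have closed: "?g y \<in> X" if "y \<in> X" for y
  proof (cases "y = a")
    case True then show ?thesis using fb by simp
  next
    case False
    from that obtain i where i: "y = (f ^^ i) b" "0 < i" "i \<le> m" by (auto simp: X_def)
    then have "i < m" using False m by (cases "i = m") auto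
    moreover have "?g y = (f ^^ Suc i) b" using False nb[of i] i by (simp add: transpose_def)
    ultimately show ?thesis unfolding X_def by (intro CollectI exI[of _ "Suc i"]) auto
  qed
  have "orbit ?g a \<subseteq> X"
  proof
    fix y assume "y \<in> orbit ?g a"
    then show "y \<in> X" by induct (use fb closed in simp_all)
  qed
  moreover have "b \<notin> X"
  proof
    assume "b \<in> X"
    then obtain i where "0 < i" "i \<le> m" "(f ^^ i) b = b" unfolding X_def by (auto dest: sym)
    then show False using nb by blast
  qed
  ultimately show ?thesis by auto
qed

lemma permutation_if_permutes: "f permutes S \<Longrightarrow> finite S \<Longrightarrow> permutation f"
  by (auto simp: permutation_permutes)

lemma orbit_disjoint:
  assumes "permutation f" "orbit f x \<noteq> orbit f y"
  shows "orbit f x \<inter> orbit f y = {}"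
proof (rule ccontr)
  assume "orbit f x \<inter> orbit f y \<noteq> {}"
  then obtain z where z: "z \<in> orbit f x" "z \<in> orbit f y" by auto
  have "orbit f z = orbit f x" "orbit f z = orbit f y"
    using orbit_cyclic_eq3[OF cyclic_on_orbit'[OF assms(1)]] z by metis+
  then show False using assms(2) by simp
qed

lemma orbit_eq: "permutation f \<Longrightarrow> x \<in> orbit f y \<Longrightarrow> orbit f x = orbit f y"
  using orbit_cyclic_eq3[OF cyclic_on_orbit'] by metis

lemma card_orbits_merge:
  assumes f: "f permutes S" "finite S" and S: "a \<in> S" "b \<in> S" and ba: "b \<notin> orbit f a"
  shows "card (orbit (f \<circ> transpose a b) ` S) + 1 = card (orbit f ` S)"
proof -
  let ?g = "f \<circ> transpose a b"
  have p: "permutation f" using f by (rule permutation_if_permutes)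
  note self = permutation_self_in_orbit[OF p]
  note m = orbit_comp_transpose_merge[OF p ba]
  have g: "permutation ?g" using p by (simp add: permutation_compose permutation_swap_id)
  have X: "orbit ?g x = orbit f a \<union> orbit f b" if "x \<in> orbit f a \<union> orbit f b" for x
    using orbit_eq[OF g, of x a] that m(1) by auto
  have "orbit ?g ` S = insert (orbit f a \<union> orbit f b) (orbit f ` S - {orbit f a, orbit f b})" (is "?L = ?R")
  proof
    show "?L \<subseteq> ?R"
    proof
      fix Q assume "Q \<in> ?L"
      then obtain x where x: "x \<in> S" "Q = orbit ?g x" by auto
      show "Q \<in> ?R"
      proof (cases "x \<in> orbit f a \<union> orbit f b")
        case True then show ?thesis using X x by auto
      next
        case False
        then have "Q = orbit f x" using m(3) x by auto
        moreover have "orbit f x \<noteq> orbit f a" "orbit f x \<noteq> orbit f b" using False self by auto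
        ultimately show ?thesis using x by auto
      qed
    qed
    show "?R \<subseteq> ?L"
    proof
      fix Q assume "Q \<in> ?R"
      then consider "Q = orbit f a \<union> orbit f b" | x where "x \<in> S" "Q = orbit f x" "orbit f x \<noteq> orbit f a" "orbit f x \<noteq> orbit f b"
        by auto
      then show "Q \<in> ?L"
      proof cases
        case 1 then show ?thesis using m(1) S by auto
      next
        case 2
        then have "x \<notin> orbit f a" "x \<notin> orbit f b" using orbit_eq[OF p] by auto
        then show ?thesis using m(3)[of x] 2 by auto
      qed
    qed
  qed
  moreover have "card (insert (orbit f a \<union> orbit f b) (orbit f ` S - {orbit f a, orbit f b})) + 1 = card (orbit f ` S)"
  proof (rule card_merge_blocks)
    show "orbit f a \<noteq> orbit f b" using ba self by auto
    show "A \<inter> B = {}" if "A \<in> orbit f ` S" "B \<in> orbit f ` S" "A \<noteq> B" for A B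
      using that orbit_disjoint[OF p] by auto
  qed (use S f orbit_nonempty[of f a] in auto)
  ultimately show ?thesis by simp
qed

text \<open>Splitting is merging read backwards: a second transposition restores \<open>f\<close>,
  and \<open>card_orbits_merge\<close> applies to \<open>f \<circ> transpose a b\<close>, where
  \<open>a\<close> and \<open>b\<close> are on different cycles.\<close>

lemma card_orbits_split:
  assumes f: "f permutes S" "finite S" and S: "a \<in> S" "b \<in> S" and ba: "b \<in> orbit f a" "a \<noteq> b"
  shows "card (orbit (f \<circ> transpose a b) ` S) = card (orbit f ` S) + 1"
proof -
  let ?g = "f \<circ> transpose a b"
  have "?g permutes S" using f S by (intro permutes_compose permutes_swap_id)
  moreover have "b \<notin> orbit ?g a"
    using orbit_comp_transpose_split ba permutation_if_permutes[OF f] by metis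
  ultimately have "card (orbit (?g \<circ> transpose a b) ` S) + 1 = card (orbit ?g ` S)"
    using card_orbits_merge[of ?g S a b] f S by auto
  moreover have "?g \<circ> transpose a b = f" by (auto simp: fun_eq_iff)
  ultimately show ?thesis by simp
qed

lemma card_orbits_Diff_fixpoint:
  assumes f: "f permutes S" "finite S" and "a \<in> S" "f a = a"
  shows "card (orbit f ` S) = card (orbit f ` (S - {a})) + 1"
proof -
  have p: "permutation f" using f by (rule permutation_if_permutes)
  have a: "orbit f a = {a}" using assms by (simp add: orbit_eq_singleton_iff)
  have "orbit f ` S = insert {a} (orbit f ` (S - {a}))" using a assms(3) by auto
  moreover have "{a} \<notin> orbit f ` (S - {a})"
    using permutation_self_in_orbit[OF p] by force
  ultimately show ?thesis using f by simp
qed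

text \<open>A new element is a fixed point, and a transposition merges it into the cycle built so
  far. This provides the rotation at a single vertex.\<close>

lemma exists_cyclic_permutation:
  assumes "finite S" "S \<noteq> {}"
  shows "\<exists>f. f permutes S \<and> cyclic_on f S"
  using assms
proof (induction rule: finite_ne_induct)
  case (singleton x)
  have "cyclic_on id {x}"
    by (rule cyclic_on_singleI[of x]) (simp_all add: orbit_eq_singleton_iff[THEN iffD2])
  then show ?case using permutes_id by blast
next
  case (insert x S)
  then obtain f s where f: "f permutes S" and s: "s \<in> S" "S = orbit f s" by (auto simp: cyclic_on_def)
  have p: "permutation f" using f insert by (auto intro: permutation_if_permutes)
  have x: "orbit f x = {x}" using f insert by (auto simp: orbit_eq_singleton_iff permutes_def)
  have "s \<notin> orbit f x" using x s insert by auto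
  then have "orbit (f \<circ> transpose x s) x = {x} \<union> S"
    using orbit_comp_transpose_merge(1)[OF p] x s by auto
  then have "cyclic_on (f \<circ> transpose x s) (insert x S)"
    by (intro cyclic_on_singleI[of x]) simp_all
  moreover have "f permutes insert x S" using f by (rule permutes_subset) auto
  then have "f \<circ> transpose x s permutes insert x S"
    using s by (intro permutes_compose permutes_swap_id) auto
  ultimately show ?case by blast
qed

section \<open>Connected components when an edge is added\<close>

definition comps :: "'a set \<Rightarrow> 'a rel \<Rightarrow> 'a set set" where
  "comps V A = (\<lambda>x. A\<^sup>* `` {x}) ` V"

lemma rtrancl_Image_eq:
  assumes "sym A" "(x, y) \<in> A\<^sup>*"
  shows "A\<^sup>* `` {x} = A\<^sup>* `` {y}"
proof -
  have "(y, x) \<in> A\<^sup>*" using assms by (meson sym_rtrancl symD)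
  then show ?thesis using assms(2) by (auto intro: rtrancl_trans)
qed

lemma rtrancl_insert_edge:
  assumes A: "sym A" and nuv: "x \<notin> A\<^sup>* `` {u}" "x \<notin> A\<^sup>* `` {v}"
  shows "(insert (u, v) (insert (v, u) A))\<^sup>* `` {x} = A\<^sup>* `` {x}"
proof
  show "A\<^sup>* `` {x} \<subseteq> (insert (u, v) (insert (v, u) A))\<^sup>* `` {x}"
    using rtrancl_mono[of A "insert (u, v) (insert (v, u) A)"] by auto
  have ux: "u \<notin> A\<^sup>* `` {x}" "v \<notin> A\<^sup>* `` {x}"
    using A nuv by (auto dest: symD[OF sym_rtrancl])
  show "(insert (u, v) (insert (v, u) A))\<^sup>* `` {x} \<subseteq> A\<^sup>* `` {x}"
  proof
    fix y assume "y \<in> (insert (u, v) (insert (v, u) A))\<^sup>* `` {x}"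
    then have "(x, y) \<in> (insert (u, v) (insert (v, u) A))\<^sup>*" by auto
    then show "y \<in> A\<^sup>* `` {x}"
      by induct (use ux in \<open>auto intro: rtrancl.rtrancl_into_rtrancl\<close>)
  qed
qed

lemma comps_insert_edge_connected:
  assumes A: "sym A" and uv: "(u, v) \<in> A\<^sup>*"
  shows "comps V (insert (u, v) (insert (v, u) A)) = comps V A"
proof -
  have "(v, u) \<in> A\<^sup>*" using assms by (meson sym_rtrancl symD)
  then have "insert (u, v) (insert (v, u) A) \<subseteq> A\<^sup>*" using uv by auto
  moreover have "A \<subseteq> insert (u, v) (insert (v, u) A)" by auto
  ultimately have "(insert (u, v) (insert (v, u) A))\<^sup>* = A\<^sup>*" by (metis rtrancl_subset)
  then show ?thesis by (simp add: comps_def)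
qed

lemma card_comps_insert_edge_disconnected:
  assumes A: "sym A" and uv: "(u, v) \<notin> A\<^sup>*" and V: "u \<in> V" "v \<in> V" "finite V"
  shows "card (comps V (insert (u, v) (insert (v, u) A))) + 1 = card (comps V A)"
proof -
  let ?B = "insert (u, v) (insert (v, u) A)"
  have B: "sym ?B" using A by (auto simp: sym_def)
  let ?U = "A\<^sup>* `` {u}" and ?W = "A\<^sup>* `` {v}"
  have AB: "A\<^sup>* \<subseteq> ?B\<^sup>*" by (rule rtrancl_mono) auto
  have U: "?B\<^sup>* `` {u} = ?U \<union> ?W"
  proof
    have "?B\<^sup>* `` {v} = ?B\<^sup>* `` {u}" using rtrancl_Image_eq[OF B, of v u] by auto
    then show "?U \<union> ?W \<subseteq> ?B\<^sup>* `` {u}" using AB by blast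
    show "?B\<^sup>* `` {u} \<subseteq> ?U \<union> ?W"
    proof
      fix y assume "y \<in> ?B\<^sup>* `` {u}"
      then have "(u, y) \<in> ?B\<^sup>*" by auto
      then show "y \<in> ?U \<union> ?W"
        by induct (auto intro: rtrancl.rtrancl_into_rtrancl)
    qed
  qed
  have X: "?B\<^sup>* `` {x} = ?U \<union> ?W" if "x \<in> ?U \<union> ?W" for x
    using rtrancl_Image_eq[OF B, of u x] that U by auto
  have Y: "?B\<^sup>* `` {x} = A\<^sup>* `` {x}" if "x \<notin> ?U \<union> ?W" for x
    using rtrancl_insert_edge[OF A] that by auto
  have "comps V ?B = insert (?U \<union> ?W) (comps V A - {?U, ?W})" (is "?L = ?R")
  proof
    show "?L \<subseteq> ?R"
    proof
      fix Q assume "Q \<in> ?L"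
      then obtain x where x: "x \<in> V" "Q = ?B\<^sup>* `` {x}" by (auto simp: comps_def)
      show "Q \<in> ?R"
      proof (cases "x \<in> ?U \<union> ?W")
        case True then show ?thesis using X x by auto
      next
        case False
        then have "Q = A\<^sup>* `` {x}" using Y x by auto
        moreover have "A\<^sup>* `` {x} \<noteq> ?U" "A\<^sup>* `` {x} \<noteq> ?W" using False by auto
        ultimately show ?thesis using x by (auto simp: comps_def)
      qed
    qed
    show "?R \<subseteq> ?L"
    proof
      fix Q assume "Q \<in> ?R"
      then consider "Q = ?U \<union> ?W" | x where "x \<in> V" "Q = A\<^sup>* `` {x}" "A\<^sup>* `` {x} \<noteq> ?U" "A\<^sup>* `` {x} \<noteq> ?W"
        by (auto simp: comps_def)
      then show "Q \<in> ?L"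
      proof cases
        case 1 then show ?thesis using U V by (auto simp: comps_def)
      next
        case 2
        then have "x \<notin> ?U \<union> ?W" using rtrancl_Image_eq[OF A] by auto
        then show ?thesis using Y[of x] 2 by (auto simp: comps_def)
      qed
    qed
  qed
  moreover have "card (insert (?U \<union> ?W) (comps V A - {?U, ?W})) + 1 = card (comps V A)"
  proof (rule card_merge_blocks)
    show "?U \<noteq> ?W" using uv by auto
    show "C \<inter> D = {}" if "C \<in> comps V A" "D \<in> comps V A" "C \<noteq> D" for C D
      using that rtrancl_Image_eq[OF A] unfolding comps_def by blast
  qed (use V in \<open>auto simp: comps_def\<close>)
  ultimately show ?thesis by simp
qed

text \<open>Removes \<open>a\<close> from its cycle and makes it a fixed point.\<close>

definition bypass :: "'a \<Rightarrow> ('a \<Rightarrow> 'a) \<Rightarrow> 'a \<Rightarrow> 'a" where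
  "bypass a f = f \<circ> transpose a (inv f a)"

lemma bypass_apply:
  assumes "bij f"
  shows "bypass a f x = (if x = a then a else if f x = a then f a else f x)"
proof -
  have "f (inv f a) = a" using assms by (simp add: bij_is_surj surj_f_inv_f)
  moreover have "x = inv f a \<longleftrightarrow> f x = a" using assms by (metis bij_inv_eq_iff)
  ultimately show ?thesis by (auto simp: bypass_def transpose_def)
qed

lemma bypass_permutes:
  assumes f: "f permutes S"
  shows "bypass a f permutes S - {a}"
proof -
  have bij: "bij f" using f by (rule permutes_bij)
  have "inv f a \<in> S" if "a \<in> S" using permutes_in_image[OF permutes_inv[OF f]] that by simp
  moreover have "inv f a = a" if "a \<notin> S" using permutes_not_in[OF permutes_inv[OF f]] that by simp
  ultimately have "bypass a f permutes S"
    unfolding bypass_def using f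
    by (cases "a \<in> S") (auto intro: permutes_compose permutes_swap_id)
  then show ?thesis
    by (rule permutes_superset) (auto simp: bypass_apply[OF bij])
qed

lemma inv_in_orbit:
  assumes "permutation f"
  shows "inv f a \<in> orbit f a"
proof -
  have "f (inv f a) = a" using assms by (simp add: permutation_bijective bij_is_surj surj_f_inv_f)
  then have "orbit f a = orbit f (inv f a)"
    using permutation_orbit_step[OF assms, of "inv f a"] by simp
  then show ?thesis using permutation_self_in_orbit[OF assms] by simp
qed

text \<open>Splitting \<open>{a}\<close> off its cycle adds an orbit, and leaving \<open>a\<close>
  out of the set removes it again. An orbit is lost only if \<open>a\<close> was a cycle by
  itself.\<close>

lemma card_orbits_bypass:
  assumes f: "f permutes S" "finite S" and a: "a \<in> S"
  shows "card (orbit (bypass a f) ` (S - {a})) + (if f a = a then 1 else 0) = card (orbit f ` S)"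
proof -
  have bij: "bij f" and p: "permutation f" using f permutes_bij permutation_if_permutes by blast+
  have perm: "bypass a f permutes S" using bypass_permutes[OF f(1)] by (rule permutes_subset) auto
  have "card (orbit (bypass a f) ` S) = card (orbit (bypass a f) ` (S - {a})) + 1"
    using perm f(2) a by (intro card_orbits_Diff_fixpoint) (auto simp: bypass_apply[OF bij])
  moreover have "card (orbit (bypass a f) ` S) = card (orbit f ` S) + (if f a = a then 0 else 1)"
  proof (cases "f a = a")
    case True
    then have "inv f a = a" using bij by (metis bij_inv_eq_iff)
    then show ?thesis using True by (simp add: bypass_def)
  next
    case False
    then have "inv f a \<noteq> a" using bij by (metis bij_inv_eq_iff)
    moreover have "inv f a \<in> S" using permutes_in_image[OF permutes_inv[OF f(1)]] a by simp
    ultimately show ?thesis unfolding bypass_def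
      using card_orbits_split[OF f a _ inv_in_orbit[OF p]] False by auto
  qed
  ultimately show ?thesis by (simp split: if_splits)
qed

text \<open>Merging the singleton \<open>{a}\<close> back into the cycle of its predecessor restores
  \<open>f\<close>, so the merge lemma expresses the orbits of \<open>f\<close> by those of
  \<open>bypass a f\<close>.\<close>

lemma orbit_bypass:
  assumes f: "permutation f" and x: "x \<noteq> a"
  shows "orbit (bypass a f) x = orbit f x - {a}"
proof (cases "f a = a")
  case True
  then have "inv f a = a" using f by (metis bij_inv_eq_iff permutation_bijective)
  then have "bypass a f = f" by (simp add: bypass_def)
  moreover have "a \<notin> orbit f x"
  proof
    assume "a \<in> orbit f x"
    then have "orbit f x = orbit f a" using orbit_eq[OF f] by auto
    also have "\<dots> = {a}" using True by (simp add: orbit_eq_singleton_iff)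
    finally show False using x permutation_self_in_orbit[OF f, of x] by auto
  qed
  ultimately show ?thesis by auto
next
  case False
  let ?g = "bypass a f" and ?p = "inv f a"
  have bij: "bij f" using f by (simp add: permutation_bijective)
  have g: "permutation ?g" unfolding bypass_def using f by (simp add: permutation_compose permutation_swap_id)
  have pa: "?p \<noteq> a" using bij False by (metis bij_inv_eq_iff)
  have ga: "orbit ?g a = {a}" by (simp add: orbit_eq_singleton_iff bypass_apply[OF bij])
  then have n: "?p \<notin> orbit ?g a" using pa by simp
  have fg: "?g \<circ> transpose a ?p = f" by (auto simp: bypass_def fun_eq_iff)
  note m = orbit_comp_transpose_merge[OF g n, unfolded fg ga]
  have gp: "orbit ?g ?p = orbit f a - {a}"
  proof -
    have "a \<notin> orbit ?g ?p" using orbit_eq[OF g, of a ?p] ga permutation_self_in_orbit[OF g, of ?p] pa by auto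
    then show ?thesis using m(1) by auto
  qed
  show ?thesis
  proof (cases "x \<in> orbit ?g ?p")
    case True
    then have "x \<in> orbit f a" using m(1) by auto
    then show ?thesis using orbit_eq[OF g True] orbit_eq[OF f] gp by auto
  next
    case F: False
    then have "orbit f x = orbit ?g x" using m(3) x by auto
    moreover have "a \<notin> orbit ?g x" using orbit_eq[OF g, of a x] ga permutation_self_in_orbit[OF g, of x] x by auto
    ultimately show ?thesis by auto
  qed
qed

section \<open>Deleting edges does not increase the genus\<close>

definition ugraph :: "'a set \<Rightarrow> 'a rel \<Rightarrow> bool" where
  "ugraph V A \<longleftrightarrow> finite V \<and> A \<subseteq> V \<times> V \<and> sym A \<and> irrefl A"

lemma ugraph_finite: "ugraph V A \<Longrightarrow> finite A"
  unfolding ugraph_def by (auto intro: finite_subset)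

definition rotation :: "'a set \<Rightarrow> 'a rel \<Rightarrow> ('a \<times> 'a \<Rightarrow> 'a \<times> 'a) \<Rightarrow> bool" where
  "rotation V A \<pi> \<longleftrightarrow> \<pi> permutes A \<and>
     (\<forall>v\<in>V. {a \<in> A. fst a = v} \<noteq> {} \<longrightarrow> cyclic_on \<pi> {a \<in> A. fst a = v})"

text \<open>The identity off \<open>A\<close>: there \<open>\<pi> \<circ> prod.swap\<close> would
  still reverse arcs and thus not be a permutation of \<open>A\<close> in the sense of
  \<open>permutes\<close>.\<close>

definition face_perm :: "'a rel \<Rightarrow> ('a \<times> 'a \<Rightarrow> 'a \<times> 'a) \<Rightarrow> 'a \<times> 'a \<Rightarrow> 'a \<times> 'a" where
  "face_perm A \<pi> a = (if a \<in> A then \<pi> (prod.swap a) else a)"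

definition isolated :: "'a set \<Rightarrow> 'a rel \<Rightarrow> 'a set" where
  "isolated V A = {v \<in> V. {a \<in> A. fst a = v} = {}}"

text \<open>This is \<open>- 2 g\<close> for an embedding of genus \<open>g\<close>.\<close>

definition euler_defect :: "'a set \<Rightarrow> 'a rel \<Rightarrow> ('a \<times> 'a \<Rightarrow> 'a \<times> 'a) \<Rightarrow> int" where
  "euler_defect V A \<pi> = int (card V) - int (card A div 2) + int (card (orbit (face_perm A \<pi>) ` A))
     + int (card (isolated V A)) - 2 * int (card (comps V A))"

lemma rotation_orbit:
  assumes "ugraph V A" "rotation V A \<pi>" "a \<in> A"
  shows "orbit \<pi> a = {b \<in> A. fst b = fst a}"
proof -
  have "fst a \<in> V" using assms by (auto simp: ugraph_def)
  moreover have "a \<in> {b \<in> A. fst b = fst a}" using assms by auto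
  ultimately have "cyclic_on \<pi> {b \<in> A. fst b = fst a}" using assms(2) unfolding rotation_def by blast
  then show ?thesis using assms(3) orbit_cyclic_eq3 by fastforce
qed

lemma rotation_apply:
  assumes "ugraph V A" "rotation V A \<pi>" "a \<in> A"
  shows "\<pi> a \<in> A" "fst (\<pi> a) = fst a"
proof -
  have "\<pi> a \<in> orbit \<pi> a" by (rule orbit.base)
  then show "\<pi> a \<in> A" "fst (\<pi> a) = fst a" unfolding rotation_orbit[OF assms] by auto
qed

text \<open>Degree 1 shows up as a fixed point of \<open>\<pi>\<close>. This detects vertices that
  become isolated in \<open>delete_edge\<close> and, later, dead ends of face walks.\<close>

lemma rotation_fixed_iff:
  assumes "ugraph V A" "rotation V A \<pi>" "a \<in> A"
  shows "\<pi> a = a \<longleftrightarrow> {b \<in> A. fst b = fst a} = {a}"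
  using rotation_orbit[OF assms] orbit_eq_singleton_iff[of \<pi> a] by simp

lemma swap_in: "sym A \<Longrightarrow> a \<in> A \<Longrightarrow> prod.swap a \<in> A"
  by (cases a) (auto dest: symD)

lemma face_perm_permutes:
  assumes "ugraph V A" "rotation V A \<pi>"
  shows "face_perm A \<pi> permutes A"
proof (rule bij_imp_permutes)
  have pi: "\<pi> permutes A" and A: "sym A" using assms by (auto simp: rotation_def ugraph_def)
  have inj: "inj_on (face_perm A \<pi>) A"
  proof (rule inj_onI)
    fix x y assume "x \<in> A" "y \<in> A" "face_perm A \<pi> x = face_perm A \<pi> y"
    then have "prod.swap x = prod.swap y"
      using permutes_inj[OF pi] by (auto simp: face_perm_def dest: injD)
    then show "x = y" by (cases x; cases y) auto
  qed
  moreover have "face_perm A \<pi> ` A \<subseteq> A"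
    using permutes_in_image[OF pi] swap_in[OF A] by (auto simp: face_perm_def)
  ultimately show "bij_betw (face_perm A \<pi>) A A"
    using endo_inj_surj[of A "face_perm A \<pi>"] ugraph_finite[OF assms(1)] by (simp add: bij_betw_def)
qed (simp add: face_perm_def)

lemma ugraph_delete:
  assumes "ugraph V A"
  shows "ugraph V (A - {(u, v), (v, u)})"
  using assms by (auto simp: ugraph_def sym_def irrefl_def)

text \<open>Let \<open>a\<close> and \<open>b\<close> be the two arcs of the edge and \<open>\<phi>\<close> the face permutation. The new face permutation
  is \<open>\<phi> \<circ> transpose a b\<close> with \<open>a\<close> and \<open>b\<close> bypassed. If \<open>a\<close> and \<open>b\<close> lie on the same face, this
  face is split, and at most one component is split. Otherwise their faces are merged, and the rest of the boundary of one
  of them connects the endpoints of the edge.\<close>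

lemma delete_edge:
  assumes G: "ugraph V A" and R: "rotation V A \<pi>" and uv: "(u, v) \<in> A"
  defines "A' \<equiv> A - {(u, v), (v, u)}"
  shows "\<exists>\<pi>'. rotation V A' \<pi>' \<and>
    (euler_defect V A' \<pi>' = euler_defect V A \<pi> \<or> euler_defect V A' \<pi>' = euler_defect V A \<pi> + 2)"
proof -
  define a where "a = (u, v)"
  define b where "b = (v, u)"
  have A: "finite V" "A \<subseteq> V \<times> V" "sym A" "irrefl A" "finite A"
    using G ugraph_finite[OF G] by (auto simp: ugraph_def)
  have aA: "a \<in> A" and bA: "b \<in> A" using uv A by (auto simp: a_def b_def dest: symD)
  have ne: "u \<noteq> v" using uv A(4) by (auto simp: irrefl_def)
  have ab: "a \<noteq> b" using ne by (auto simp: a_def b_def)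
  have A': "A' = A - {a} - {b}" by (auto simp: A'_def a_def b_def)
  have G': "ugraph V A'" unfolding A'_def using G by (rule ugraph_delete)
  have pi: "\<pi> permutes A" using R by (simp add: rotation_def)
  have bij: "bij \<pi>" using pi by (rule permutes_bij)
  have ppi: "permutation \<pi>" using pi A by (auto intro: permutation_if_permutes)
  have pa: "\<pi> a \<noteq> b" and pb: "\<pi> b \<noteq> a"
    using rotation_apply(2)[OF G R aA] rotation_apply(2)[OF G R bA] ne by (auto simp: a_def b_def)
  define \<phi> where "\<phi> = face_perm A \<pi>"
  define \<psi> where "\<psi> = \<phi> \<circ> transpose a b"
  define \<pi>' where "\<pi>' = bypass b (bypass a \<pi>)"
  have phi: "\<phi> permutes A" unfolding \<phi>_def by (rule face_perm_permutes[OF G R])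
  have psi: "\<psi> permutes A" unfolding \<psi>_def using phi aA bA by (intro permutes_compose permutes_swap_id)
  have psi_bij: "bij \<psi>" using psi by (rule permutes_bij)
  have s1: "bypass a \<pi> permutes A - {a}" by (rule bypass_permutes[OF pi])
  have s1': "permutation (bypass a \<pi>)" using s1 A by (auto intro: permutation_if_permutes)
  have b1: "bij (bypass a \<pi>)" using s1 by (rule permutes_bij)
  have pi': "\<pi>' permutes A'" unfolding \<pi>'_def A' by (rule bypass_permutes[OF s1])
  have t1: "bypass a \<psi> permutes A - {a}" by (rule bypass_permutes[OF psi])
  have b2: "bij (bypass a \<psi>)" using t1 by (rule permutes_bij)
  have sab: "prod.swap a = b" "prod.swap b = a" by (auto simp: a_def b_def)
  have psi_a: "\<psi> a = \<pi> a" and psi_b: "\<psi> b = \<pi> b"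
    using aA bA by (auto simp: \<psi>_def \<phi>_def face_perm_def sab)
  have psi_x: "\<psi> x = (if x \<in> A then \<pi> (prod.swap x) else x)" if "x \<noteq> a" "x \<noteq> b" for x
    using that by (auto simp: \<psi>_def \<phi>_def face_perm_def transpose_def)
  \<comment> \<open>The transposition makes \<open>\<psi> a = \<pi> a\<close>. So an arc whose face
    successor was \<open>a\<close> continues with \<open>\<pi> a\<close> once \<open>a\<close> is
    bypassed, just as the bypassed rotation demands; likewise for \<open>b\<close>.\<close>
  have face': "face_perm A' \<pi>' = bypass b (bypass a \<psi>)"
  proof
    fix x
    show "face_perm A' \<pi>' x = bypass b (bypass a \<psi>) x"
    proof (cases "x \<in> A'")
      case True
      then have x: "x \<in> A" "x \<noteq> a" "x \<noteq> b" by (auto simp: A')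
      then have "prod.swap x \<noteq> a" "prod.swap x \<noteq> b" by (cases x; auto simp: a_def b_def)+
      then show ?thesis using True x pa pb ab
        by (auto simp: face_perm_def \<pi>'_def bypass_apply[OF b1] bypass_apply[OF b2] bypass_apply[OF bij]
            bypass_apply[OF psi_bij] psi_a psi_b psi_x)
    next
      case False
      then show ?thesis
        using permutes_not_in[OF bypass_permutes[OF t1, of b, folded A'] False] by (simp add: face_perm_def)
    qed
  qed
  have orb': "orbit \<pi>' x = {c \<in> A'. fst c = fst x}" if x: "x \<in> A'" for x
  proof -
    have "x \<noteq> a" "x \<noteq> b" "x \<in> A" using x by (auto simp: A')
    then have "orbit \<pi>' x = orbit \<pi> x - {a} - {b}"
      unfolding \<pi>'_def by (simp add: orbit_bypass[OF s1'] orbit_bypass[OF ppi])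
    then show ?thesis using rotation_orbit[OF G R \<open>x \<in> A\<close>] by (auto simp: A')
  qed
  have R': "rotation V A' \<pi>'"
    unfolding rotation_def
  proof (intro conjI ballI impI pi')
    fix w assume "{x \<in> A'. fst x = w} \<noteq> {}"
    then obtain x where x: "x \<in> A'" "fst x = w" by auto
    then show "cyclic_on \<pi>' {x \<in> A'. fst x = w}"
      using orb'[OF x(1)] by (intro cyclic_on_singleI[of x]) auto
  qed
  \<comment> \<open>An endpoint that loses its last arc costs one orbit of \<open>\<psi>\<close> but
    gains the face of an isolated vertex. The two corrections in \<open>iso\<close> and
    \<open>faces\<close> cancel.\<close>
  let ?da = "if \<pi> a = a then 1 else 0 :: nat" and ?db = "if \<pi> b = b then 1 else 0 :: nat"
  have iso: "card (isolated V A') = card (isolated V A) + ?da + ?db"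
  proof -
    have uV: "u \<in> V" "v \<in> V" using uv A by auto
    let ?U = "if \<pi> a = a then {u} else {}" and ?W = "if \<pi> b = b then {v} else {}"
    have "{x \<in> A'. fst x = u} = {x \<in> A. fst x = u} - {a}"
      using ne unfolding A' a_def b_def by fastforce
    moreover have "a \<in> {x \<in> A. fst x = u}" using aA by (simp add: a_def)
    moreover have "\<pi> a = a \<longleftrightarrow> {x \<in> A. fst x = u} = {a}"
      using rotation_fixed_iff[OF G R aA] by (simp add: a_def)
    ultimately have da: "\<pi> a = a \<longleftrightarrow> {x \<in> A'. fst x = u} = {}" by blast
    have "{x \<in> A'. fst x = v} = {x \<in> A. fst x = v} - {b}"
      using ne unfolding A' a_def b_def by fastforce
    moreover have "b \<in> {x \<in> A. fst x = v}" using bA by (simp add: b_def)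
    moreover have "\<pi> b = b \<longleftrightarrow> {x \<in> A. fst x = v} = {b}"
      using rotation_fixed_iff[OF G R bA] by (simp add: b_def)
    ultimately have db: "\<pi> b = b \<longleftrightarrow> {x \<in> A'. fst x = v} = {}" by blast
    have "w \<in> isolated V A' \<longleftrightarrow> w \<in> isolated V A \<union> ?U \<union> ?W" for w
    proof -
      consider "w = u" | "w = v" | "w \<noteq> u" "w \<noteq> v" by blast
      then show ?thesis
      proof cases
        case 1
        then show ?thesis using da uV aA ne by (auto simp: isolated_def a_def)
      next
        case 2
        then show ?thesis using db uV bA ne by (auto simp: isolated_def b_def)
      next
        case 3
        then have eq: "{x \<in> A'. fst x = w} = {x \<in> A. fst x = w}" by (auto simp: A' a_def b_def)
        have "w \<in> isolated V A' \<longleftrightarrow> w \<in> isolated V A" unfolding isolated_def mem_Collect_eq eq ..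
        then show ?thesis using 3 by auto
      qed
    qed
    then have eq: "isolated V A' = isolated V A \<union> ?U \<union> ?W" by blast
    have "u \<notin> isolated V A" "v \<notin> isolated V A" using aA bA by (auto simp: isolated_def a_def b_def)
    moreover have "finite (isolated V A)" using A by (simp add: isolated_def)
    ultimately show ?thesis unfolding eq using ne by (auto simp: card_insert_if)
  qed
  have faces: "card (orbit (face_perm A' \<pi>') ` A') + ?da + ?db = card (orbit \<psi> ` A)"
  proof -
    have "card (orbit (bypass b (bypass a \<psi>)) ` (A - {a} - {b})) + (if bypass a \<psi> b = b then 1 else 0)
      = card (orbit (bypass a \<psi>) ` (A - {a}))"
      using t1 A bA ab by (intro card_orbits_bypass) auto
    moreover have "card (orbit (bypass a \<psi>) ` (A - {a})) + (if \<psi> a = a then 1 else 0) = card (orbit \<psi> ` A)"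
      using psi A aA by (intro card_orbits_bypass) auto
    moreover have "bypass a \<psi> b = \<pi> b" using ab pb by (auto simp: bypass_apply[OF psi_bij] psi_b)
    ultimately show ?thesis unfolding face' unfolding A' psi_a by simp
  qed
  have cA: "card A = card A' + 2"
  proof -
    have "A' = A - {a, b}" by (auto simp: A')
    then show ?thesis using card_Diff_subset[of "{a, b}" A] card_mono[of A "{a, b}"] A aA bA ab by auto
  qed
  have Ains: "A = insert (u, v) (insert (v, u) A')" using aA bA by (auto simp: A' a_def b_def)
  have symA': "sym A'" using G' by (simp add: ugraph_def)
  have uV: "u \<in> V" "v \<in> V" using uv A by auto
  have pphi: "permutation \<phi>" using phi A by (auto intro: permutation_if_permutes)
  \<comment> \<open>The \<open>1\<close> stems from the deleted edge. What remains is to compare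
    face counts and component counts.\<close>
  have chi: "euler_defect V A' \<pi>' = euler_defect V A \<pi> + 1
      + (int (card (orbit \<psi> ` A)) - int (card (orbit \<phi> ` A)))
      + 2 * (int (card (comps V A)) - int (card (comps V A')))"
    unfolding euler_defect_def \<phi>_def[symmetric] using iso faces cA by simp
  show ?thesis
  proof (cases "b \<in> orbit \<phi> a")
    case True
    have "card (orbit \<psi> ` A) = card (orbit \<phi> ` A) + 1"
      unfolding \<psi>_def using card_orbits_split[OF phi A(5) aA bA True ab] .
    moreover have "card (comps V A') = card (comps V A) \<or> card (comps V A') = card (comps V A) + 1"
      using comps_insert_edge_connected[OF symA', of u v V]
        card_comps_insert_edge_disconnected[OF symA', of u v V] uV A(1) Ains by metis
    ultimately show ?thesis using R' chi by (intro exI[of _ \<pi>']) auto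
  next
    case False
    \<comment> \<open>Consecutive arcs of a face share a vertex, and \<open>b\<close> is not on this
      face. So the part of the face after \<open>a\<close> is a walk in \<open>A'\<close> that
      starts at \<open>v\<close> and comes back to the tail \<open>u\<close> of
      \<open>a\<close>.\<close>
    have "(v, fst y) \<in> A'\<^sup>*" if "y \<in> orbit \<phi> a" for y
      using that
    proof induct
      case base
      show ?case using aA rotation_apply(2)[OF G R bA] by (simp add: \<phi>_def face_perm_def sab) (simp add: b_def)
    next
      case (step y)
      have yA: "y \<in> A" using permutes_orbit_subset[OF phi aA] step(1) by auto
      have fy: "fst (\<phi> y) = snd y"
        using yA rotation_apply(2)[OF G R swap_in[OF A(3) yA]] by (simp add: \<phi>_def face_perm_def)
      show ?case
      proof (cases "y = a")
        case True
        then show ?thesis unfolding fy by (simp add: a_def)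
      next
        case F: False
        then have "y \<in> A'" using yA False step(1) by (auto simp: A')
        then have "(fst y, snd y) \<in> A'" by simp
        then show ?thesis unfolding fy using step(2) by (rule rtrancl_into_rtrancl[rotated])
      qed
    qed
    from this[OF permutation_self_in_orbit[OF pphi]] have "(v, u) \<in> A'\<^sup>*" by (simp add: a_def)
    then have "(u, v) \<in> A'\<^sup>*" using symA' by (meson sym_rtrancl symD)
    then have "comps V A = comps V A'" using comps_insert_edge_connected[OF symA'] Ains by metis
    moreover have "card (orbit \<psi> ` A) + 1 = card (orbit \<phi> ` A)"
      unfolding \<psi>_def using card_orbits_merge[OF phi A(5) aA bA False] .
    ultimately show ?thesis using R' chi by (intro exI[of _ \<pi>']) auto
  qed
qed

lemma euler_defect_empty: "finite V \<Longrightarrow> euler_defect V {} \<pi> = 0"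
proof -
  assume "finite V"
  have "comps V {} = (\<lambda>x. {x}) ` V" by (auto simp: comps_def)
  then have "card (comps V {}) = card V" by (simp add: card_image)
  then show ?thesis by (simp add: euler_defect_def isolated_def)
qed

text \<open>Edges are deleted one at a time while the vertex set stays fixed. Parity is carried
  along so that comparison with the edgeless graph shows every defect to be even.\<close>

lemma subgraph_rotation:
  assumes "ugraph V A" "rotation V A \<pi>" "D \<subseteq> A" "sym D"
  shows "\<exists>\<pi>'. rotation V D \<pi>' \<and> euler_defect V A \<pi> \<le> euler_defect V D \<pi>' \<and>
    even (euler_defect V D \<pi>' - euler_defect V A \<pi>)"
  using assms
proof (induction "card (A - D)" arbitrary: A \<pi> rule: less_induct)
  case less
  show ?case
  proof (cases "A = D")
    case True
    then show ?thesis using less.prems by (intro exI[of _ \<pi>]) auto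
  next
    case False
    then obtain u v where uv: "(u, v) \<in> A" "(u, v) \<notin> D" using less.prems by auto
    define A' where "A' = A - {(u, v), (v, u)}"
    have DA': "D \<subseteq> A'" using uv less.prems(3,4) by (auto simp: A'_def dest: symD)
    obtain \<pi>' where p': "rotation V A' \<pi>'"
      "euler_defect V A' \<pi>' = euler_defect V A \<pi> \<or> euler_defect V A' \<pi>' = euler_defect V A \<pi> + 2"
      using delete_edge[OF less.prems(1,2) uv(1)] unfolding A'_def by blast
    have "A' - D \<subset> A - D" using uv by (auto simp: A'_def)
    then have "card (A' - D) < card (A - D)"
      using ugraph_finite[OF less.prems(1)] by (intro psubset_card_mono) auto
    from less.hyps[OF this _ p'(1) DA' less.prems(4)] obtain \<pi>'' where
      "rotation V D \<pi>''" "euler_defect V A' \<pi>' \<le> euler_defect V D \<pi>''"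
      "even (euler_defect V D \<pi>'' - euler_defect V A' \<pi>')"
      using ugraph_delete[OF less.prems(1)] unfolding A'_def by blast
    then show ?thesis using p'(2) by (intro exI[of _ \<pi>'']) auto
  qed
qed

text \<open>The edgeless graph has defect 0, and deleting all edges changes the defect by a
  nonnegative even number. Every rotation thus has a genus that is a natural number.\<close>

lemma euler_defect_even_nonpos:
  assumes "ugraph V A" "rotation V A \<pi>"
  shows "\<exists>g::nat. euler_defect V A \<pi> = - 2 * int g"
proof -
  obtain \<pi>' where "euler_defect V A \<pi> \<le> euler_defect V {} \<pi>'"
    "even (euler_defect V {} \<pi>' - euler_defect V A \<pi>)"
    using subgraph_rotation[OF assms, of "{}"] by (auto simp: sym_def)
  moreover have "euler_defect V {} \<pi>' = 0" using assms(1) by (intro euler_defect_empty) (simp add: ugraph_def)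
  ultimately have "euler_defect V A \<pi> \<le> 0" "even (euler_defect V A \<pi>)" by simp_all
  then obtain k where k: "euler_defect V A \<pi> = 2 * k" "k \<le> 0" by (auto elim!: evenE)
  then show ?thesis by (intro exI[of _ "nat (- k)"]) auto
qed

lemma exists_rotation:
  assumes "ugraph V A"
  shows "\<exists>\<pi>. rotation V A \<pi>"
proof -
  define out where "out v = {a \<in> A. fst a = v}" for v
  have fin: "finite (out v)" for v using ugraph_finite[OF assms] by (simp add: out_def)
  have "\<forall>v. \<exists>f. out v \<noteq> {} \<longrightarrow> f permutes out v \<and> cyclic_on f (out v)"
    using exists_cyclic_permutation[OF fin] by blast
  then obtain f where f: "\<And>v. out v \<noteq> {} \<Longrightarrow> f v permutes out v \<and> cyclic_on (f v) (out v)" by metis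
  define \<pi> where "\<pi> a = (if a \<in> A then f (fst a) a else a)" for a
  have in_out: "\<pi> a \<in> out (fst a)" if "a \<in> A" for a
  proof -
    have "a \<in> out (fst a)" using that by (simp add: out_def)
    then have "f (fst a) a \<in> out (fst a)" using f permutes_in_image by fastforce
    then show ?thesis using that by (simp add: \<pi>_def)
  qed
  have inj: "inj_on \<pi> A"
  proof (rule inj_onI)
    fix x y assume xy: "x \<in> A" "y \<in> A" "\<pi> x = \<pi> y"
    then have "fst x = fst y" using in_out[of x] in_out[of y] by (auto simp: out_def)
    moreover have "x \<in> out (fst x)" using xy by (simp add: out_def)
    then have "f (fst x) permutes out (fst x)" using f by blast
    ultimately show "x = y" using xy permutes_inj[of "f (fst x)"] by (auto simp: \<pi>_def dest: injD)
  qed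
  have "\<pi> permutes A"
  proof (rule bij_imp_permutes)
    have "\<pi> ` A \<subseteq> A" using in_out by (auto simp: out_def)
    then show "bij_betw \<pi> A A"
      using endo_inj_surj[of A \<pi>] inj ugraph_finite[OF assms] by (simp add: bij_betw_def)
  qed (simp add: \<pi>_def)
  moreover have "cyclic_on \<pi> (out v)" if "out v \<noteq> {}" for v
  proof -
    have "cyclic_on \<pi> (out v) = cyclic_on (f v) (out v)"
      by (rule cyclic_cong) (auto simp: \<pi>_def out_def)
    then show ?thesis using f[OF that] by simp
  qed
  ultimately show ?thesis unfolding rotation_def out_def by blast
qed

section \<open>Sparsity of bipartite graphs of bounded genus\<close>

lemma card_isolated_le_comps:
  assumes "finite V" "A \<subseteq> V \<times> V"
  shows "card (isolated V A) \<le> card (comps V A)"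
proof (rule card_inj_on_le[where f = "\<lambda>x. {x}"])
  show "(\<lambda>x. {x}) ` isolated V A \<subseteq> comps V A"
  proof clarify
    fix x assume x: "x \<in> isolated V A"
    then have "x \<notin> Domain A" by (auto simp: isolated_def)
    then have "A\<^sup>* `` {x} = {x}" by (auto elim: converse_rtranclE)
    then show "{x} \<in> comps V A" using x by (force simp: comps_def isolated_def)
  qed
qed (use assms in \<open>auto simp: comps_def\<close>)

text \<open>A vertex outside \<open>X \<union> Y\<close> is isolated. It counts once as a vertex,
  once as a face and twice as a component, so it drops out of Euler's formula; this is why
  \<open>V\<close> may be much larger than \<open>X \<union> Y\<close>.\<close>

lemma bipartite_subgraph_faces:
  assumes G: "ugraph V A" "rotation V A \<pi>" "euler_defect V A \<pi> = - 2 * int g"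
    and B: "B \<subseteq> A" "B \<subseteq> X \<times> Y" "X \<inter> Y = {}" "finite X" "finite Y"
  shows "\<exists>\<pi>'. ugraph V (B \<union> B\<inverse>) \<and> rotation V (B \<union> B\<inverse>) \<pi>' \<and>
    card B \<le> card X + card Y + card (orbit (face_perm (B \<union> B\<inverse>) \<pi>') ` (B \<union> B\<inverse>)) + 2 * g"
proof -
  let ?D = "B \<union> B\<inverse>"
  have DA: "?D \<subseteq> A" using B(1) G(1) by (auto simp: ugraph_def dest: symD)
  have sym: "sym ?D" by (auto simp: sym_def)
  have uD: "ugraph V ?D" using G(1) DA sym by (auto simp: ugraph_def irrefl_def)
  obtain \<pi>' where R: "rotation V ?D \<pi>'" and le: "- 2 * int g \<le> euler_defect V ?D \<pi>'"
    using subgraph_rotation[OF G(1,2) DA sym] G(3) by auto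
  have fB: "finite B" using B by (meson finite_SigmaI finite_subset)
  have "B \<inter> B\<inverse> = {}" using B by auto
  then have cD: "card ?D = 2 * card B" using fB by (simp add: card_Un_disjoint card_inverse)
  have fV: "finite V" using G by (simp add: ugraph_def)
  have iso: "card (isolated V ?D) \<le> card (comps V ?D)"
    using card_isolated_le_comps[of V ?D] uD by (simp add: ugraph_def)
  have "V \<subseteq> isolated V ?D \<union> (X \<union> Y)" using B(2) by (auto simp: isolated_def)
  then have "card V \<le> card (isolated V ?D \<union> (X \<union> Y))"
    using fV B(4,5) by (intro card_mono) (auto simp: isolated_def)
  also have "\<dots> \<le> card (isolated V ?D) + (card X + card Y)"
    by (meson card_Un_le add_left_mono order_trans)
  finally have "card V \<le> card (isolated V ?D) + (card X + card Y)" .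
  then show ?thesis using le iso cD uD R unfolding euler_defect_def by (intro exI[of _ \<pi>']) auto
qed

section \<open>Lengths of faces in bipartite graphs\<close>

lemma card_orbit_ge:
  assumes f: "permutation f" and "\<And>j. 0 < j \<Longrightarrow> j < q \<Longrightarrow> (f ^^ j) a \<noteq> a"
  shows "q \<le> card (orbit f a)"
proof -
  have inj: "inj f" using f by (simp add: permutation_bijective bij_is_inj)
  have "inj_on (\<lambda>i. (f ^^ i) a) {..<q}"
  proof (rule linorder_inj_onI)
    fix i j assume ij: "i < j" "i \<in> {..<q}" "j \<in> {..<q}"
    show "(f ^^ i) a \<noteq> (f ^^ j) a"
    proof
      assume "(f ^^ i) a = (f ^^ j) a"
      also have "\<dots> = (f ^^ i) ((f ^^ (j - i)) a)"
        using ij funpow_add[of i "j - i" f] by simp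
      finally have "a = (f ^^ (j - i)) a" by (rule injD[OF inj_fn[OF inj]])
      moreover have "0 < j - i" "j - i < q" using ij by auto
      ultimately show False using assms(2) by metis
    qed
  qed auto
  moreover have "(\<lambda>i. (f ^^ i) a) ` {..<q} \<subseteq> orbit f a"
    using funpow_in_orbit[OF permutation_self_in_orbit[OF f]] by auto
  moreover have "finite (orbit f a)" using finite_orbit permutation_self_in_orbit[OF f] by fast
  ultimately show ?thesis using card_inj_on_le by fastforce
qed

lemma card_large_orbits_le:
  assumes f: "f permutes S" "finite S" and P: "P \<subseteq> orbit f ` S" "\<And>Q. Q \<in> P \<Longrightarrow> q \<le> card Q"
  shows "q * card P \<le> card S"
proof -
  have p: "permutation f" using f by (rule permutation_if_permutes)
  have sub: "\<Union>P \<subseteq> S" using P(1) permutes_orbit_subset[OF f(1)] by auto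
  have "q * card P = (\<Sum>Q\<in>P. q)" by simp
  also have "\<dots> \<le> (\<Sum>Q\<in>P. card Q)" using P(2) by (rule sum_mono)
  also have "\<dots> = card (\<Union>P)"
  proof (rule card_Union_disjoint[symmetric])
    show "pairwise disjnt P"
    proof (rule pairwiseI)
      fix Q Q' assume "Q \<in> P" "Q' \<in> P" "Q \<noteq> Q'"
      moreover from this obtain x y where "Q = orbit f x" "Q' = orbit f y" using P(1) by blast
      ultimately show "disjnt Q Q'" using orbit_disjoint[OF p, of x y] by (simp add: disjnt_def)
    qed
    show "finite Q" if "Q \<in> P" for Q using that sub f(2) by (meson Union_upper finite_subset order_trans)
  qed
  also have "\<dots> \<le> card S" using sub f(2) by (rule card_mono[rotated])
  finally show ?thesis .
qed

text \<open>\<open>B\<close> lists each edge once, from the variable side \<open>X\<close> to the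
  clause side \<open>Y\<close>; faces consist of arcs in \<open>D\<close>, so their lengths add up
  to twice the number of edges.\<close>

locale bipartite_rotation =
  fixes V :: "'a set" and X Y :: "'a set" and B :: "'a rel" and \<pi>
  assumes B: "B \<subseteq> X \<times> Y" and XY: "X \<inter> Y = {}"
    and uD: "ugraph V (B \<union> B\<inverse>)" and R: "rotation V (B \<union> B\<inverse>) \<pi>"
begin

abbreviation "D \<equiv> B \<union> B\<inverse>"
abbreviation "f \<equiv> face_perm D \<pi>"

lemma f_permutes: "f permutes D"
  using face_perm_permutes[OF uD R] .

lemma f_permutation: "permutation f"
  using f_permutes ugraph_finite[OF uD] by (rule permutation_if_permutes)

lemma f_eq: "a \<in> D \<Longrightarrow> f a = \<pi> (prod.swap a)"
  by (simp add: face_perm_def)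

lemma f_in: "a \<in> D \<Longrightarrow> f a \<in> D"
  using permutes_in_image[OF f_permutes] by blast

lemma fst_f: "a \<in> D \<Longrightarrow> fst (f a) = snd a"
  using rotation_apply(2)[OF uD R, of "prod.swap a"] f_eq by (cases a) auto

lemma funpow_in: "a \<in> D \<Longrightarrow> (f ^^ j) a \<in> D"
  by (induction j) (simp_all add: f_in del: Un_iff)

lemma sides: "a \<in> D \<Longrightarrow> fst a \<in> X \<longleftrightarrow> snd a \<in> Y" "a \<in> D \<Longrightarrow> snd a \<in> X \<longleftrightarrow> fst a \<in> Y"
  "a \<in> D \<Longrightarrow> fst a \<in> X \<longleftrightarrow> fst a \<notin> Y"
  using B XY by (cases a; auto)+

text \<open>Every step of a face walk changes sides; hence faces have even length.\<close>

lemma funpow_side: "a \<in> D \<Longrightarrow> fst ((f ^^ j) a) \<in> X \<longleftrightarrow> (fst a \<in> X \<longleftrightarrow> even j)"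
proof (induction j)
  case (Suc j)
  have "fst ((f ^^ Suc j) a) = snd ((f ^^ j) a)" using fst_f[OF funpow_in[OF Suc.prems, of j]] by simp
  then show ?case using sides[OF funpow_in[OF Suc.prems, of j]] Suc by auto
qed simp

lemma odd_period: "a \<in> D \<Longrightarrow> odd j \<Longrightarrow> (f ^^ j) a \<noteq> a"
  using funpow_side[of a j] by auto

lemma fixed_X:
  assumes "(x, y) \<in> B" "\<pi> (x, y) = (x, y)"
  shows "B `` {x} = {y}"
proof -
  have eq: "{b \<in> D. fst b = x} = {(x, y)}"
    using rotation_fixed_iff[OF uD R, of "(x, y)"] assms by simp
  have "z = y" if "(x, z) \<in> B" for z
  proof -
    have "(x, z) \<in> {b \<in> D. fst b = x}" using that by simp
    then show ?thesis unfolding eq by simp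
  qed
  then show ?thesis using assms(1) by blast
qed

text \<open>In a face of length 2 the walk turns back at both ends. So both ends have degree 1, one
  of them being a variable.\<close>

lemma period_2:
  assumes a: "a \<in> D" and deg: "\<And>x. x \<in> Domain B \<Longrightarrow> 2 \<le> card (B `` {x})"
  shows "f (f a) \<noteq> a"
proof
  assume eq: "f (f a) = a"
  obtain p q where pq: "a = (p, q)" by (cases a)
  have fa: "f a = (q, p)"
    using fst_f[OF a] fst_f[OF f_in[OF a]] eq by (cases "f a") (auto simp: pq)
  have 1: "\<pi> (q, p) = (q, p)" using f_eq[OF a] fa by (simp add: pq)
  have 2: "\<pi> (p, q) = (p, q)" using f_eq[OF f_in[OF a]] eq fa by (simp add: pq)
  consider "(p, q) \<in> B" | "(q, p) \<in> B" using a pq by auto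
  then show False
    by cases (use fixed_X 1 2 deg in fastforce)+
qed

text \<open>A face of length 4 would consist of two degree 2 variables with the same neighbours, unless it
  turns back at a clause of degree 1.\<close>

lemma period_4:
  assumes a: "a \<in> D" "fst a \<in> Y" "(f ^^ 4) a = a"
    and deg: "\<And>x. x \<in> Domain B \<Longrightarrow> card (B `` {x}) = 2"
    and inj: "inj_on (\<lambda>x. B `` {x}) (Domain B)"
  shows "fst (f (f a)) \<in> Y" "\<pi> (f (f a)) = f (f a)"
proof -
  have in1: "f a \<in> D" and in2: "f (f a) \<in> D" and in3: "f (f (f a)) \<in> D" using a f_in by blast+
  have f4: "f (f (f (f a))) = a" using a(3) by (simp add: eval_nat_numeral)
  obtain p q where pq: "a = (p, q)" by (cases a)
  obtain r where qr: "f a = (q, r)" using fst_f[OF a(1)] by (cases "f a") (auto simp: pq)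
  obtain s where rs: "f (f a) = (r, s)" using fst_f[OF in1] qr by (cases "f (f a)") auto
  have sp: "f (f (f a)) = (s, p)"
    using fst_f[OF in2] fst_f[OF in3] rs f4 pq by (cases "f (f (f a))") auto
  have p: "p \<in> Y" using a pq by simp
  have qp: "(q, p) \<in> B" using a pq p B XY by auto
  then have qX: "q \<in> X" using B by auto
  then have qrB: "(q, r) \<in> B" using in1 qr B XY by auto
  then have rY: "r \<in> Y" using B by auto
  then have srB: "(s, r) \<in> B" using in2 rs B XY by auto
  then have "s \<in> X" using B by auto
  then have spB: "(s, p) \<in> B" using in3 sp B XY by auto
  \<comment> \<open>If \<open>p = r\<close>, the walk turns back at the variable \<open>q\<close>,
    which then has degree 1.\<close>
  have "p \<noteq> r"
  proof
    assume "p = r"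
    then have "\<pi> (q, p) = (q, p)" using f_eq[OF a(1)] qr pq by simp
    then have "B `` {q} = {p}" using fixed_X qp by blast
    then show False using deg[of q] qp by (auto simp: Domain.simps)
  qed
  have two: "B `` {x} = {p, r}" if "(x, p) \<in> B" "(x, r) \<in> B" for x
  proof -
    have c: "card (B `` {x}) = 2" using deg that by auto
    then have "finite (B `` {x})" using card.infinite by fastforce
    moreover have "{p, r} \<subseteq> B `` {x}" using that by auto
    ultimately show ?thesis using card_subset_eq[of "B `` {x}" "{p, r}"] c \<open>p \<noteq> r\<close> by auto
  qed
  \<comment> \<open>Both variables are adjacent to exactly \<open>p\<close> and \<open>r\<close>, so
    they coincide and the walk turns back at \<open>r\<close>.\<close>
  have "q = s" using inj_onD[OF inj, of q s] two qp qrB srB spB by auto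
  then have "\<pi> (r, q) = (r, q)" using f_eq[OF in1] qr rs by simp
  then show "fst (f (f a)) \<in> Y" "\<pi> (f (f a)) = f (f a)" using rs rY \<open>q = s\<close> by auto
qed

text \<open>The only positive even length below 4 is 2, which \<open>period_2\<close>
  excludes.\<close>

lemma faces_deg_ge_2:
  assumes deg: "\<And>x. x \<in> Domain B \<Longrightarrow> 2 \<le> card (B `` {x})" and fB: "finite B"
  shows "2 * card (orbit f ` D) \<le> card B"
proof -
  have "4 * card (orbit f ` D) \<le> card D"
  proof (rule card_large_orbits_le[OF f_permutes ugraph_finite[OF uD] order_refl])
    fix Q assume "Q \<in> orbit f ` D"
    then obtain a where a: "a \<in> D" "Q = orbit f a" by auto
    have "(f ^^ j) a \<noteq> a" if "0 < j" "j < 4" for j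
    proof -
      from that have "odd j \<or> j = 2" by presburger
      then consider "odd j" | "j = 2" by blast
      then show ?thesis
        using odd_period[OF a(1)] period_2[OF a(1) deg] by cases (auto simp: numeral_2_eq_2)
    qed
    then show "4 \<le> card Q" unfolding a(2) by (rule card_orbit_ge[OF f_permutation])
  qed
  moreover have "card D \<le> 2 * card B"
    using card_Un_le[of B "B\<inverse>"] card_inverse[of B] fB by simp
  ultimately show ?thesis by linarith
qed

text \<open>Exceptional faces are charged to the degree 1 clauses on them. Only one arc leaves such
  a clause, so each clause is charged at most once.\<close>

lemma faces_deg_2:
  assumes deg: "\<And>x. x \<in> Domain B \<Longrightarrow> card (B `` {x}) = 2" and fB: "finite B" and fY: "finite Y"
    and inj: "inj_on (\<lambda>x. B `` {x}) (Domain B)"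
  shows "3 * card (orbit f ` D) \<le> card B + 3 * card Y"
proof -
  define bad where "bad Q \<longleftrightarrow> (\<exists>d\<in>Q. fst d \<in> Y \<and> \<pi> d = d)" for Q
  let ?Bad = "{Q \<in> orbit f ` D. bad Q}" and ?Good = "{Q \<in> orbit f ` D. \<not> bad Q}"
  have fD: "finite D" by (rule ugraph_finite[OF uD])
  have "?Bad \<subseteq> (\<lambda>y. orbit f (SOME d. d \<in> D \<and> fst d = y)) ` Y"
  proof clarify
    fix a assume a: "a \<in> D" "bad (orbit f a)"
    then obtain d where d: "d \<in> orbit f a" "fst d \<in> Y" "\<pi> d = d" by (auto simp: bad_def)
    have dD: "d \<in> D" using permutes_orbit_subset[OF f_permutes a(1)] d(1) by auto
    have eq: "{b \<in> D. fst b = fst d} = {d}" using rotation_fixed_iff[OF uD R dD] d(3) by simp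
    have "(SOME e. e \<in> D \<and> fst e = fst d) = d"
    proof (rule some_equality)
      show "e = d" if "e \<in> D \<and> fst e = fst d" for e using that eq by blast
    qed (use dD in simp)
    moreover have "orbit f a = orbit f d" using orbit_eq[OF f_permutation d(1)] by simp
    ultimately show "orbit f a \<in> (\<lambda>y. orbit f (SOME d. d \<in> D \<and> fst d = y)) ` Y"
      using d(2) by (intro image_eqI[of _ _ "fst d"]) auto
  qed
  then have bad: "card ?Bad \<le> card Y" using fY by (meson card_image_le card_mono finite_imageI order_trans)
  have good: "6 * card ?Good \<le> card D"
  proof (rule card_large_orbits_le[OF f_permutes fD])
    fix Q assume "Q \<in> ?Good"
    then obtain a where a: "a \<in> D" "Q = orbit f a" "\<not> bad (orbit f a)" by auto
    have not4: "(f ^^ 4) a \<noteq> a"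
    proof
      assume 4: "(f ^^ 4) a = a"
      \<comment> \<open>\<open>period_4\<close> expects a walk that starts at a clause, which is
        reached after at most one step along the face.\<close>
      define a' where "a' = (if fst a \<in> Y then a else f a)"
      have a': "a' \<in> D" "fst a' \<in> Y" "a' \<in> orbit f a"
        using a(1) f_in fst_f sides permutation_self_in_orbit[OF f_permutation] orbit.base[of f a]
        by (auto simp: a'_def)
      have "(f ^^ 4) a' = a'" using 4 by (auto simp: a'_def eval_nat_numeral)
      from period_4[OF a'(1,2) this deg inj] have "fst (f (f a')) \<in> Y" "\<pi> (f (f a')) = f (f a')" by auto
      moreover have "f (f a') \<in> orbit f a" using a'(3) by (blast intro: orbit.step)
      ultimately show False using a(3) unfolding bad_def by blast
    qed
    have "(f ^^ j) a \<noteq> a" if "0 < j" "j < 6" for j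
    proof -
      from that have "odd j \<or> j = 2 \<or> j = 4" by presburger
      then consider "odd j" | "j = 2" | "j = 4" by blast
      then show ?thesis
        using odd_period[OF a(1)] period_2[OF a(1)] deg not4 by cases (auto simp: numeral_2_eq_2)
    qed
    then show "6 \<le> card Q" unfolding a(2) by (rule card_orbit_ge[OF f_permutation])
  qed auto
  have "card (orbit f ` D) = card (?Bad \<union> ?Good)" by (rule arg_cong[where f = card]) blast
  also have "\<dots> \<le> card ?Bad + card ?Good" by (rule card_Un_le)
  finally have "card (orbit f ` D) \<le> card ?Bad + card ?Good" .
  moreover have "card D \<le> 2 * card B"
    using card_Un_le[of B "B\<inverse>"] card_inverse[of B] fB by simp
  ultimately show ?thesis using bad good by linarith
qed

end

lemma card_edges_ge:
  assumes "finite B" "\<And>x. x \<in> Domain B \<Longrightarrow> m \<le> card (B `` {x})"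
  shows "m * card (Domain B) \<le> card B"
proof -
  have eq: "B = (SIGMA x:Domain B. B `` {x})" by auto
  have "m * card (Domain B) \<le> (\<Sum>x\<in>Domain B. card (B `` {x}))"
    using sum_mono[of "Domain B" "\<lambda>_. m"] assms(2) by (simp add: mult.commute)
  also have "\<dots> = card (SIGMA x:Domain B. B `` {x})"
    using assms(1) by (intro card_SigmaI[symmetric]) (auto simp: finite_Domain intro: finite_subset[OF _ finite_Range])
  finally show ?thesis using eq by simp
qed

lemma card_edges_eq:
  assumes "finite B" "\<And>x. x \<in> Domain B \<Longrightarrow> card (B `` {x}) = m"
  shows "card B = m * card (Domain B)"
proof -
  have eq: "B = (SIGMA x:Domain B. B `` {x})" by auto
  have "card (SIGMA x:Domain B. B `` {x}) = (\<Sum>x\<in>Domain B. card (B `` {x}))"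
    using assms(1) by (intro card_SigmaI) (auto simp: finite_Domain intro: finite_subset[OF _ finite_Range])
  then show ?thesis using eq assms(2) by (simp add: mult.commute)
qed

text \<open>Variables of degree 1, of degree 2 and of degree at least 3 contribute
  \<open>1 + 12 + 6 = 19\<close> times \<open>card Y\<close> and \<open>0 + 12 + 12 = 24\<close>
  times \<open>g\<close>. Distinct neighbourhoods are essential for the first two kinds.\<close>

lemma bipartite_edges_le:
  assumes G: "ugraph V A" "rotation V A \<pi>" "euler_defect V A \<pi> = - 2 * int g"
    and B: "B \<subseteq> A" "B \<subseteq> X \<times> Y" "X \<inter> Y = {}" "finite Y"
    and inj: "inj_on (\<lambda>x. B `` {x}) (Domain B)"
  shows "card B \<le> 19 * card Y + 24 * g"
proof -
  have fB: "finite B" using B(1) ugraph_finite[OF G(1)] by (rule finite_subset)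
  have fim: "finite (B `` {x})" for x using fB by (auto intro: finite_subset[OF _ finite_Range])
  \<comment> \<open>Edges are selected by the degree of their variable in \<open>B\<close>. A
    variable is thus kept with all its neighbours or not at all, so degrees and distinctness of
    neighbourhoods survive the restriction.\<close>
  define r where "r P = {e \<in> B. P (card (B `` {fst e}))}" for P
  have im: "r P `` {x} = (if P (card (B `` {x})) then B `` {x} else {})" for P x by (auto simp: r_def)
  have fr: "finite (r P)" for P using fB by (simp add: r_def)
  have inj': "inj_on (\<lambda>x. r P `` {x}) (Domain (r P))" for P
  proof (rule inj_onI)
    fix x y assume xy: "x \<in> Domain (r P)" "y \<in> Domain (r P)" "r P `` {x} = r P `` {y}"
    then have "P (card (B `` {x}))" "P (card (B `` {y}))" "x \<in> Domain B" "y \<in> Domain B"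
      by (auto simp: r_def)
    then show "x = y" using xy(3) inj_onD[OF inj] by (simp add: im)
  qed
  have sub: "r P \<subseteq> A" "r P \<subseteq> Domain (r P) \<times> Y" "Domain (r P) \<inter> Y = {}" for P
    using B by (auto simp: r_def)
  have faces: "\<exists>\<pi>'. bipartite_rotation V (Domain (r P)) Y (r P) \<pi>' \<and>
    card (r P) \<le> card (Domain (r P)) + card Y + card (orbit (face_perm (r P \<union> (r P)\<inverse>) \<pi>') ` (r P \<union> (r P)\<inverse>)) + 2 * g" for P
    using bipartite_subgraph_faces[OF G sub(1,2,3)[of P]] fr B(4) sub(2,3)[of P]
    by (auto simp: finite_Domain bipartite_rotation_def)
  \<comment> \<open>Distinct neighbourhoods of size 1 are distinct neighbours.\<close>
  have 1: "card (r (\<lambda>d. d = 1)) \<le> card Y"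
  proof -
    let ?P = "\<lambda>d::nat. d = 1"
    have "inj_on snd (r ?P)"
    proof (rule inj_onI)
      fix d e assume de: "d \<in> r ?P" "e \<in> r ?P" "snd d = snd e"
      then have c: "card (B `` {fst d}) = 1" "card (B `` {fst e}) = 1" and "d \<in> B" "e \<in> B"
        by (auto simp: r_def)
      moreover from this have "snd d \<in> B `` {fst d}" "snd d \<in> B `` {fst e}"
        using de(3) by (auto simp: Image_def) (metis prod.collapse)+
      ultimately have "B `` {fst d} = B `` {fst e}" by (metis card_1_singletonE singletonD)
      then have "fst d = fst e" using inj \<open>d \<in> B\<close> \<open>e \<in> B\<close> by (auto simp: inj_on_def Domain_fst)
      then show "d = e" using de(3) by (simp add: prod_eq_iff)
    qed
    moreover have "snd ` r ?P \<subseteq> Y" using sub(2)[of ?P] by auto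
    ultimately show ?thesis using B(4) by (rule card_inj_on_le)
  qed
  \<comment> \<open>Write \<open>E\<close>, \<open>x\<close>, \<open>F\<close> for the numbers of
    edges, variables and faces. From \<open>E = 2 * x\<close> and
    \<open>3 * F \<le> E + 3 * card Y\<close>, the bound
    \<open>E \<le> x + card Y + F + 2 * g\<close> becomes
    \<open>E / 6 \<le> 2 * card Y + 2 * g\<close>.\<close>
  have 2: "card (r (\<lambda>d. d = 2)) \<le> 12 * card Y + 12 * g"
  proof -
    let ?P = "\<lambda>d::nat. d = 2"
    obtain \<pi>' where b: "bipartite_rotation V (Domain (r ?P)) Y (r ?P) \<pi>'" and
      le: "card (r ?P) \<le> card (Domain (r ?P)) + card Y + card (orbit (face_perm (r ?P \<union> (r ?P)\<inverse>) \<pi>') ` (r ?P \<union> (r ?P)\<inverse>)) + 2 * g"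
      using faces by blast
    have deg: "card (r ?P `` {x}) = 2" if "x \<in> Domain (r ?P)" for x
      using that by (auto simp: im) (auto simp: r_def)
    have "3 * card (orbit (face_perm (r ?P \<union> (r ?P)\<inverse>) \<pi>') ` (r ?P \<union> (r ?P)\<inverse>)) \<le> card (r ?P) + 3 * card Y"
      using bipartite_rotation.faces_deg_2[OF b deg fr B(4) inj'] by blast
    moreover have "card (r ?P) = 2 * card (Domain (r ?P))" by (rule card_edges_eq[OF fr deg])
    ultimately show ?thesis using le by linarith
  qed
  \<comment> \<open>Now \<open>3 * x \<le> E\<close> and \<open>2 * F \<le> E\<close>, which leaves
    \<open>E / 6 \<le> card Y + 2 * g\<close>. With so few variables, faces of length 4 do no
    harm.\<close>
  have 3: "card (r (\<lambda>d. 3 \<le> d)) \<le> 6 * card Y + 12 * g"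
  proof -
    let ?P = "\<lambda>d::nat. 3 \<le> d"
    obtain \<pi>' where b: "bipartite_rotation V (Domain (r ?P)) Y (r ?P) \<pi>'" and
      le: "card (r ?P) \<le> card (Domain (r ?P)) + card Y + card (orbit (face_perm (r ?P \<union> (r ?P)\<inverse>) \<pi>') ` (r ?P \<union> (r ?P)\<inverse>)) + 2 * g"
      using faces by blast
    have deg: "3 \<le> card (r ?P `` {x})" if "x \<in> Domain (r ?P)" for x
      using that by (auto simp: im) (auto simp: r_def)
    have deg': "2 \<le> card (r ?P `` {x})" if "x \<in> Domain (r ?P)" for x
      using deg[OF that] by simp
    have "2 * card (orbit (face_perm (r ?P \<union> (r ?P)\<inverse>) \<pi>') ` (r ?P \<union> (r ?P)\<inverse>)) \<le> card (r ?P)"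
      using bipartite_rotation.faces_deg_ge_2[OF b deg' fr] by blast
    moreover have "3 * card (Domain (r ?P)) \<le> card (r ?P)" by (rule card_edges_ge[OF fr deg])
    ultimately show ?thesis using le by linarith
  qed
  have "B = r (\<lambda>d. d = 1) \<union> (r (\<lambda>d. d = 2) \<union> r (\<lambda>d. 3 \<le> d))"
  proof
    show "B \<subseteq> r (\<lambda>d. d = 1) \<union> (r (\<lambda>d. d = 2) \<union> r (\<lambda>d. 3 \<le> d))"
    proof
      fix e assume e: "e \<in> B"
      then have "B `` {fst e} \<noteq> {}" by (cases e) auto
      then have "0 < card (B `` {fst e})" using fim by (simp add: card_gt_0_iff)
      then show "e \<in> r (\<lambda>d. d = 1) \<union> (r (\<lambda>d. d = 2) \<union> r (\<lambda>d. 3 \<le> d))"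
        using e unfolding r_def by auto
    qed
  qed (auto simp: r_def)
  then have "card B \<le> card (r (\<lambda>d. d = 1)) + (card (r (\<lambda>d. d = 2)) + card (r (\<lambda>d. 3 \<le> d)))"
    by (metis (no_types, lifting) add_left_mono card_Un_le order_trans)
  then show ?thesis using 1 2 3 by linarith
qed

text \<open>The \<open>LEAST\<close> in \<open>graph_genus\<close> is attained because some rotation
  exists and its defect has the form \<open>- 2 * int g\<close>. Strong components are the ordinary
  ones since arcs come in both orientations.\<close>

lemma graph_genus_rotation:
  assumes G: "ugraph (pverts G) (parcs G)"
  shows "\<exists>\<pi>. rotation (pverts G) (parcs G) \<pi> \<and>
    euler_defect (pverts G) (parcs G) \<pi> = - 2 * int (graph_genus G)"
proof -
  let ?V = "pverts G" and ?A = "parcs G"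
  have out: "out_arcs (with_proj G) v = {a \<in> ?A. fst a = v}" for v by (auto simp: out_arcs_def)
  have rot: "rotation_system G \<pi> \<longleftrightarrow> rotation ?V ?A \<pi>" for \<pi>
    unfolding rotation_system_def rotation_def out ..
  have faces: "num_faces G \<pi> = card (orbit (face_perm ?A \<pi>) ` ?A) + card (isolated ?V ?A)"
    if R: "rotation ?V ?A \<pi>" for \<pi>
  proof -
    have "face_perm ?A \<pi> \<in> ?A \<rightarrow> ?A" using permutes_in_image[OF face_perm_permutes[OF G R]] by blast
    then have "orbit (\<pi> \<circ> prod.swap) a = orbit (face_perm ?A \<pi>) a" if a: "a \<in> ?A" for a
      using orbit_cong0[OF a, of "face_perm ?A \<pi>" "\<pi> \<circ> prod.swap"] by (simp add: face_perm_def)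
    then show ?thesis unfolding num_faces_def isolated_def out by (metis (no_types, lifting) image_cong)
  qed
  interpret pair_wf_digraph G
    using G by unfold_locales (auto simp: ugraph_def)
  have symG: "sym ?A" using G by (simp add: ugraph_def)
  have reach: "u \<rightarrow>\<^sup>*\<^bsub>with_proj G\<^esub> v \<longleftrightarrow> (u, v) \<in> ?A\<^sup>*" if "u \<in> ?V" for u v
  proof
    assume "u \<rightarrow>\<^sup>*\<^bsub>with_proj G\<^esub> v"
    then have "(u, v) \<in> rtrancl_on ?V ?A" by (simp add: reachable_def)
    then show "(u, v) \<in> ?A\<^sup>*" by induct (auto intro: rtrancl_into_rtrancl)
  next
    assume "(u, v) \<in> ?A\<^sup>*"
    then have "(u, v) \<in> rtrancl_on ?V ?A"
    proof induct
      case base then show ?case using that by simp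
    next
      case (step y z)
      then show ?case using G by (auto simp: ugraph_def intro: rtrancl_on_into_rtrancl_on)
    qed
    then show "u \<rightarrow>\<^sup>*\<^bsub>with_proj G\<^esub> v" by (simp add: reachable_def)
  qed
  have scc: "pre_digraph.scc_of (with_proj G) u = ?A\<^sup>* `` {u}" if u: "u \<in> ?V" for u
  proof -
    have "v \<rightarrow>\<^sup>*\<^bsub>with_proj G\<^esub> u" if "u \<rightarrow>\<^sup>*\<^bsub>with_proj G\<^esub> v" for v
      using symmetric_reachable[of "with_proj G" u v] that symG by (simp add: symmetric_def)
    then have "pre_digraph.scc_of (with_proj G) u = {v. u \<rightarrow>\<^sup>*\<^bsub>with_proj G\<^esub> v}"
      by (auto simp: scc_of_def)
    then show ?thesis using reach[OF u] by auto
  qed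
  have "pre_digraph.sccs_verts (with_proj G) = comps ?V ?A"
    unfolding sccs_verts_conv_scc_of comps_def using scc by auto
  then have euler: "(int (card ?V) - int (card ?A div 2) + int (num_faces G \<pi>) =
      2 * int (card (pre_digraph.sccs_verts (with_proj G))) - 2 * int g) \<longleftrightarrow>
      euler_defect ?V ?A \<pi> = - 2 * int g" if "rotation ?V ?A \<pi>" for \<pi> g
    using faces[OF that] by (auto simp: euler_defect_def)
  then have "(\<exists>\<pi>. rotation ?V ?A \<pi> \<and> int (card ?V) - int (card ?A div 2) + int (num_faces G \<pi>) =
      2 * int (card (pre_digraph.sccs_verts (with_proj G))) - 2 * int g) \<longleftrightarrow>
      (\<exists>\<pi>. rotation ?V ?A \<pi> \<and> euler_defect ?V ?A \<pi> = - 2 * int g)" for g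
    by blast
  then have genus: "graph_genus G = (LEAST g. \<exists>\<pi>. rotation ?V ?A \<pi> \<and> euler_defect ?V ?A \<pi> = - 2 * int g)"
    unfolding graph_genus_def rot by (simp only:)
  have "\<exists>g. \<exists>\<pi>. rotation ?V ?A \<pi> \<and> euler_defect ?V ?A \<pi> = - 2 * int g"
    using exists_rotation[OF G] euler_defect_even_nonpos[OF G] by metis
  then show ?thesis unfolding genus by (rule LeastI_ex)
qed

section \<open>Polynomial-time functions on trees\<close>

text \<open>The scratch variables below \<open>V\<close> are leaves before and after the run and all other variables except 0
  are untouched. So programs can be composed without renaming variables.\<close>

definition impl :: "com \<Rightarrow> nat \<Rightarrow> (tree \<Rightarrow> tree) \<Rightarrow> (tree \<Rightarrow> nat) \<Rightarrow> bool" where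
  "impl p V F T \<longleftrightarrow> 0 < V \<and>
     (\<forall>s. (\<forall>v. 0 < v \<and> v < V \<longrightarrow> s v = Leaf) \<longrightarrow> (\<exists>t \<le> T (s 0). exec p s t (s(0 := F (s 0)))))"

lemma implI:
  assumes "0 < V"
    and "\<And>s. (\<And>v. 0 < v \<Longrightarrow> v < V \<Longrightarrow> s v = Leaf) \<Longrightarrow> \<exists>t \<le> T (s 0). exec p s t (s(0 := F (s 0)))"
  shows "impl p V F T"
  using assms by (auto simp: impl_def)

lemma implE:
  assumes "impl p V F T" "\<And>v. 0 < v \<Longrightarrow> v < V \<Longrightarrow> s v = Leaf"
  obtains t where "t \<le> T (s 0)" "exec p s t (s(0 := F (s 0)))"
  using assms unfolding impl_def by blast

lemma impl_pos: "impl p V F T \<Longrightarrow> 0 < V"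
  by (simp add: impl_def)

lemma impl_expr:
  assumes "\<And>s. eval_expr e s = F (s 0)"
  shows "impl (Assign 0 e) 1 F (\<lambda>_. 1 + cost_expr e)"
  unfolding impl_def using exec_Assign[of 0 e] assms by auto

lemma impl_comp:
  assumes p: "impl p V F T" and q: "impl q W G U"
  shows "impl (Seq p q) (max V W) (\<lambda>x. G (F x)) (\<lambda>x. 1 + T x + U (F x))"
proof (rule implI)
  show "0 < max V W" using impl_pos[OF p] by simp
  fix s :: store assume s: "\<And>v. 0 < v \<Longrightarrow> v < max V W \<Longrightarrow> s v = Leaf"
  obtain t where t: "t \<le> T (s 0)" "exec p s t (s(0 := F (s 0)))"
    by (rule implE[OF p, of s]) (use s in auto)
  obtain u where u: "u \<le> U (F (s 0))" "exec q (s(0 := F (s 0))) u (s(0 := G (F (s 0))))"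
    by (rule implE[OF q, of "s(0 := F (s 0))"]) (use s in auto)
  show "\<exists>t \<le> 1 + T (s 0) + U (F (s 0)). exec (Seq p q) s t (s(0 := G (F (s 0))))"
    using exec_Seq[OF t(2) u(2)] t(1) u(1) by (intro exI[of _ "1 + t + u"]) auto
qed

lemma exec_Seq':
  "exec c1 s1 t1 s2 \<Longrightarrow> exec c2 s2 t2 s3 \<Longrightarrow> t = 1 + t1 + t2 \<Longrightarrow> exec (Seq c1 c2) s1 t s3"
  using exec_Seq by simp

lemma exec_Assign': "t = 1 + cost_expr e \<Longrightarrow> s' = s(v := eval_expr e s) \<Longrightarrow> exec (Assign v e) s t s'"
  using exec_Assign by simp

text \<open>Two cells above all scratch variables hold the input and the first result. Both are
  reset at the end, so the composed program keeps the scratch convention.\<close>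

lemma impl_Node:
  assumes p: "impl p V F T" and q: "impl q W G U"
  shows "\<exists>r. impl r (max V W + 2) (\<lambda>x. Node (F x) (G x)) (\<lambda>x. 21 + T x + U x)"
proof -
  define m where "m = max V W"
  let ?r = "Seq (Assign m (Var 0)) (Seq p (Seq (Assign (Suc m) (Var 0)) (Seq (Assign 0 (Var m)) (Seq q
    (Seq (Assign 0 (ConsE (Var (Suc m)) (Var 0))) (Seq (Assign m LeafE) (Assign (Suc m) LeafE)))))))"
  have m: "0 < m" "V \<le> m" "W \<le> m" using impl_pos[OF p] by (auto simp: m_def)
  have "impl ?r (m + 2) (\<lambda>x. Node (F x) (G x)) (\<lambda>x. 21 + T x + U x)"
  proof (rule implI)
    fix s :: store assume s: "\<And>v. 0 < v \<Longrightarrow> v < m + 2 \<Longrightarrow> s v = Leaf"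
    define x where "x = s 0"
    define s1 where "s1 = s(m := x)"
    define s2 where "s2 = s1(0 := F x)"
    define s3 where "s3 = s1(Suc m := F x)"
    define s4 where "s4 = s3(0 := G x)"
    obtain t where t: "t \<le> T x" "exec p s1 t s2"
      by (rule implE[OF p, of s1]) (use s m in \<open>auto simp: s1_def s2_def x_def\<close>)
    obtain u where u: "u \<le> U x" "exec q s3 u s4"
      by (rule implE[OF q, of s3]) (use s m in \<open>auto simp: s1_def s3_def s4_def x_def\<close>)
    have "exec ?r s (21 + t + u) (s(0 := Node (F x) (G x)))"
      apply (rule exec_Seq'[where ?t1.0 = 2 and ?t2.0 = "18 + t + u"])
        apply (rule exec_Assign'[where s' = s1]; simp add: s1_def x_def)
       apply (rule exec_Seq'[where ?t1.0 = t and ?t2.0 = "17 + u", OF t(2)])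
        apply (rule exec_Seq'[where ?t1.0 = 2 and ?t2.0 = "14 + u"])
          apply (rule exec_Assign'[OF _ refl]; simp)
         apply (rule exec_Seq'[where ?t1.0 = 2 and ?t2.0 = "11 + u"])
           apply (rule exec_Assign'[where s' = s3])
            apply simp
      subgoal using m by (auto simp: s1_def s2_def s3_def x_def fun_eq_iff)
          apply (rule exec_Seq'[where ?t1.0 = u and ?t2.0 = 10, OF u(2)])
           apply (rule exec_Seq'[where ?t1.0 = 4 and ?t2.0 = 5])
             apply (rule exec_Assign'[OF _ refl]; simp)
            apply (rule exec_Seq'[where ?t1.0 = 2 and ?t2.0 = 2])
              apply (rule exec_Assign'[OF _ refl]; simp)
             apply (rule exec_Assign')
              apply simp
      subgoal using m s by (auto simp: s1_def s3_def s4_def x_def fun_eq_iff)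
      by simp_all
    then show "\<exists>t \<le> 21 + T (s 0) + U (s 0). exec ?r s t (s(0 := Node (F (s 0)) (G (s 0))))"
      using t(1) u(1) unfolding x_def by (intro exI[of _ "21 + t + u"]) auto
  qed simp
  then show ?thesis unfolding m_def by blast
qed

text \<open>The test value lies above the scratch variables. It is cleared on entering the branch
  \<open>q\<close> and is already a leaf in the other branch.\<close>

lemma impl_If:
  assumes p: "impl p V F T" and q: "impl q W G U" and q': "impl q' W' G' U'"
  shows "\<exists>r. impl r (max V (max W W') + 2) (\<lambda>x. if F x = Leaf then G' x else G x)
    (\<lambda>x. 20 + T x + U x + U' x)"
proof -
  define m where "m = max V (max W W')"
  let ?i = "If (Var (Suc m)) (Seq (Assign (Suc m) LeafE) q) q'"
  let ?r = "Seq (Assign m (Var 0)) (Seq p (Seq (Assign (Suc m) (Var 0)) (Seq (Assign 0 (Var m))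
    (Seq (Assign m LeafE) ?i))))"
  have m: "0 < m" "V \<le> m" "W \<le> m" "W' \<le> m" using impl_pos[OF p] by (auto simp: m_def)
  have "impl ?r (m + 2) (\<lambda>x. if F x = Leaf then G' x else G x) (\<lambda>x. 20 + T x + U x + U' x)"
  proof (rule implI)
    fix s :: store assume s: "\<And>v. 0 < v \<Longrightarrow> v < m + 2 \<Longrightarrow> s v = Leaf"
    define x where "x = s 0"
    define s1 where "s1 = s(m := x)"
    define s2 where "s2 = s1(0 := F x)"
    define s3 where "s3 = s(Suc m := F x)"
    define y where "y = (if F x = Leaf then G' x else G x)"
    obtain t where t: "t \<le> T x" "exec p s1 t s2"
      by (rule implE[OF p, of s1]) (use s m in \<open>auto simp: s1_def s2_def x_def\<close>)
    obtain u where u: "u \<le> U x" "exec q s u (s(0 := G x))"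
      by (rule implE[OF q, of s]) (use s m in \<open>auto simp: x_def\<close>)
    obtain u' where u': "u' \<le> U' x" "exec q' s u' (s(0 := G' x))"
      by (rule implE[OF q', of s]) (use s m in \<open>auto simp: x_def\<close>)
    have sm: "s3(Suc m := Leaf) = s" using s by (auto simp: s3_def fun_eq_iff)
    obtain w where w: "w \<le> 5 + u + u'" "exec ?i s3 w (s(0 := y))"
    proof (cases "F x = Leaf")
      case True
      then have "s3 = s" using s by (auto simp: s3_def fun_eq_iff)
      then have "exec ?i s3 (1 + 1 + u') (s(0 := y))"
        using exec_IfFalse[of "Var (Suc m)" s3 q' u' "s(0 := y)"] u' True s by (simp add: y_def)
      then show ?thesis by (intro that) auto
    next
      case False
      have "exec (Assign (Suc m) LeafE) s3 2 s" by (rule exec_Assign') (auto simp: sm)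
      then have "exec (Seq (Assign (Suc m) LeafE) q) s3 (1 + 2 + u) (s(0 := y))"
        using exec_Seq u(2) False by (simp only: y_def if_False)
      then have "exec ?i s3 (1 + 1 + (1 + 2 + u)) (s(0 := y))"
        using exec_IfTrue[of "Var (Suc m)" s3] False by (simp add: s3_def)
      then show ?thesis by (intro that) auto
    qed
    have "exec ?r s (13 + t + w) (s(0 := y))"
      apply (rule exec_Seq'[where ?t1.0 = 2 and ?t2.0 = "10 + t + w"])
        apply (rule exec_Assign'[where s' = s1]; simp add: s1_def x_def)
       apply (rule exec_Seq'[where ?t1.0 = t and ?t2.0 = "9 + w", OF t(2)])
        apply (rule exec_Seq'[where ?t1.0 = 2 and ?t2.0 = "6 + w"])
          apply (rule exec_Assign'[OF _ refl]; simp)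
         apply (rule exec_Seq'[where ?t1.0 = 2 and ?t2.0 = "3 + w"])
           apply (rule exec_Assign'[OF _ refl]; simp)
          apply (rule exec_Seq'[where ?t1.0 = 2 and ?t2.0 = w, OF _ w(2)])
           apply (rule exec_Assign')
            apply simp
      subgoal using m s by (auto simp: s1_def s2_def s3_def x_def fun_eq_iff)
      by simp_all
    then show "\<exists>t \<le> 20 + T (s 0) + U (s 0) + U' (s 0).
        exec ?r s t (s(0 := if F (s 0) = Leaf then G' (s 0) else G (s 0)))"
      using t(1) u(1) u'(1) w(1) unfolding x_def y_def by (intro exI[of _ "13 + t + w"]) auto
  qed simp
  then show ?thesis unfolding m_def by blast
qed

text \<open>All loops have this shape: variable 0 holds the state, whose head is a leaf exactly when
  the work is done. Supplying the number of rounds from outside turns termination into a statement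
  about \<open>B ^^ n\<close>.\<close>

lemma impl_loop_exec:
  assumes p: "impl p V B T" and s: "\<And>v. 0 < v \<Longrightarrow> v < V \<Longrightarrow> s v = Leaf"
    and "hd_tree ((B ^^ n) (s 0)) = Leaf" "\<And>i. i < n \<Longrightarrow> hd_tree ((B ^^ i) (s 0)) \<noteq> Leaf"
  shows "\<exists>t \<le> 3 + (\<Sum>i<n. 3 + T ((B ^^ i) (s 0))). exec (While (HdE (Var 0)) p) s t (s(0 := (B ^^ n) (s 0)))"
  using assms(2-)
proof (induction n arbitrary: s)
  case 0
  then show ?case using exec_WhileFalse[of "HdE (Var 0)" s p] by (intro exI[of _ 3]) (auto simp: numeral_3_eq_3)
next
  case (Suc n)
  obtain t where t: "t \<le> T (s 0)" "exec p s t (s(0 := B (s 0)))"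
    by (rule implE[OF p, of s]) (use Suc.prems(1) in auto)
  let ?s = "s(0 := B (s 0))"
  have fp: "(B ^^ i) (?s 0) = (B ^^ Suc i) (s 0)" for i
    by (simp add: funpow_swap1)
  have "\<exists>t \<le> 3 + (\<Sum>i<n. 3 + T ((B ^^ i) (?s 0))). exec (While (HdE (Var 0)) p) ?s t (?s(0 := (B ^^ n) (?s 0)))"
  proof (rule Suc.IH)
    show "?s v = Leaf" if "0 < v" "v < V" for v using that Suc.prems(1) by auto
    show "hd_tree ((B ^^ n) (?s 0)) = Leaf" using Suc.prems(2) unfolding fp .
    show "hd_tree ((B ^^ i) (?s 0)) \<noteq> Leaf" if "i < n" for i
      using Suc.prems(3)[of "Suc i"] that unfolding fp by simp
  qed
  then obtain u where u: "u \<le> 3 + (\<Sum>i<n. 3 + T ((B ^^ Suc i) (s 0)))"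
    "exec (While (HdE (Var 0)) p) ?s u (s(0 := (B ^^ Suc n) (s 0)))"
    unfolding fp by auto
  have "hd_tree (s 0) \<noteq> Leaf" using Suc.prems(3)[of 0] by simp
  then have "exec (While (HdE (Var 0)) p) s (1 + 2 + t + u) (s(0 := (B ^^ Suc n) (s 0)))"
    using exec_WhileTrue[where e = "HdE (Var 0)", OF _ t(2) u(2)] by simp
  moreover have "(\<Sum>i<Suc n. 3 + T ((B ^^ i) (s 0))) = 3 + T (s 0) + (\<Sum>i<n. 3 + T ((B ^^ Suc i) (s 0)))"
    by (subst sum.lessThan_Suc_shift) simp
  then have "1 + 2 + t + u \<le> 3 + (\<Sum>i<Suc n. 3 + T ((B ^^ i) (s 0)))"
    using t(1) u(1) by linarith
  ultimately show ?case by blast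
qed

lemma impl_loop:
  assumes q: "impl q W P U" and p: "impl p V B T"
    and n: "\<And>x. hd_tree ((B ^^ n x) (P x)) = Leaf" "\<And>x i. i < n x \<Longrightarrow> hd_tree ((B ^^ i) (P x)) \<noteq> Leaf"
  shows "impl (Seq q (While (HdE (Var 0)) p)) (max W V) (\<lambda>x. (B ^^ n x) (P x))
    (\<lambda>x. 4 + U x + (\<Sum>i<n x. 3 + T ((B ^^ i) (P x))))"
proof (rule implI)
  show "0 < max W V" using impl_pos[OF p] by simp
  fix s :: store assume s: "\<And>v. 0 < v \<Longrightarrow> v < max W V \<Longrightarrow> s v = Leaf"
  obtain t where t: "t \<le> U (s 0)" "exec q s t (s(0 := P (s 0)))"
    by (rule implE[OF q, of s]) (use s in auto)
  let ?s = "s(0 := P (s 0))"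
  obtain u where u: "u \<le> 3 + (\<Sum>i<n (s 0). 3 + T ((B ^^ i) (P (s 0))))"
    "exec (While (HdE (Var 0)) p) ?s u (s(0 := (B ^^ n (s 0)) (P (s 0))))"
    using impl_loop_exec[OF p, of ?s "n (s 0)"] s n by auto
  show "\<exists>t \<le> 4 + U (s 0) + (\<Sum>i<n (s 0). 3 + T ((B ^^ i) (P (s 0)))).
      exec (Seq q (While (HdE (Var 0)) p)) s t (s(0 := (B ^^ n (s 0)) (P (s 0))))"
    using exec_Seq[OF t(2) u(2)] t(1) u(1) by (intro exI[of _ "1 + t + u"]) auto
qed

section \<open>Polynomial bounds and closure properties\<close>

lemma tree_size_pos: "0 < tree_size x"
  by (cases x) auto

lemma tree_size_hd: "tree_size (hd_tree x) \<le> tree_size x"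
  by (cases x) auto

lemma tree_size_tl: "tree_size (tl_tree x) \<le> tree_size x"
  by (cases x) auto

text \<open>One constant serves as factor and exponent, which loses nothing because
  \<open>tree_size\<close> is at least 1.\<close>

definition polyb :: "(tree \<Rightarrow> nat) \<Rightarrow> bool" where
  "polyb h \<longleftrightarrow> (\<exists>c. \<forall>x. h x \<le> c * tree_size x ^ c)"

lemma polyb_mono: "polyb h \<Longrightarrow> (\<And>x. h' x \<le> h x) \<Longrightarrow> polyb h'"
  unfolding polyb_def by (meson order_trans)

lemma polyb_const: "polyb (\<lambda>_. c)"
proof -
  have "c \<le> c * tree_size x ^ c" for x using tree_size_pos[of x] by (simp add: Suc_le_eq)
  then show ?thesis unfolding polyb_def by blast
qed

lemma polyb_size: "polyb tree_size"
  unfolding polyb_def by (intro exI[of _ 1]) simp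

lemma polyb_add: "polyb h \<Longrightarrow> polyb k \<Longrightarrow> polyb (\<lambda>x. h x + k x)"
proof -
  assume "polyb h" "polyb k"
  then obtain a b where a: "\<And>x. h x \<le> a * tree_size x ^ a" and b: "\<And>x. k x \<le> b * tree_size x ^ b"
    by (auto simp: polyb_def)
  have "h x + k x \<le> (a + b) * tree_size x ^ (a + b)" for x
  proof -
    have "tree_size x ^ a \<le> tree_size x ^ (a + b)" "tree_size x ^ b \<le> tree_size x ^ (a + b)"
      using tree_size_pos[of x] by (auto intro!: power_increasing simp: Suc_le_eq)
    then have "a * tree_size x ^ a + b * tree_size x ^ b \<le> (a + b) * tree_size x ^ (a + b)"
      unfolding distrib_right by (intro add_mono mult_le_mono) auto
    then show ?thesis using a[of x] b[of x] by linarith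
  qed
  then show ?thesis unfolding polyb_def by blast
qed

lemma polyb_mult: "polyb h \<Longrightarrow> polyb k \<Longrightarrow> polyb (\<lambda>x. h x * k x)"
proof -
  assume "polyb h" "polyb k"
  then obtain a b where a: "\<And>x. h x \<le> a * tree_size x ^ a" and b: "\<And>x. k x \<le> b * tree_size x ^ b"
    by (auto simp: polyb_def)
  have "h x * k x \<le> (a * b + a + b) * tree_size x ^ (a * b + a + b)" for x
  proof -
    have "h x * k x \<le> (a * tree_size x ^ a) * (b * tree_size x ^ b)"
      using a b by (intro mult_le_mono) auto
    also have "\<dots> = a * b * tree_size x ^ (a + b)" by (simp add: power_add)
    also have "\<dots> \<le> (a * b + a + b) * tree_size x ^ (a * b + a + b)"
      using tree_size_pos[of x] by (intro mult_le_mono power_increasing) (auto simp: Suc_le_eq)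
    finally show ?thesis .
  qed
  then show ?thesis unfolding polyb_def by blast
qed

lemma polyb_power: "polyb h \<Longrightarrow> polyb (\<lambda>x. h x ^ n)"
  by (induction n) (auto intro: polyb_const polyb_mult)

lemma polyb_comp:
  assumes "polyb h" "polyb (\<lambda>x. tree_size (F x))"
  shows "polyb (\<lambda>x. h (F x))"
proof -
  obtain a where "\<And>x. h x \<le> a * tree_size x ^ a" using assms by (auto simp: polyb_def)
  then show ?thesis
    by (intro polyb_mono[OF polyb_mult[OF polyb_const[of a] polyb_power[OF assms(2), of a]]])
qed

text \<open>The bound on the output size is not implied by the time bound: repeating \<open>x := cons x x\<close> doubles
  the size in constant time.\<close>

definition ptime :: "(tree \<Rightarrow> tree) \<Rightarrow> bool" where
  "ptime F \<longleftrightarrow> (\<exists>p V T. impl p V F T \<and> polyb T) \<and> polyb (\<lambda>x. tree_size (F x))"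

lemma ptime_size: "ptime F \<Longrightarrow> polyb (\<lambda>x. tree_size (F x))"
  by (simp add: ptime_def)

lemma ptime_expr:
  assumes "\<And>s. eval_expr e s = F (s 0)" "polyb (\<lambda>x. tree_size (F x))"
  shows "ptime F"
  unfolding ptime_def using impl_expr[OF assms(1)] polyb_const assms(2) by blast

lemma ptime_comp: "ptime G \<Longrightarrow> ptime F \<Longrightarrow> ptime (\<lambda>x. G (F x))"
proof -
  assume G: "ptime G" and F: "ptime F"
  then obtain p V T q W U where i: "impl p V F T" "polyb T" "impl q W G U" "polyb U"
    by (auto simp: ptime_def)
  show ?thesis unfolding ptime_def
    using impl_comp[OF i(1,3)] i F polyb_comp[OF ptime_size[OF G] ptime_size[OF F]]
      polyb_add[OF polyb_add[OF polyb_const[of 1] i(2)] polyb_comp[OF i(4) ptime_size[OF F]]]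
    by blast
qed

lemma ptime_id: "ptime (\<lambda>x. x)"
  by (rule ptime_expr[of "Var 0"]) (auto intro: polyb_size)

lemma ptime_Leaf: "ptime (\<lambda>x. Leaf)"
  by (rule ptime_expr[of "LeafE"]) (auto intro: polyb_const)

lemma ptime_hd: "ptime F \<Longrightarrow> ptime (\<lambda>x. hd_tree (F x))"
  by (rule ptime_comp[of hd_tree], rule ptime_expr[of "HdE (Var 0)"])
    (auto intro: polyb_mono[OF polyb_size] tree_size_hd)

lemma ptime_tl: "ptime F \<Longrightarrow> ptime (\<lambda>x. tl_tree (F x))"
  by (rule ptime_comp[of tl_tree], rule ptime_expr[of "TlE (Var 0)"])
    (auto intro: polyb_mono[OF polyb_size] tree_size_tl)

lemma ptime_Node: "ptime F \<Longrightarrow> ptime G \<Longrightarrow> ptime (\<lambda>x. Node (F x) (G x))"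
proof -
  assume F: "ptime F" and G: "ptime G"
  then obtain p V T q W U where i: "impl p V F T" "polyb T" "impl q W G U" "polyb U"
    by (auto simp: ptime_def)
  have "polyb (\<lambda>x. tree_size (Node (F x) (G x)))"
    using polyb_add[OF polyb_add[OF polyb_const[of 1] ptime_size[OF F]] ptime_size[OF G]] by simp
  moreover have "polyb (\<lambda>x. 21 + T x + U x)"
    by (intro polyb_add polyb_const i)
  ultimately show ?thesis unfolding ptime_def using impl_Node[OF i(1,3)] by blast
qed

lemma ptime_If:
  assumes "ptime F" "ptime G" "ptime H"
  shows "ptime (\<lambda>x. if F x = Leaf then G x else H x)"
proof -
  from assms obtain p V T q W U r Y Z where i: "impl p V F T" "polyb T" "impl q W G U" "polyb U"
    "impl r Y H Z" "polyb Z"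
    by (auto simp: ptime_def)
  have "polyb (\<lambda>x. tree_size (if F x = Leaf then G x else H x))"
    by (rule polyb_mono[OF polyb_add[OF ptime_size[OF assms(2)] ptime_size[OF assms(3)]]]) auto
  moreover have "polyb (\<lambda>x. 20 + T x + Z x + U x)"
    by (intro polyb_add polyb_const i)
  ultimately show ?thesis unfolding ptime_def using impl_If[OF i(1,5,3)] by blast
qed

text \<open>The cost of a round depends on the current state. So besides the number of rounds, the
  size of every intermediate state needs a polynomial bound.\<close>

lemma ptime_loop:
  assumes P: "ptime P" and B: "ptime B" and n: "polyb n" and h: "polyb h"
    and "\<And>x. hd_tree ((B ^^ n x) (P x)) = Leaf" "\<And>x i. i < n x \<Longrightarrow> hd_tree ((B ^^ i) (P x)) \<noteq> Leaf"
    and sz: "\<And>x i. i \<le> n x \<Longrightarrow> tree_size ((B ^^ i) (P x)) \<le> h x"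
  shows "ptime (\<lambda>x. (B ^^ n x) (P x))"
proof -
  from P B obtain p V T q W U where i: "impl p V P T" "polyb T" "impl q W B U" "polyb U"
    by (auto simp: ptime_def)
  obtain c where c: "\<And>x. U x \<le> c * tree_size x ^ c" using i(4) by (auto simp: polyb_def)
  have "polyb (\<lambda>x. 4 + T x + (\<Sum>i<n x. 3 + U ((B ^^ i) (P x))))"
  proof (rule polyb_mono)
    show "polyb (\<lambda>x. 4 + T x + n x * (3 + c * h x ^ c))"
      by (intro polyb_add polyb_const i polyb_mult polyb_power h n)
    have "(\<Sum>i<n x. 3 + U ((B ^^ i) (P x))) \<le> (\<Sum>i<n x. 3 + c * h x ^ c)" for x
      using sz order_trans[OF c] by (intro sum_mono add_mono order_trans[OF c] mult_le_mono power_mono) auto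
    then show "4 + T x + (\<Sum>i<n x. 3 + U ((B ^^ i) (P x))) \<le> 4 + T x + n x * (3 + c * h x ^ c)" for x
      by simp
  qed
  moreover have "polyb (\<lambda>x. tree_size ((B ^^ n x) (P x)))"
    using sz by (intro polyb_mono[OF h]) auto
  ultimately show ?thesis unfolding ptime_def using impl_loop[OF i(1,3) assms(5,6)] by blast
qed

section \<open>Folds over lists\<close>

text \<open>The folded function has a single argument, the tree \<open>(x, (acc, env))\<close> of the current element, the
  accumulator and a fixed environment.\<close>

fun foldt :: "(tree \<Rightarrow> tree) \<Rightarrow> tree \<Rightarrow> tree \<Rightarrow> tree \<Rightarrow> tree" where
  "foldt G env Leaf acc = acc"
| "foldt G env (Node x xs) acc = foldt G env xs (G (Node x (Node acc env)))"

fun spine :: "tree \<Rightarrow> nat" where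
  "spine Leaf = 0"
| "spine (Node x xs) = Suc (spine xs)"

abbreviation foldt_step :: "(tree \<Rightarrow> tree) \<Rightarrow> tree \<Rightarrow> tree" where
  "foldt_step G z \<equiv> Node (tl_tree (hd_tree z)) (Node (G (Node (hd_tree (hd_tree z)) (tl_tree z))) (tl_tree (tl_tree z)))"

lemma spine_tl: "spine ((tl_tree ^^ i) x) = spine x - i"
proof (induction i arbitrary: x)
  case (Suc i)
  show ?case unfolding funpow_Suc_right comp_def using Suc[of "tl_tree x"] by (cases x) auto
qed simp

lemma spine_eq_0: "spine x = 0 \<longleftrightarrow> x = Leaf"
  by (cases x) auto

lemma spine_le_size: "spine x \<le> tree_size x"
  by (induction x) auto

lemma funpow_tl_eq_Leaf: "(tl_tree ^^ i) x = Leaf \<longleftrightarrow> spine x \<le> i"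
  using spine_tl[of i x] spine_eq_0[of "(tl_tree ^^ i) x"] by auto

lemma tree_size_funpow_tl: "tree_size ((tl_tree ^^ i) x) \<le> tree_size x"
  by (induction i) (auto intro: order_trans[OF tree_size_tl])

lemma foldt_step_funpow_hd: "hd_tree ((foldt_step G ^^ i) z) = (tl_tree ^^ i) (hd_tree z)"
  by (induction i) auto

lemma foldt_step_funpow:
  "(foldt_step G ^^ spine xs) (Node xs (Node acc env)) = Node Leaf (Node (foldt G env xs acc) env)"
  by (induction xs arbitrary: acc) (auto simp: funpow_Suc_right simp del: funpow.simps(2))

lemma foldt_step_size:
  assumes G: "\<And>x acc env. tree_size (G (Node x (Node acc env))) \<le> tree_size acc + h (Node x env)"
    and h: "\<And>x. tree_size x \<le> tree_size xs \<Longrightarrow> h (Node x env) \<le> H"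
  shows "\<exists>a. (foldt_step G ^^ i) (Node xs (Node acc env)) = Node ((tl_tree ^^ i) xs) (Node a env) \<and>
    tree_size a \<le> tree_size acc + i * H"
proof (induction i)
  case (Suc i)
  then obtain a where a: "(foldt_step G ^^ i) (Node xs (Node acc env)) = Node ((tl_tree ^^ i) xs) (Node a env)"
    "tree_size a \<le> tree_size acc + i * H" by blast
  let ?x = "hd_tree ((tl_tree ^^ i) xs)"
  have "tree_size ?x \<le> tree_size xs" using tree_size_funpow_tl tree_size_hd order_trans by metis
  then have "tree_size (G (Node ?x (Node a env))) \<le> tree_size acc + Suc i * H"
    using G[of ?x a env] h[of ?x] a(2) by simp
  then show ?case using a(1) by simp
qed simp

text \<open>The allowance \<open>h\<close> depends on the element and the environment but not on the
  accumulator. Hence growth is additive per step, and a body that doubles its accumulator is ruled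
  out.\<close>

lemma ptime_foldt:
  assumes G: "ptime G" and X: "ptime X" and A: "ptime A" and E: "ptime E" and h: "polyb h"
    and le: "\<And>x acc env. tree_size (G (Node x (Node acc env))) \<le> tree_size acc + h (Node x env)"
  shows "ptime (\<lambda>u. foldt G (E u) (X u) (A u))"
proof -
  define P where "P u = Node (X u) (Node (A u) (E u))" for u
  obtain c where c: "\<And>x. h x \<le> c * tree_size x ^ c" using h by (auto simp: polyb_def)
  define H where "H u = c * (1 + tree_size (X u) + tree_size (E u)) ^ c" for u
  define B where "B u = 2 + tree_size (X u) + tree_size (E u) + tree_size (A u) + tree_size (X u) * H u" for u
  have H: "polyb H" unfolding H_def
    by (intro polyb_mult polyb_power polyb_add polyb_const ptime_size X E)
  have "ptime (\<lambda>u. (foldt_step G ^^ spine (X u)) (P u))"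
  proof (rule ptime_loop)
    show "ptime P" unfolding P_def by (intro ptime_Node X A E)
    show "ptime (foldt_step G)"
      by (intro ptime_Node ptime_tl ptime_hd ptime_id ptime_comp[OF G])
    show "polyb (\<lambda>x. spine (X x))"
      by (rule polyb_mono[OF ptime_size[OF X]]) (rule spine_le_size)
    show "polyb B" unfolding B_def
      by (intro polyb_add polyb_mult polyb_const ptime_size X E A H)
    show "hd_tree ((foldt_step G ^^ spine (X u)) (P u)) = Leaf" for u
      by (simp add: foldt_step_funpow_hd P_def funpow_tl_eq_Leaf)
    show "hd_tree ((foldt_step G ^^ i) (P u)) \<noteq> Leaf" if "i < spine (X u)" for u i
      using that by (simp add: foldt_step_funpow_hd P_def funpow_tl_eq_Leaf)
    show "tree_size ((foldt_step G ^^ i) (P u)) \<le> B u" if i: "i \<le> spine (X u)" for u i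
    proof -
      have "h (Node x (E u)) \<le> H u" if "tree_size x \<le> tree_size (X u)" for x
        unfolding H_def using that by (intro order_trans[OF c] mult_le_mono power_mono) auto
      then obtain a where a: "(foldt_step G ^^ i) (P u) = Node ((tl_tree ^^ i) (X u)) (Node a (E u))"
        "tree_size a \<le> tree_size (A u) + i * H u"
        using foldt_step_size[where G = G and h = h and H = "H u" and xs = "X u" and env = "E u"
            and acc = "A u" and i = i, OF le] unfolding P_def by blast
      have "i * H u \<le> tree_size (X u) * H u"
        using i spine_le_size[of "X u"] by (intro mult_le_mono) auto
      moreover have "tree_size ((foldt_step G ^^ i) (P u)) =
          2 + tree_size ((tl_tree ^^ i) (X u)) + tree_size a + tree_size (E u)"
        unfolding a(1) by simp
      ultimately show ?thesis using a(2) tree_size_funpow_tl[of i "X u"] unfolding B_def by linarith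
    qed
  qed
  then have "ptime (\<lambda>u. hd_tree (tl_tree ((foldt_step G ^^ spine (X u)) (P u))))"
    by (intro ptime_hd ptime_tl)
  then show ?thesis by (simp add: P_def foldt_step_funpow)
qed

text \<open>The bridge from tree programs to list functions, with \<open>e\<close> encoding elements
  and \<open>E\<close> accumulators: only one step of the fold has to be simulated.\<close>

lemma foldt_enc_list:
  assumes "\<And>x a. x \<in> set xs \<Longrightarrow> G (Node (e x) (Node (E a) env)) = E (g x a)"
  shows "foldt G env (enc_list e xs) (E a) = E (fold g xs a)"
  using assms by (induction xs arbitrary: a) auto

section \<open>The search step\<close>

abbreviation (input) TT :: tree where "TT \<equiv> Node Leaf Leaf"

lemma ptime_TT: "ptime (\<lambda>_. TT)"
  by (intro ptime_Node ptime_Leaf)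

text \<open>Truncated subtraction of list lengths; on unary numerals it yields the order
  test.\<close>

definition dropt :: "tree \<Rightarrow> tree \<Rightarrow> tree" where
  "dropt xs a = foldt (\<lambda>z. tl_tree (hd_tree (tl_tree z))) Leaf xs a"

lemma ptime_dropt: "ptime X \<Longrightarrow> ptime A \<Longrightarrow> ptime (\<lambda>u. dropt (X u) (A u))"
  unfolding dropt_def
  by (rule ptime_foldt[where h = "\<lambda>_. 0"])
    (auto intro!: ptime_tl ptime_hd ptime_id ptime_Leaf polyb_const tree_size_tl)

lemma dropt_eq_Leaf: "dropt xs a = Leaf \<longleftrightarrow> spine a \<le> spine xs"
proof -
  have "dropt xs a = (tl_tree ^^ spine xs) a" unfolding dropt_def
    by (induction xs arbitrary: a) (auto simp: funpow_Suc_right simp del: funpow.simps(2))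
  then show ?thesis by (simp add: funpow_tl_eq_Leaf)
qed

lemma spine_enc_nat: "spine (enc_nat n) = n"
  by (induction n) auto

lemma spine_enc_list: "spine (enc_list e xs) = length xs"
  by (induction xs) auto

lemma enc_list_eq_Leaf: "enc_list e xs = Leaf \<longleftrightarrow> xs = []"
  by (cases xs) auto

lemma enc_nat_eq_Leaf: "enc_nat n = Leaf \<longleftrightarrow> n = 0"
  by (cases n) auto

text \<open>This compares lengths only, which decides equality of unary numerals.\<close>

definition eqt :: "tree \<Rightarrow> tree \<Rightarrow> tree" where
  "eqt a b = (if dropt a b = Leaf then if dropt b a = Leaf then TT else Leaf else Leaf)"

lemma ptime_eqt: "ptime X \<Longrightarrow> ptime A \<Longrightarrow> ptime (\<lambda>u. eqt (X u) (A u))"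
  unfolding eqt_def by (intro ptime_If ptime_dropt ptime_TT ptime_Leaf)

lemma eqt_enc: "eqt (enc_nat m) (enc_nat n) = (if m = n then TT else Leaf)"
  by (auto simp: eqt_def dropt_eq_Leaf spine_enc_nat)

definition memt :: "tree \<Rightarrow> tree \<Rightarrow> tree" where
  "memt v c = foldt (\<lambda>z. if eqt (hd_tree z) (tl_tree (tl_tree z)) = Leaf then hd_tree (tl_tree z) else TT) v c Leaf"

lemma ptime_memt: "ptime X \<Longrightarrow> ptime A \<Longrightarrow> ptime (\<lambda>u. memt (X u) (A u))"
  unfolding memt_def
  by (rule ptime_foldt[where h = "\<lambda>_. 3"])
    (auto intro!: ptime_tl ptime_hd ptime_id ptime_Leaf ptime_If ptime_eqt ptime_TT polyb_const)

lemma memt_enc: "memt (enc_nat v) (enc_list enc_nat c) = (if v \<in> set c then TT else Leaf)"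
proof -
  have "memt (enc_nat v) (enc_list enc_nat c) =
    (\<lambda>b. if b then TT else Leaf) (fold (\<lambda>x b. b \<or> x = v) c False)"
    unfolding memt_def
    by (subst foldt_enc_list[where E = "\<lambda>b. if b then TT else Leaf", symmetric]) (auto simp: eqt_enc)
  moreover have "fold (\<lambda>x b. b \<or> x = v) c b \<longleftrightarrow> b \<or> v \<in> set c" for b
    by (induction c arbitrary: b) auto
  ultimately show ?thesis by simp
qed

definition equivt :: "tree \<Rightarrow> tree \<Rightarrow> tree \<Rightarrow> tree" where
  "equivt cs v w = foldt (\<lambda>z.
     if memt (hd_tree (tl_tree (tl_tree z))) (hd_tree z) = Leaf
     then if memt (tl_tree (tl_tree (tl_tree z))) (hd_tree z) = Leaf then hd_tree (tl_tree z) else Leaf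
     else if memt (tl_tree (tl_tree (tl_tree z))) (hd_tree z) = Leaf then Leaf else hd_tree (tl_tree z))
     (Node v w) cs TT"

lemma ptime_equivt: "ptime X \<Longrightarrow> ptime A \<Longrightarrow> ptime C \<Longrightarrow> ptime (\<lambda>u. equivt (X u) (A u) (C u))"
  unfolding equivt_def
  by (rule ptime_foldt[where h = "\<lambda>_. 1"])
    (auto intro!: ptime_Node ptime_tl ptime_hd ptime_id ptime_Leaf ptime_If ptime_memt ptime_TT polyb_const)

abbreviation enc_clauses :: "nat list list \<Rightarrow> tree" where
  "enc_clauses \<equiv> enc_list (enc_list enc_nat)"

definition equiv_vars :: "nat list list \<Rightarrow> nat \<Rightarrow> nat \<Rightarrow> bool" where
  "equiv_vars cs v w \<longleftrightarrow> (\<forall>c\<in>set cs. v \<in> set c \<longleftrightarrow> w \<in> set c)"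

lemma equivt_enc:
  "equivt (enc_clauses cs) (enc_nat v) (enc_nat w) = (if equiv_vars cs v w then TT else Leaf)"
proof -
  have "equivt (enc_clauses cs) (enc_nat v) (enc_nat w) =
    (\<lambda>b. if b then TT else Leaf) (fold (\<lambda>c b. b \<and> (v \<in> set c \<longleftrightarrow> w \<in> set c)) cs True)"
    unfolding equivt_def
    by (subst foldt_enc_list[where E = "\<lambda>b. if b then TT else Leaf", symmetric]) (auto simp: memt_enc)
  moreover have "fold (\<lambda>c b. b \<and> (v \<in> set c \<longleftrightarrow> w \<in> set c)) cs b \<longleftrightarrow> b \<and> equiv_vars cs v w" for b
    by (induction cs arbitrary: b) (auto simp: equiv_vars_def)
  ultimately show ?thesis by simp
qed

definition anyt :: "tree \<Rightarrow> tree \<Rightarrow> tree \<Rightarrow> tree" where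
  "anyt v cs xs = foldt (\<lambda>z.
     if equivt (tl_tree (tl_tree (tl_tree z))) (hd_tree (tl_tree (tl_tree z))) (hd_tree z) = Leaf
     then hd_tree (tl_tree z) else TT) (Node v cs) xs Leaf"

lemma ptime_anyt: "ptime X \<Longrightarrow> ptime A \<Longrightarrow> ptime C \<Longrightarrow> ptime (\<lambda>u. anyt (X u) (A u) (C u))"
  unfolding anyt_def
  by (rule ptime_foldt[where h = "\<lambda>_. 3"])
    (auto intro!: ptime_Node ptime_tl ptime_hd ptime_id ptime_Leaf ptime_If ptime_equivt ptime_TT polyb_const)

lemma anyt_enc:
  "anyt (enc_nat v) (enc_clauses cs) (enc_list enc_nat xs) =
   (if \<exists>w\<in>set xs. equiv_vars cs v w then TT else Leaf)"
proof -
  have "anyt (enc_nat v) (enc_clauses cs) (enc_list enc_nat xs) =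
    (\<lambda>b. if b then TT else Leaf) (fold (\<lambda>w b. b \<or> equiv_vars cs v w) xs False)"
    unfolding anyt_def
    by (subst foldt_enc_list[where E = "\<lambda>b. if b then TT else Leaf", symmetric]) (auto simp: equivt_enc)
  moreover have "fold (\<lambda>w b. b \<or> equiv_vars cs v w) xs b \<longleftrightarrow> b \<or> (\<exists>w\<in>set xs. equiv_vars cs v w)" for b
    by (induction xs arbitrary: b) auto
  ultimately show ?thesis by simp
qed

definition redt :: "tree \<Rightarrow> tree \<Rightarrow> tree" where
  "redt cs c = foldt (\<lambda>z.
     if anyt (hd_tree z) (tl_tree (tl_tree z)) (hd_tree (tl_tree z)) = Leaf
     then Node (hd_tree z) (hd_tree (tl_tree z)) else hd_tree (tl_tree z)) cs c Leaf"

lemma ptime_redt: "ptime X \<Longrightarrow> ptime A \<Longrightarrow> ptime (\<lambda>u. redt (X u) (A u))"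
  unfolding redt_def
  by (rule ptime_foldt[where h = tree_size])
    (auto intro!: ptime_Node ptime_tl ptime_hd ptime_id ptime_Leaf ptime_If ptime_anyt polyb_size)

definition reduce :: "nat list list \<Rightarrow> nat list \<Rightarrow> nat list" where
  "reduce cs c = fold (\<lambda>v xs. if \<exists>w\<in>set xs. equiv_vars cs v w then xs else v # xs) c []"

lemma redt_enc: "redt (enc_clauses cs) (enc_list enc_nat c) = enc_list enc_nat (reduce cs c)"
  unfolding redt_def reduce_def
  by (subst foldt_enc_list[where E = "enc_list enc_nat", symmetric]) (auto simp: anyt_enc)

definition bestt :: "tree \<Rightarrow> tree" where
  "bestt cs = foldt (\<lambda>z.
     if dropt (redt (tl_tree (tl_tree z)) (hd_tree z)) (hd_tree (tl_tree z)) = Leaf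
     then hd_tree (tl_tree z) else redt (tl_tree (tl_tree z)) (hd_tree z)) cs cs (redt cs (hd_tree cs))"

lemma ptime_bestt: "ptime X \<Longrightarrow> ptime (\<lambda>u. bestt (X u))"
  unfolding bestt_def
proof (rule ptime_foldt[where h = "\<lambda>y. tree_size (redt (tl_tree y) (hd_tree y))"])
  show "polyb (\<lambda>y. tree_size (redt (tl_tree y) (hd_tree y)))"
    by (intro ptime_size ptime_redt ptime_tl ptime_hd ptime_id)
qed (auto intro!: ptime_Node ptime_tl ptime_hd ptime_id ptime_Leaf ptime_If ptime_redt ptime_dropt)

definition shortest :: "nat list list \<Rightarrow> nat list" where
  "shortest cs = fold (\<lambda>c xs. if length xs \<le> length (reduce cs c) then xs else reduce cs c) cs (reduce cs (hd cs))"

lemma bestt_enc: "cs \<noteq> [] \<Longrightarrow> bestt (enc_clauses cs) = enc_list enc_nat (shortest cs)"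
proof -
  assume "cs \<noteq> []"
  then have "hd_tree (enc_clauses cs) = enc_list enc_nat (hd cs)" by (cases cs) auto
  then show ?thesis unfolding bestt_def shortest_def redt_enc
    by (subst foldt_enc_list[where E = "enc_list enc_nat", symmetric])
      (auto simp: redt_enc dropt_eq_Leaf spine_enc_list)
qed

text \<open>Folds build lists backwards. Reversal makes the remaining clauses literally a
  \<open>filter\<close> of the original list, the form over which \<open>nodes_le\<close>
  quantifies.\<close>

definition revt :: "tree \<Rightarrow> tree" where
  "revt xs = foldt (\<lambda>z. Node (hd_tree z) (hd_tree (tl_tree z))) Leaf xs Leaf"

lemma ptime_revt: "ptime X \<Longrightarrow> ptime (\<lambda>u. revt (X u))"
  unfolding revt_def
  by (rule ptime_foldt[where h = tree_size])
    (auto intro!: ptime_Node ptime_tl ptime_hd ptime_id ptime_Leaf polyb_size)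

lemma revt_enc: "revt (enc_list e xs) = enc_list e (rev xs)"
proof -
  have "revt (enc_list e xs) = enc_list e (fold (#) xs [])"
    unfolding revt_def by (subst foldt_enc_list[where E = "enc_list e", symmetric]) auto
  then show ?thesis by (simp add: fold_Cons_rev)
qed

definition filtt :: "tree \<Rightarrow> tree \<Rightarrow> tree" where
  "filtt v cs = revt (foldt (\<lambda>z. if memt (tl_tree (tl_tree z)) (hd_tree z) = Leaf
     then Node (hd_tree z) (hd_tree (tl_tree z)) else hd_tree (tl_tree z)) v cs Leaf)"

lemma ptime_filtt: "ptime X \<Longrightarrow> ptime A \<Longrightarrow> ptime (\<lambda>u. filtt (X u) (A u))"
  unfolding filtt_def
  by (rule ptime_revt, rule ptime_foldt[where h = tree_size])
    (auto intro!: ptime_Node ptime_tl ptime_hd ptime_id ptime_Leaf ptime_If ptime_memt polyb_size)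

definition unhit :: "nat \<Rightarrow> nat list list \<Rightarrow> nat list list" where
  "unhit v cs = filter (\<lambda>c. v \<notin> set c) cs"

lemma filtt_enc: "filtt (enc_nat v) (enc_clauses cs) = enc_clauses (unhit v cs)"
proof -
  have "filtt (enc_nat v) (enc_clauses cs) =
    revt (enc_clauses (fold (\<lambda>c acc. if v \<notin> set c then c # acc else acc) cs []))"
    unfolding filtt_def
    by (subst foldt_enc_list[where E = enc_clauses, symmetric]) (auto simp: memt_enc)
  moreover have "fold (\<lambda>c acc. if v \<notin> set c then c # acc else acc) cs acc = rev (unhit v cs) @ acc" for acc
    by (induction cs arbitrary: acc) (auto simp: unhit_def)
  ultimately show ?thesis by (simp add: revt_enc)
qed

definition pusht :: "tree \<Rightarrow> tree \<Rightarrow> tree \<Rightarrow> tree" where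
  "pusht e xs st = foldt (\<lambda>z. Node (Node (filtt (hd_tree z) (hd_tree (tl_tree (tl_tree z)))) (tl_tree (tl_tree (tl_tree z))))
     (hd_tree (tl_tree z))) e xs st"

lemma ptime_pusht: "ptime X \<Longrightarrow> ptime A \<Longrightarrow> ptime C \<Longrightarrow> ptime (\<lambda>u. pusht (X u) (A u) (C u))"
  unfolding pusht_def
proof (rule ptime_foldt[where h = "\<lambda>y. 2 + tree_size (filtt (hd_tree y) (hd_tree (tl_tree y))) + tree_size y"])
  show "polyb (\<lambda>y. 2 + tree_size (filtt (hd_tree y) (hd_tree (tl_tree y))) + tree_size y)"
    by (intro polyb_add polyb_const polyb_size ptime_size ptime_filtt ptime_tl ptime_hd ptime_id)
  show "tree_size (Node (Node (filtt (hd_tree (Node x (Node acc env))) (hd_tree (tl_tree (tl_tree (Node x (Node acc env))))))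
      (tl_tree (tl_tree (tl_tree (Node x (Node acc env)))))) (hd_tree (tl_tree (Node x (Node acc env)))))
    \<le> tree_size acc + (2 + tree_size (filtt (hd_tree (Node x env)) (hd_tree (tl_tree (Node x env)))) + tree_size (Node x env))"
    for x acc env using tree_size_tl[of env] by simp
qed (auto intro!: ptime_Node ptime_tl ptime_hd ptime_id ptime_Leaf ptime_filtt)

fun enc_task :: "nat list list \<times> nat \<Rightarrow> tree" where
  "enc_task (cs, k) = Node (enc_clauses cs) (enc_nat k)"

text \<open>Reversed because the fold in \<open>pusht\<close> pushes the branches one after
  another.\<close>

definition branch :: "nat list list \<Rightarrow> nat \<Rightarrow> (nat list list \<times> nat) list" where
  "branch cs k = rev (map (\<lambda>v. (unhit v cs, k)) (shortest cs))"

lemma pusht_enc: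
  assumes "cs \<noteq> []"
  shows "pusht (Node (enc_clauses cs) (enc_nat k)) (enc_list enc_nat (shortest cs)) (enc_list enc_task st) =
    enc_list enc_task (branch cs k @ st)"
proof -
  have "pusht (Node (enc_clauses cs) (enc_nat k)) (enc_list enc_nat (shortest cs)) (enc_list enc_task st) =
    enc_list enc_task (fold (\<lambda>v st. (unhit v cs, k) # st) (shortest cs) st)"
    unfolding pusht_def by (subst foldt_enc_list[where E = "enc_list enc_task", symmetric]) (auto simp: filtt_enc)
  moreover have "fold (\<lambda>v st. (unhit v cs, k) # st) vs st = rev (map (\<lambda>v. (unhit v cs, k)) vs) @ st" for vs
    by (induction vs arbitrary: st) auto
  ultimately show ?thesis by (simp add: branch_def)
qed

definition stept :: "tree \<Rightarrow> tree" where
  "stept s =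
    (if hd_tree (hd_tree (hd_tree s)) = Leaf then Node Leaf TT
     else if tl_tree (hd_tree (hd_tree s)) = Leaf then Node (tl_tree (hd_tree s)) (tl_tree s)
     else Node (pusht (Node (hd_tree (hd_tree (hd_tree s))) (tl_tree (tl_tree (hd_tree (hd_tree s)))))
       (bestt (hd_tree (hd_tree (hd_tree s)))) (tl_tree (hd_tree s))) (tl_tree s))"

lemma ptime_stept: "ptime stept"
  unfolding stept_def
  by (intro ptime_If ptime_Node ptime_Leaf ptime_tl ptime_hd ptime_id ptime_pusht ptime_bestt)

type_synonym search_state = "(nat list list \<times> nat) list \<times> bool"

fun enc_state :: "search_state \<Rightarrow> tree" where
  "enc_state (st, b) = Node (enc_list enc_task st) (if b then TT else Leaf)"

text \<open>Success discards the whole stack, since the loop test sees the stack and not the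
  flag.\<close>

fun search_step :: "search_state \<Rightarrow> search_state" where
  "search_step ([], b) = ([], b)"
| "search_step ((cs, k) # st, b) =
    (if cs = [] then ([], True) else if k = 0 then (st, b) else (branch cs (k - 1) @ st, b))"

text \<open>On an empty stack \<open>stept\<close> would report success, because heads of leaves are
  leaves. The loop stops before this can happen.\<close>

lemma stept_enc: "fst s \<noteq> [] \<Longrightarrow> stept (enc_state s) = enc_state (search_step s)"
proof -
  assume "fst s \<noteq> []"
  then obtain cs k st b where s: "s = ((cs, k) # st, b)" by (cases s; cases "fst s") auto
  show ?thesis unfolding s
    by (cases k) (auto simp: stept_def enc_list_eq_Leaf enc_nat_eq_Leaf bestt_enc pusht_enc)
qed

definition prept :: "tree \<Rightarrow> tree" where
  "prept xs = revt (foldt (\<lambda>z. Node (if hd_tree (hd_tree z) = Leaf then Node (tl_tree (hd_tree z)) Leaf else tl_tree (hd_tree z))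
     (hd_tree (tl_tree z))) Leaf xs Leaf)"

lemma ptime_prept: "ptime X \<Longrightarrow> ptime (\<lambda>u. prept (X u))"
  unfolding prept_def
proof (rule ptime_revt, rule ptime_foldt[where h = "\<lambda>y. 3 + tree_size y"])
  show "polyb (\<lambda>y. 3 + tree_size y)" by (intro polyb_add polyb_const polyb_size)
  show "tree_size (Node (if hd_tree (hd_tree (Node x (Node acc env))) = Leaf
        then Node (tl_tree (hd_tree (Node x (Node acc env)))) Leaf else tl_tree (hd_tree (Node x (Node acc env))))
      (hd_tree (tl_tree (Node x (Node acc env))))) \<le> tree_size acc + (3 + tree_size (Node x env))" for x acc env
    using tree_size_tl[of x] by auto
qed (auto intro!: ptime_Node ptime_tl ptime_hd ptime_id ptime_Leaf ptime_If)

text \<open>Variables are shifted by one because the encoding of a positive literal \<open>v\<close> is the numeral \<open>Suc v\<close>.\<close>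

fun clause_of :: "and_input \<Rightarrow> nat list" where
  "clause_of (Lit l) = [Suc (var l)]"
| "clause_of (Or ls) = map (\<lambda>l. Suc (var l)) ls"

lemma enc_list_map: "enc_list e (map f xs) = enc_list (\<lambda>x. e (f x)) xs"
  by (induction xs) auto

lemma enc_list_cong: "(\<And>x. x \<in> set xs \<Longrightarrow> e x = e' x) \<Longrightarrow> enc_list e xs = enc_list e' xs"
  by (induction xs) auto

lemma prept_enc:
  assumes "\<And>i l. i \<in> set is \<Longrightarrow> l \<in> literals i \<Longrightarrow> \<exists>v. l = Pos v"
  shows "prept (enc_list enc_and_input is) = enc_clauses (map clause_of is)"
proof -
  have i: "(if hd_tree (enc_and_input i) = Leaf then Node (tl_tree (enc_and_input i)) Leaf else tl_tree (enc_and_input i))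
     = enc_list enc_nat (clause_of i)" if "i \<in> set is" for i
  proof (cases i)
    case (Lit l)
    then obtain v where "l = Pos v" using assms[of i l] \<open>i \<in> set is\<close> by auto
    then show ?thesis using Lit by simp
  next
    case (Or ls)
    have "enc_literal l = enc_nat (Suc (var l))" if "l \<in> set ls" for l
      using assms[OF \<open>i \<in> set is\<close>, of l] Or that by auto
    then show ?thesis using Or by (auto simp: enc_list_map intro: enc_list_cong)
  qed
  have i1: "Node (tl_tree (enc_and_input i)) Leaf = enc_list enc_nat (clause_of i)"
    if "i \<in> set is" "hd_tree (enc_and_input i) = Leaf" for i using i[OF that(1)] that(2) by simp
  have i2: "tl_tree (enc_and_input i) = enc_list enc_nat (clause_of i)"
    if "i \<in> set is" "hd_tree (enc_and_input i) \<noteq> Leaf" for i using i[OF that(1)] that(2) by simp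
  have "prept (enc_list enc_and_input is) = revt (enc_clauses (fold (\<lambda>i acc. clause_of i # acc) is []))"
    unfolding prept_def
    by (subst foldt_enc_list[where E = enc_clauses, symmetric]) (auto simp: i1 i2)
  moreover have "fold (\<lambda>i acc. clause_of i # acc) js acc = rev (map clause_of js) @ acc" for js acc
    by (induction js arbitrary: acc) auto
  ultimately show ?thesis by (simp add: revt_enc)
qed

text \<open>No assignment has weight above the number \<open>n\<close> of variables, so in the case
  \<open>Suc n \<le> k\<close> the search starts with an empty stack and a false flag.\<close>

definition initt :: "tree \<Rightarrow> tree" where
  "initt z = (if dropt (tl_tree z) (Node Leaf (hd_tree (hd_tree z))) = Leaf then Node Leaf Leaf
     else Node (Node (Node (prept (tl_tree (hd_tree z))) (tl_tree z)) Leaf) Leaf)"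

lemma ptime_initt: "ptime initt"
  unfolding initt_def
  by (intro ptime_If ptime_Node ptime_Leaf ptime_tl ptime_hd ptime_id ptime_dropt ptime_prept)

lemma initt_enc:
  assumes "monotone_circuit C"
  shows "initt (Node (enc_circuit C) (enc_nat k)) =
    enc_state (if k \<le> num_vars C then [(map clause_of (and_inputs C), k)] else [], False)"
proof -
  have "prept (enc_list enc_and_input (and_inputs C)) = enc_clauses (map clause_of (and_inputs C))"
    using assms by (intro prept_enc) (auto simp: monotone_circuit_def circuit_literals_def)
  then show ?thesis by (auto simp: initt_def enc_circuit_def dropt_eq_Leaf spine_enc_nat)
qed

section \<open>Analysis of the search\<close>

lemma reduce_fold:
  fixes cs :: "nat list list"
  defines "red \<equiv> \<lambda>v xs. if \<exists>w\<in>set xs. equiv_vars cs v w then xs else v # xs"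
  assumes "distinct xs" "\<And>v w. v \<in> set xs \<Longrightarrow> w \<in> set xs \<Longrightarrow> equiv_vars cs v w \<Longrightarrow> v = w"
  shows "distinct (fold red c xs) \<and> set xs \<subseteq> set (fold red c xs) \<and> set (fold red c xs) \<subseteq> set xs \<union> set c \<and>
    (\<forall>v\<in>set (fold red c xs). \<forall>w\<in>set (fold red c xs). equiv_vars cs v w \<longrightarrow> v = w) \<and>
    (\<forall>v\<in>set c. \<exists>w\<in>set (fold red c xs). equiv_vars cs v w)"
  using assms(2-)
proof (induction c arbitrary: xs)
  case Nil
  then show ?case by auto
next
  case (Cons v c)
  have refl: "equiv_vars cs w w" and sym: "equiv_vars cs w w' \<Longrightarrow> equiv_vars cs w' w" for w w'
    by (auto simp: equiv_vars_def)
  have d: "distinct (red v xs)" using Cons.prems refl by (auto simp: red_def)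
  have i: "w = w'" if "w \<in> set (red v xs)" "w' \<in> set (red v xs)" "equiv_vars cs w w'" for w w'
    using that Cons.prems(2) sym by (auto simp: red_def split: if_splits)
  have s: "set xs \<subseteq> set (red v xs)" "set (red v xs) \<subseteq> insert v (set xs)" "\<exists>w\<in>set (red v xs). equiv_vars cs v w"
    using refl by (auto simp: red_def)
  show ?case using Cons.IH[OF d i] s by (simp add: subset_iff) blast
qed

lemma reduce:
  shows distinct_reduce: "distinct (reduce cs c)"
    and reduce_subset: "set (reduce cs c) \<subseteq> set c"
    and reduce_inequiv: "v \<in> set (reduce cs c) \<Longrightarrow> w \<in> set (reduce cs c) \<Longrightarrow> equiv_vars cs v w \<Longrightarrow> v = w"
    and reduce_covers: "v \<in> set c \<Longrightarrow> \<exists>w\<in>set (reduce cs c). equiv_vars cs v w"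
  using reduce_fold[of "[]" cs c] unfolding reduce_def by auto

lemma length_reduce_le: "length (reduce cs c) \<le> length c"
proof -
  have "length (reduce cs c) = card (set (reduce cs c))" using distinct_reduce distinct_card by metis
  also have "\<dots> \<le> card (set c)" by (rule card_mono) (auto dest: reduce_subset[THEN subsetD])
  also have "\<dots> \<le> length c" by (rule card_length)
  finally show ?thesis .
qed

lemma shortest_fold:
  fixes r :: "nat list \<Rightarrow> nat list"
  defines "m \<equiv> \<lambda>c xs. if length xs \<le> length (r c) then xs else r c"
  shows "fold m cs xs \<in> insert xs (r ` set cs) \<and> length (fold m cs xs) \<le> length xs \<and>
    (\<forall>c\<in>set cs. length (fold m cs xs) \<le> length (r c))"
proof (induction cs arbitrary: xs)
  case (Cons c cs)
  have "m c xs \<in> {xs, r c}" "length (m c xs) \<le> length xs" "length (m c xs) \<le> length (r c)"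
    by (auto simp: m_def)
  then show ?case using Cons[of "m c xs"] by auto
qed simp

lemma shortest:
  assumes "cs \<noteq> []"
  shows shortest_in: "\<exists>c\<in>set cs. shortest cs = reduce cs c"
    and shortest_le: "c \<in> set cs \<Longrightarrow> length (shortest cs) \<le> length (reduce cs c)"
proof -
  have f: "shortest cs \<in> insert (reduce cs (hd cs)) (reduce cs ` set cs)"
    "\<forall>c\<in>set cs. length (shortest cs) \<le> length (reduce cs c)"
    using shortest_fold[of "reduce cs" cs "reduce cs (hd cs)"] unfolding shortest_def by blast+
  have "hd cs \<in> set cs" using assms by simp
  then show "\<exists>c\<in>set cs. shortest cs = reduce cs c" using f(1) by blast
  show "length (shortest cs) \<le> length (reduce cs c)" if "c \<in> set cs" using f(2) that by blast
qed

section \<open>Hitting sets and the search tree\<close>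

definition hittable :: "nat \<Rightarrow> nat list list \<Rightarrow> bool" where
  "hittable k cs \<longleftrightarrow> (\<exists>A. finite A \<and> card A \<le> k \<and> (\<forall>c\<in>set cs. A \<inter> set c \<noteq> {}))"

lemma hittable_Nil: "hittable k []"
  unfolding hittable_def by (rule exI[of _ "{}"]) simp

lemma hittable_0: "cs \<noteq> [] \<Longrightarrow> \<not> hittable 0 cs"
  by (cases cs) (auto simp: hittable_def)

text \<open>A hitting set meets the chosen clause in some \<open>v\<close>, which may be traded for
  its representative \<open>w\<close>: clauses missed by \<open>w\<close> are missed by
  \<open>v\<close> too, so the other elements already hit them.\<close>

lemma hittable_Suc:
  assumes "cs \<noteq> []"
  shows "hittable (Suc k) cs \<longleftrightarrow> (\<exists>v\<in>set (shortest cs). hittable k (unhit v cs))"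
proof
  assume "hittable (Suc k) cs"
  then obtain A where A: "finite A" "card A \<le> Suc k" "\<And>c. c \<in> set cs \<Longrightarrow> A \<inter> set c \<noteq> {}"
    by (auto simp: hittable_def)
  obtain c where c: "c \<in> set cs" "shortest cs = reduce cs c" using shortest_in[OF assms] by auto
  obtain v where v: "v \<in> A" "v \<in> set c" using A(3)[OF c(1)] by auto
  obtain w where w: "w \<in> set (shortest cs)" "equiv_vars cs v w" using reduce_covers[OF v(2)] c(2) by auto
  have "(A - {v}) \<inter> set d \<noteq> {}" if "d \<in> set (unhit w cs)" for d
  proof -
    have "d \<in> set cs" "v \<notin> set d" using that w(2) by (auto simp: unhit_def equiv_vars_def)
    then show ?thesis using A(3)[of d] by auto
  qed
  moreover have "card (A - {v}) \<le> k" using A v by simp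
  ultimately have "hittable k (unhit w cs)" using A(1) unfolding hittable_def by blast
  then show "\<exists>v\<in>set (shortest cs). hittable k (unhit v cs)" using w by blast
next
  assume "\<exists>v\<in>set (shortest cs). hittable k (unhit v cs)"
  then obtain v A where A: "finite A" "card A \<le> k" "\<And>c. c \<in> set (unhit v cs) \<Longrightarrow> A \<inter> set c \<noteq> {}"
    by (auto simp: hittable_def)
  have "insert v A \<inter> set c \<noteq> {}" if "c \<in> set cs" for c
    using A(3)[of c] that by (cases "v \<in> set c") (auto simp: unhit_def)
  moreover have "card (insert v A) \<le> Suc k" using A by (simp add: card_insert_if)
  ultimately show "hittable (Suc k) cs" using A(1) unfolding hittable_def by blast
qed

text \<open>An upper bound for the number of search steps spent on one task; summed over the stack
  it becomes the termination measure.\<close>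

fun nodes :: "nat \<Rightarrow> nat list list \<Rightarrow> nat" where
  "nodes 0 cs = 1"
| "nodes (Suc k) cs = 1 + (if cs = [] then 0 else (\<Sum>v\<leftarrow>shortest cs. nodes k (unhit v cs)))"

definition stack_nodes :: "(nat list list \<times> nat) list \<Rightarrow> nat" where
  "stack_nodes st = (\<Sum>(cs, k)\<leftarrow>st. nodes k cs)"

text \<open>A step replaces a task by its children, so \<open>stack_nodes\<close> drops by exactly
  one, unless success empties the stack at once.\<close>

lemma search_terminates:
  "\<exists>n \<le> stack_nodes st. (search_step ^^ n) (st, False) = ([], \<exists>(cs, k)\<in>set st. hittable k cs) \<and>
    (\<forall>i<n. fst ((search_step ^^ i) (st, False)) \<noteq> [])"
proof (induction "stack_nodes st" arbitrary: st rule: less_induct)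
  case less
  show ?case
  proof (cases st)
    case Nil
    then show ?thesis by (intro exI[of _ 0]) auto
  next
    case (Cons task st')
    obtain cs k where task: "task = (cs, k)" by (cases task)
    have st: "st = (cs, k) # st'" using Cons task by simp
    have pos: "0 < nodes k cs" by (cases k) auto
    show ?thesis
    proof (cases "cs = []")
      case True
      then show ?thesis using pos st hittable_Nil
        by (intro exI[of _ 1]) (auto simp: stack_nodes_def Suc_le_eq)
    next
      case False
      define st'' where "st'' = (if k = 0 then st' else branch cs (k - 1) @ st')"
      have step: "search_step (st, False) = (st'', False)" using False st by (simp add: st''_def)
      have "stack_nodes st'' + 1 = stack_nodes st"
        using st False
        by (cases k) (auto simp: st''_def stack_nodes_def branch_def comp_def rev_map[symmetric] sum_list_rev)
      then have lt: "stack_nodes st'' < stack_nodes st" "Suc (stack_nodes st'') = stack_nodes st" by simp_all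
      obtain n where n: "n \<le> stack_nodes st''"
        "(search_step ^^ n) (st'', False) = ([], \<exists>(cs, k)\<in>set st''. hittable k cs)"
        "\<And>i. i < n \<Longrightarrow> fst ((search_step ^^ i) (st'', False)) \<noteq> []"
        using less[OF lt(1)] by blast
      have "(\<exists>(cs, k)\<in>set st''. hittable k cs) \<longleftrightarrow> (\<exists>(cs, k)\<in>set st. hittable k cs)"
        using st False hittable_0 hittable_Suc
        by (cases k) (auto simp: st''_def branch_def)
      moreover have it: "(search_step ^^ Suc i) (st, False) = (search_step ^^ i) (st'', False)" for i
        using step by (simp add: funpow_Suc_right del: funpow.simps(2))
      moreover have "fst ((search_step ^^ i) (st, False)) \<noteq> []" if "i < Suc n" for i
      proof (cases i)
        case 0 then show ?thesis using st by simp
      next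
        case (Suc j) then show ?thesis using n(3)[of j] that it by simp
      qed
      ultimately show ?thesis using n(1,2) lt(2) by (intro exI[of _ "Suc n"]) (auto simp del: funpow.simps(2))
    qed
  qed
qed

text \<open>The induction runs over all \<open>P\<close> because removing the hit clauses from a
  filtered list gives another filtered list. So the width bound is needed for every
  subfamily.\<close>

lemma nodes_le:
  assumes "\<And>P. filter P cs \<noteq> [] \<Longrightarrow> length (shortest (filter P cs)) \<le> b"
  shows "nodes k (filter P cs) \<le> (b + 1) ^ k"
proof (induction k arbitrary: P)
  case (Suc k)
  have le: "(\<Sum>v\<leftarrow>shortest (filter P cs). nodes k (unhit v (filter P cs))) \<le> b * (b + 1) ^ k" if "filter P cs \<noteq> []"
  proof -
    have "(\<Sum>v\<leftarrow>shortest (filter P cs). nodes k (unhit v (filter P cs))) \<le>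
      (\<Sum>v\<leftarrow>shortest (filter P cs). (b + 1) ^ k)"
      using Suc by (intro sum_list_mono) (simp add: unhit_def)
    also have "\<dots> = length (shortest (filter P cs)) * (b + 1) ^ k" by (simp add: sum_list_triv)
    also have "\<dots> \<le> b * (b + 1) ^ k" using assms[OF that] by (intro mult_le_mono) auto
    finally show ?thesis .
  qed
  have 1: "1 \<le> (b + 1) ^ k" by simp
  have 2: "(b + 1) ^ Suc k = (b + 1) ^ k + b * (b + 1) ^ k" by simp
  show ?case
  proof (cases "filter P cs = []")
    case True
    then have "nodes (Suc k) (filter P cs) = 1" by simp
    then show ?thesis using 1 2 by linarith
  next
    case False
    then have "nodes (Suc k) (filter P cs) = 1 + (\<Sum>v\<leftarrow>shortest (filter P cs). nodes k (unhit v (filter P cs)))"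
      by simp
    then show ?thesis using le[OF False] 1 2 by linarith
  qed
qed simp

section \<open>Sizes of search states and total running time\<close>

lemma tree_size_enc_nat: "tree_size (enc_nat n) = 2 * n + 1"
  by (induction n) auto

lemma tree_size_enc_list_filter: "tree_size (enc_list e (filter P xs)) \<le> tree_size (enc_list e xs)"
  by (induction xs) auto

lemma tree_size_enc_list_le:
  "(\<And>x. x \<in> set xs \<Longrightarrow> tree_size (e x) \<le> S) \<Longrightarrow> tree_size (enc_list e xs) \<le> 1 + length xs * (S + 1)"
  by (induction xs) force+

lemma tree_size_enc_list_mem: "x \<in> set xs \<Longrightarrow> tree_size (e x) \<le> tree_size (enc_list e xs)"
  by (induction xs) force+

lemma length_le_tree_size: "length xs \<le> tree_size (enc_list e xs)"
  by (induction xs) auto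

lemma length_shortest_le: "cs \<noteq> [] \<Longrightarrow> length (shortest cs) \<le> tree_size (enc_clauses cs)"
  using shortest_in length_reduce_le length_le_tree_size tree_size_enc_list_mem
  by (metis order_trans)

text \<open>Tasks never grow, as clauses are only removed and the parameter only decreases. The same
  \<open>S\<close> bounds the number of children, since the branching clause is no longer than the
  encoding of the task.\<close>

lemma search_step_size:
  assumes "\<forall>task\<in>set (fst s). tree_size (enc_task task) \<le> S" "length (fst s) \<le> m"
  shows "\<forall>task\<in>set (fst (search_step s)). tree_size (enc_task task) \<le> S"
    and "length (fst (search_step s)) \<le> m + S"
proof -
  have "(\<forall>task\<in>set (fst (search_step s)). tree_size (enc_task task) \<le> S) \<and> length (fst (search_step s)) \<le> m + S"
  proof (cases "fst s = []")
    case True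
    then show ?thesis using assms by (cases s) auto
  next
    case False
    then obtain cs k st b where s: "s = ((cs, k) # st, b)" by (cases s; cases "fst s") auto
    have S: "tree_size (enc_clauses cs) + tree_size (enc_nat k) + 1 \<le> S" using assms(1) s by simp
    show ?thesis
    proof (cases "cs = [] \<or> k = 0")
      case True
      then show ?thesis using assms s by auto
    next
      case F: False
      have "tree_size (enc_task task) \<le> S" if "task \<in> set (branch cs (k - 1))" for task
      proof -
        from that obtain v where v: "task = (unhit v cs, k - 1)" by (auto simp: branch_def)
        have "tree_size (enc_clauses (unhit v cs)) \<le> tree_size (enc_clauses cs)"
          unfolding unhit_def by (rule tree_size_enc_list_filter)
        then show ?thesis using S v by (simp add: tree_size_enc_nat)
      qed
      moreover have "length (branch cs (k - 1)) \<le> S"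
        using length_shortest_le[of cs] F S by (simp add: branch_def)
      ultimately show ?thesis using F assms s by auto
    qed
  qed
  then show "\<forall>task\<in>set (fst (search_step s)). tree_size (enc_task task) \<le> S"
    and "length (fst (search_step s)) \<le> m + S" by blast+
qed

lemma search_steps_size:
  assumes "\<forall>task\<in>set (fst s). tree_size (enc_task task) \<le> S" "length (fst s) \<le> 1"
  shows "tree_size (enc_state ((search_step ^^ i) s)) \<le> 5 + (1 + i * S) * (S + 1)"
proof -
  have *: "(\<forall>task\<in>set (fst ((search_step ^^ i) s)). tree_size (enc_task task) \<le> S) \<and>
    length (fst ((search_step ^^ i) s)) \<le> 1 + i * S"
  proof (induction i)
    case 0
    then show ?case using assms by simp
  next
    case (Suc i)
    show ?case using search_step_size[of "(search_step ^^ i) s" S "1 + i * S"] Suc by (simp add: algebra_simps)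
  qed
  obtain st b where st: "(search_step ^^ i) s = (st, b)" by (cases "(search_step ^^ i) s")
  have "tree_size (enc_list enc_task st) \<le> 1 + length st * (S + 1)"
    using * st by (intro tree_size_enc_list_le) auto
  also have "\<dots> \<le> 1 + (1 + i * S) * (S + 1)"
    using * st by (intro add_left_mono mult_le_mono1) auto
  finally show ?thesis unfolding st by simp
qed

lemma enc_state_hd: "hd_tree (enc_state s) = Leaf \<longleftrightarrow> fst s = []"
  by (cases s) (auto simp: enc_list_eq_Leaf)

lemma stept_funpow:
  assumes "\<And>i. i < n \<Longrightarrow> fst ((search_step ^^ i) s) \<noteq> []" "i \<le> n"
  shows "(stept ^^ i) (enc_state s) = enc_state ((search_step ^^ i) s)"
  using assms(2)
proof (induction i)
  case (Suc i)
  then show ?case using stept_enc[of "(search_step ^^ i) s"] assms(1)[of i] by simp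
qed simp

text \<open>Program and exponent are chosen before \<open>b\<close>: the width enters only the
  analysis and is not an input.\<close>

lemma search_program:
  "\<exists>p c. \<forall>C k b. monotone_circuit C \<longrightarrow>
     (\<forall>P. filter P (map clause_of (and_inputs C)) \<noteq> [] \<longrightarrow>
        length (shortest (filter P (map clause_of (and_inputs C)))) \<le> b) \<longrightarrow>
     (\<exists>t y. runs p (Node (enc_circuit C) (enc_nat k)) t y \<and>
        t \<le> c * ((b + 1) ^ k * tree_size (Node (enc_circuit C) (enc_nat k))) ^ c \<and>
        (y \<noteq> Leaf \<longleftrightarrow> k \<le> num_vars C \<and> hittable k (map clause_of (and_inputs C))))"
proof -
  obtain p0 V0 T0 where p0: "impl p0 V0 initt T0" "polyb T0" and s0: "polyb (\<lambda>x. tree_size (initt x))"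
    using ptime_initt by (auto simp: ptime_def)
  obtain p1 V1 T1 where p1: "impl p1 V1 stept T1" "polyb T1"
    using ptime_stept by (auto simp: ptime_def)
  obtain c0 c1 c2 where c0: "\<And>x. T0 x \<le> c0 * tree_size x ^ c0" and c1: "\<And>x. T1 x \<le> c1 * tree_size x ^ c1"
    and c2: "\<And>x. tree_size (initt x) \<le> c2 * tree_size x ^ c2"
    using p0(2) p1(2) s0 unfolding polyb_def by metis
  \<comment> \<open>\<open>Z\<close> bounds the size of a state after at most \<open>y\<close> steps
    when tasks have size at most \<open>c2 * y ^ c2\<close>; \<open>H\<close> adds up initialisation
    and \<open>y\<close> rounds of the loop.\<close>
  define Z where "Z y = 5 + (1 + y * (c2 * y ^ c2)) * (c2 * y ^ c2 + 1)" for y :: nat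
  define H where "H y = 8 + c0 * y ^ c0 + y * (3 + c1 * Z y ^ c1)" for y :: nat
  have "polyb (\<lambda>u. H (tree_size u))" unfolding H_def Z_def
    by (intro polyb_add polyb_mult polyb_power polyb_const polyb_size)
  then obtain d where d: "\<And>u. H (tree_size u) \<le> d * tree_size u ^ d" by (auto simp: polyb_def)
  define c where "c = d * 3 ^ d + d"
  have Hc: "H y \<le> c * y ^ c" if "0 < y" for y
  proof -
    \<comment> \<open>\<open>polyb\<close> speaks about sizes of trees, which do not take every
      value. The numeral \<open>enc_nat y\<close> of size \<open>2 * y + 1\<close> is large enough,
      and the factor \<open>3 ^ d\<close> in \<open>c\<close> pays for the detour.\<close>
    have Hmono: "H y \<le> H (2 * y + 1)"
      unfolding H_def Z_def by (intro add_mono mult_le_mono power_mono order_refl) auto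
    have "H (2 * y + 1) \<le> d * (2 * y + 1) ^ d" using d[of "enc_nat y"] by (simp add: tree_size_enc_nat)
    also have "\<dots> \<le> d * (3 * y) ^ d" using that by (intro mult_le_mono power_mono) auto
    also have "\<dots> = d * 3 ^ d * y ^ d" by (simp add: power_mult_distrib)
    also have "\<dots> \<le> c * y ^ c" using that by (intro mult_le_mono power_increasing) (auto simp: c_def)
    finally show ?thesis using Hmono by simp
  qed
  let ?p = "Seq p0 (Seq (While (HdE (Var 0)) p1) (Assign 0 (TlE (Var 0))))"
  have main: "\<exists>t y. runs ?p x t y \<and> t \<le> c * ((b + 1) ^ k * tree_size x) ^ c \<and>
        (y \<noteq> Leaf \<longleftrightarrow> k \<le> num_vars C \<and> hittable k (map clause_of (and_inputs C)))"
    if C: "monotone_circuit C"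
      and b: "\<And>P. filter P (map clause_of (and_inputs C)) \<noteq> [] \<Longrightarrow>
        length (shortest (filter P (map clause_of (and_inputs C)))) \<le> b"
      and x: "x = Node (enc_circuit C) (enc_nat k)" for C k b x
  proof -
    let ?cs = "map clause_of (and_inputs C)"
    define st where "st = (if k \<le> num_vars C then [(?cs, k)] else [])"
    have init: "initt x = enc_state (st, False)" using initt_enc[OF C] x by (simp add: st_def)
    obtain n where n: "n \<le> stack_nodes st"
      "(search_step ^^ n) (st, False) = ([], \<exists>(cs, k)\<in>set st. hittable k cs)"
      "\<And>i. i < n \<Longrightarrow> fst ((search_step ^^ i) (st, False)) \<noteq> []"
      using search_terminates by blast
    \<comment> \<open>A single quantity that dominates both the number of rounds and the size of the
      input.\<close>
    define N where "N = (b + 1) ^ k * tree_size x"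
    have "1 \<le> (b + 1) ^ k" by simp
    then have xN: "tree_size x \<le> N" and N0: "0 < N" unfolding N_def using tree_size_pos[of x] by simp_all
    have "stack_nodes st \<le> (b + 1) ^ k"
      using nodes_le[OF b, of k "\<lambda>_. True"] by (simp add: st_def stack_nodes_def)
    also have "\<dots> \<le> N" unfolding N_def using tree_size_pos[of x] by simp
    finally have nN: "n \<le> N" using n(1) by simp
    define S where "S = c2 * N ^ c2"
    have "tree_size (initt x) \<le> c2 * tree_size x ^ c2" by (rule c2)
    also have "\<dots> \<le> S" unfolding S_def using xN by (intro mult_le_mono power_mono) auto
    finally have "tree_size (enc_state (st, False)) \<le> S" using init by simp
    then have "\<forall>task\<in>set st. tree_size (enc_task task) \<le> S" by (auto simp: st_def)
    then have size: "tree_size (enc_state ((search_step ^^ i) (st, False))) \<le> 5 + (1 + i * S) * (S + 1)" for i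
      by (intro search_steps_size) (auto simp: st_def)
    have it: "(stept ^^ i) (initt x) = enc_state ((search_step ^^ i) (st, False))" if "i \<le> n" for i
      unfolding init using stept_funpow[OF n(3) that] .
    have T1: "T1 ((stept ^^ i) (initt x)) \<le> c1 * Z N ^ c1" if "i < n" for i
    proof -
      have "5 + (1 + i * S) * (S + 1) \<le> Z N"
        unfolding Z_def S_def using that nN by (intro add_mono mult_le_mono order_refl) auto
      then have "tree_size ((stept ^^ i) (initt x)) \<le> Z N" using size[of i] it[of i] that by simp
      then show ?thesis by (intro order_trans[OF c1] mult_le_mono power_mono) auto
    qed
    let ?s0 = "(\<lambda>_. Leaf)(0 := x)" and ?s1 = "(\<lambda>_. Leaf)(0 := initt x)"
      and ?s2 = "(\<lambda>_. Leaf)(0 := (stept ^^ n) (initt x))"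
      and ?s3 = "(\<lambda>_. Leaf)(0 := tl_tree ((stept ^^ n) (initt x)))"
    obtain t0 where t0: "t0 \<le> T0 x" "exec p0 ?s0 t0 ?s1"
      by (rule implE[OF p0(1), of ?s0]) auto
    have "hd_tree ((stept ^^ n) (?s1 0)) = Leaf" using it[of n] n(2) by (simp add: enc_state_hd)
    moreover have "hd_tree ((stept ^^ i) (?s1 0)) \<noteq> Leaf" if "i < n" for i
      using it[of i] n(3)[OF that] that by (simp add: enc_state_hd)
    ultimately obtain t1 where t1: "t1 \<le> 3 + (\<Sum>i<n. 3 + T1 ((stept ^^ i) (initt x)))"
      "exec (While (HdE (Var 0)) p1) ?s1 t1 ?s2"
      using impl_loop_exec[OF p1(1), of ?s1 n] by auto
    have t2: "exec (Assign 0 (TlE (Var 0))) ?s2 3 ?s3"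
      by (rule exec_Assign') auto
    have "exec ?p ?s0 (1 + t0 + (1 + t1 + 3)) ?s3"
      by (rule exec_Seq[OF t0(2) exec_Seq[OF t1(2) t2]])
    then have "runs ?p x (1 + t0 + (1 + t1 + 3)) (tl_tree ((stept ^^ n) (initt x)))"
      unfolding runs_def by (intro exI[of _ ?s3]) simp
    moreover have "1 + t0 + (1 + t1 + 3) \<le> c * N ^ c"
    proof -
      have "(\<Sum>i<n. 3 + T1 ((stept ^^ i) (initt x))) \<le> (\<Sum>i<n. 3 + c1 * Z N ^ c1)"
        using T1 by (intro sum_mono) auto
      also have "\<dots> \<le> N * (3 + c1 * Z N ^ c1)" using nN by simp
      finally have "t1 \<le> 3 + N * (3 + c1 * Z N ^ c1)" using t1(1) by linarith
      moreover have "t0 \<le> c0 * N ^ c0"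
        using t0(1) c0[of x] xN by (meson mult_le_mono2 order_trans power_mono zero_le)
      ultimately have "1 + t0 + (1 + t1 + 3) \<le> H N" unfolding H_def by linarith
      then show ?thesis using Hc[OF N0] by linarith
    qed
    moreover have "tl_tree ((stept ^^ n) (initt x)) \<noteq> Leaf \<longleftrightarrow> k \<le> num_vars C \<and> hittable k ?cs"
      using it[of n] n(2) by (simp add: st_def)
    ultimately show ?thesis unfolding N_def by blast
  qed
  show ?thesis by (intro exI[of _ ?p] exI[of _ c]) (use main in blast)
qed

section \<open>Branching width and genus\<close>

text \<open>By monotonicity a hitting set with at most \<open>k\<close> elements can be padded to
  weight exactly \<open>k\<close>, provided that there are \<open>k\<close> variables. Elements of
  the hitting set that are not variables are dropped first.\<close>

lemma satisfiable_iff_hittable: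
  assumes wf: "wf_circuit C" and mono: "monotone_circuit C"
  shows "(\<exists>A \<subseteq> {..<num_vars C}. card A = k \<and> satisfies A C) \<longleftrightarrow>
    k \<le> num_vars C \<and> hittable k (map clause_of (and_inputs C))"
proof -
  have pos: "\<exists>v < num_vars C. l = Pos v" if "i \<in> set (and_inputs C)" "l \<in> literals i" for i l
    using that wf mono unfolding wf_circuit_def monotone_circuit_def circuit_literals_def by fastforce
  have eval: "eval_and_input A i \<longleftrightarrow> (\<exists>v\<in>A. Suc v \<in> set (clause_of i))" if i: "i \<in> set (and_inputs C)" for A i
  proof (cases i)
    case (Lit l)
    then show ?thesis using pos[OF i, of l] by auto
  next
    case (Or ls)
    have l: "\<exists>v. l = Pos v" if "l \<in> set ls" for l using pos[OF i, of l] Or that by auto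
    have "eval_literal A l \<longleftrightarrow> var l \<in> A" if "l \<in> set ls" for l using l[OF that] by auto
    then show ?thesis using Or by auto
  qed
  have lt: "v < num_vars C" if "i \<in> set (and_inputs C)" "Suc v \<in> set (clause_of i)" for i v
    using that(2) pos[OF that(1)] by (cases i) fastforce+
  have ge: "\<exists>v. u = Suc v" if "u \<in> set (clause_of i)" for u i
    using that by (cases i) auto
  show ?thesis
  proof
    assume "\<exists>A \<subseteq> {..<num_vars C}. card A = k \<and> satisfies A C"
    then obtain A where A: "A \<subseteq> {..<num_vars C}" "card A = k" "satisfies A C" by blast
    have fin: "finite A" using A(1) finite_subset by blast
    have "k \<le> num_vars C" using card_mono[OF _ A(1)] A(2) by simp
    moreover have "hittable k (map clause_of (and_inputs C))"
      unfolding hittable_def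
    proof (intro exI[of _ "Suc ` A"] conjI ballI)
      show "card (Suc ` A) \<le> k" using A(2) by (simp add: card_image)
      fix c assume "c \<in> set (map clause_of (and_inputs C))"
      then obtain i where "i \<in> set (and_inputs C)" "c = clause_of i" by auto
      then show "Suc ` A \<inter> set c \<noteq> {}" using A(3) eval[of i A] unfolding satisfies_def by blast
    qed (use fin in simp)
    ultimately show "k \<le> num_vars C \<and> hittable k (map clause_of (and_inputs C))" ..
  next
    assume k: "k \<le> num_vars C \<and> hittable k (map clause_of (and_inputs C))"
    then obtain A0 where A0: "finite A0" "card A0 \<le> k"
      "\<And>i. i \<in> set (and_inputs C) \<Longrightarrow> A0 \<inter> set (clause_of i) \<noteq> {}" by (auto simp: hittable_def)
    define A1 where "A1 = {v. v < num_vars C \<and> Suc v \<in> A0}"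
    have "card A1 = card (Suc ` A1)" by (simp add: card_image)
    also have "\<dots> \<le> card A0" using A0(1) by (intro card_mono) (auto simp: A1_def)
    finally have "card A1 \<le> k" using A0(2) by simp
    moreover have "A1 \<subseteq> {..<num_vars C}" by (auto simp: A1_def)
    ultimately obtain A where A: "A1 \<subseteq> A" "A \<subseteq> {..<num_vars C}" "card A = k"
      using exists_subset_between[of A1 k "{..<num_vars C}"] k by auto
    have "eval_and_input A i" if i: "i \<in> set (and_inputs C)" for i
    proof -
      obtain u where u: "u \<in> A0" "u \<in> set (clause_of i)" using A0(3)[OF i] by auto
      then obtain v where v: "u = Suc v" using ge by blast
      then have "v \<in> A1" using u lt[OF i] by (auto simp: A1_def)
      then show ?thesis using eval[OF i] A(1) u v by auto
    qed
    then show "\<exists>A \<subseteq> {..<num_vars C}. card A = k \<and> satisfies A C"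
      using A unfolding satisfies_def by blast
  qed
qed

lemma circuit_ugraph:
  assumes "G = remove_vertex Output (circuit_graph C)"
  shows "ugraph (pverts G) (parcs G)"
proof -
  have "finite (literals i)" for i by (cases i) auto
  then have "finite (circuit_literals C)" by (simp add: circuit_literals_def)
  moreover have "finite (or_gates C)" by (simp add: or_gates_def)
  ultimately have "finite (pverts G)" using assms by (simp add: remove_vertex_def circuit_graph_def)
  moreover have "l \<in> circuit_literals C" if "j \<in> or_gates C" "l \<in> literals (and_inputs C ! j)" for l j
  proof -
    have "and_inputs C ! j \<in> set (and_inputs C)" using that by (simp add: or_gates_def)
    then show ?thesis using that(2) unfolding circuit_literals_def by blast
  qed
  then have "parcs G \<subseteq> pverts G \<times> pverts G"
    using assms by (auto simp: remove_vertex_def circuit_graph_def wires_def)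
  moreover have "sym (parcs G)" "irrefl (parcs G)"
    using assms by (auto simp: remove_vertex_def circuit_graph_def wires_def sym_def irrefl_def)
  ultimately show ?thesis by (simp add: ugraph_def)
qed

text \<open>Double counting: if every remaining clause keeps at least \<open>d\<close>
  representatives, there are at least \<open>d * card J\<close> edges, whereas the genus allows only
  \<open>19 * card J + 24 * circuit_genus C\<close>.\<close>

lemma length_shortest_le_genus:
  assumes mono: "monotone_circuit C"
    and ne: "filter P (map clause_of (and_inputs C)) \<noteq> []"
  shows "length (shortest (filter P (map clause_of (and_inputs C)))) \<le> 19 + 24 * circuit_genus C"
proof -
  define cl where "cl j = clause_of (and_inputs C ! j)" for j
  define ds where "ds = filter P (map clause_of (and_inputs C))"
  \<comment> \<open>Positions instead of clauses, because equal clauses are different gates of the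
    circuit.\<close>
  define J where "J = {j. j < length (and_inputs C) \<and> P (cl j)}"
  define d where "d = length (shortest ds)"
  have ds: "set ds = cl ` J" by (auto simp: ds_def J_def cl_def in_set_conv_nth intro!: imageI)
  have fJ: "finite J" by (simp add: J_def)
  have J0: "J \<noteq> {}" using ne ds unfolding ds_def[symmetric] by (cases ds) auto
  have d: "d \<le> length (reduce ds (cl j))" if "j \<in> J" for j
    unfolding d_def using shortest_le[of ds "cl j"] ne ds that by (auto simp: ds_def)
  show ?thesis
  \<comment> \<open>A literal input is wired to the removed output gate and so has no gate in the
    graph, but it is a clause of length 1.\<close>
  proof (cases "\<exists>j\<in>J. \<exists>l. and_inputs C ! j = Lit l")
    case True
    then obtain j l where "j \<in> J" "and_inputs C ! j = Lit l" by blast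
    then have "d \<le> 1" using d[of j] length_reduce_le[of ds "cl j"] by (simp add: cl_def)
    then show ?thesis by (simp add: d_def ds_def)
  next
    case False
    have orJ: "j \<in> or_gates C" "\<exists>ls. and_inputs C ! j = Or ls" if "j \<in> J" for j
    proof -
      show "\<exists>ls. and_inputs C ! j = Or ls" using that False by (cases "and_inputs C ! j") auto
      then show "j \<in> or_gates C" using that by (simp add: or_gates_def J_def)
    qed
    have clJ: "\<exists>v. u = Suc v \<and> Pos v \<in> literals (and_inputs C ! j)" if j: "j \<in> J" and u: "u \<in> set (cl j)" for j u
    proof -
      obtain ls where ls: "and_inputs C ! j = Or ls" using orJ(2)[OF j] by blast
      then obtain l where l: "l \<in> set ls" "u = Suc (var l)" using u by (auto simp: cl_def)
      have "and_inputs C ! j \<in> set (and_inputs C)" using j by (simp add: J_def)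
      then have "l \<in> circuit_literals C" using l ls unfolding circuit_literals_def by force
      then obtain v where "l = Pos v" using mono by (auto simp: monotone_circuit_def)
      then show ?thesis using l ls by auto
    qed
    \<comment> \<open>\<open>reduce\<close> may keep different members of a class in different
      clauses. The graph needs one global choice, as otherwise two equivalent variables could have
      distinct neighbourhoods in it or too many edges would be kept.\<close>
    define rep where "rep v = (LEAST w. equiv_vars ds v w)" for v
    have rep: "equiv_vars ds v (rep v)" for v
      unfolding rep_def by (rule LeastI[of _ v]) (simp add: equiv_vars_def)
    have rep_eq: "rep v = rep w" if "equiv_vars ds v w" for v w
    proof -
      have "equiv_vars ds v = equiv_vars ds w" using that by (auto simp: equiv_vars_def fun_eq_iff)
      then show ?thesis by (simp add: rep_def)
    qed
    define G where "G = remove_vertex Output (circuit_graph C)"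
    define B where "B = {(Input (Pos v), OrGate j) | v j. j \<in> J \<and> Suc v \<in> set (cl j) \<and> rep (Suc v) = Suc v}"
    have uG: "ugraph (pverts G) (parcs G)" using circuit_ugraph[OF G_def] .
    obtain \<pi> where \<pi>: "rotation (pverts G) (parcs G) \<pi>"
      "euler_defect (pverts G) (parcs G) \<pi> = - 2 * int (circuit_genus C)"
      using graph_genus_rotation[OF uG] unfolding circuit_genus_def G_def by blast
    have BA: "B \<subseteq> parcs G"
      using orJ(1) clJ by (fastforce simp: B_def G_def remove_vertex_def circuit_graph_def wires_def)
    have BXY: "B \<subseteq> range Input \<times> OrGate ` J" by (auto simp: B_def)
    have fB: "finite B" using BA ugraph_finite[OF uG] by (rule finite_subset)
    have inj: "inj_on (\<lambda>x. B `` {x}) (Domain B)"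
    proof (rule inj_onI)
      fix x y assume xy: "x \<in> Domain B" "y \<in> Domain B" "B `` {x} = B `` {y}"
      from xy(1) obtain v where v: "x = Input (Pos v)" "rep (Suc v) = Suc v" by (auto simp: B_def)
      from xy(2) obtain w where w: "y = Input (Pos w)" "rep (Suc w) = Suc w" by (auto simp: B_def)
      have "Suc v \<in> set (cl j) \<longleftrightarrow> Suc w \<in> set (cl j)" if "j \<in> J" for j
      proof -
        have "OrGate j \<in> B `` {x} \<longleftrightarrow> Suc v \<in> set (cl j)" "OrGate j \<in> B `` {y} \<longleftrightarrow> Suc w \<in> set (cl j)"
          using that v w by (auto simp: B_def)
        then show ?thesis using xy(3) by simp
      qed
      then have "equiv_vars ds (Suc v) (Suc w)" using ds by (auto simp: equiv_vars_def)
      from rep_eq[OF this] have "Suc v = Suc w" unfolding v(2) w(2) .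
      then show "x = y" using v(1) w(1) by simp
    qed
    have up: "card B \<le> 19 * card J + 24 * circuit_genus C"
    proof -
      have "card B \<le> 19 * card (OrGate ` J) + 24 * circuit_genus C"
        by (rule bipartite_edges_le[OF uG \<pi> BA BXY _ _ inj]) (use fJ in auto)
      then show ?thesis by (simp add: card_image inj_on_def)
    qed
    \<comment> \<open>\<open>rep\<close> is injective on a reduced clause and does not leave the
      clause, as membership in a clause is the same throughout a class.\<close>
    have fib: "d \<le> card (B\<inverse> `` {OrGate j})" if j: "j \<in> J" for j
    proof -
      let ?r = "reduce ds (cl j)"
      have "inj_on rep (set ?r)"
      proof (rule inj_onI)
        fix v w assume vw: "v \<in> set ?r" "w \<in> set ?r" "rep v = rep w"
        then have "equiv_vars ds v w" using rep[of v] rep[of w] by (auto simp: equiv_vars_def)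
        then show "v = w" using reduce_inequiv vw by blast
      qed
      then have "length ?r = card (rep ` set ?r)" using distinct_card[OF distinct_reduce] by (simp add: card_image)
      also have "\<dots> \<le> card ((\<lambda>u. Input (Pos (u - 1))) ` (rep ` set ?r))"
      proof -
        have "inj_on (\<lambda>u. Input (Pos (u - 1))) (rep ` set ?r)"
        proof (rule inj_onI)
          fix x y assume xy: "x \<in> rep ` set ?r" "y \<in> rep ` set ?r" "Input (Pos (x - 1)) = Input (Pos (y - 1))"
          have "z > 0" if z: "z \<in> rep ` set ?r" for z
          proof -
            from z obtain u where u: "u \<in> set ?r" "z = rep u" by auto
            then have "u \<in> set (cl j)" using reduce_subset by blast
            then have "z \<in> set (cl j)" using rep[of u] u ds j by (auto simp: equiv_vars_def)
            then show ?thesis using clJ[OF j] by auto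
          qed
          from this[OF xy(1)] this[OF xy(2)] show "x = y" using xy(3) by simp
        qed
        then show ?thesis by (simp add: card_image)
      qed
      also have "\<dots> \<le> card (B\<inverse> `` {OrGate j})"
      proof (rule card_mono)
        show "finite (B\<inverse> `` {OrGate j})" using fB by (intro finite_subset[OF _ finite_Domain[OF fB]]) auto
        show "(\<lambda>u. Input (Pos (u - 1))) ` (rep ` set ?r) \<subseteq> B\<inverse> `` {OrGate j}"
        proof
          fix z assume "z \<in> (\<lambda>u. Input (Pos (u - 1))) ` (rep ` set ?r)"
          then obtain u where "u \<in> set ?r" and z: "z = Input (Pos (rep u - 1))" by blast
          then have "u \<in> set (cl j)" using reduce_subset by blast
          then have r: "rep u \<in> set (cl j)" using rep[of u] ds j by (auto simp: equiv_vars_def)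
          then obtain v where v: "rep u = Suc v" using clJ[OF j] by blast
          have "rep (rep u) = rep u" using rep_eq[OF rep[of u]] by simp
          then show "z \<in> B\<inverse> `` {OrGate j}" using r v j by (auto simp: B_def z)
        qed
      qed
      finally show ?thesis using d[OF j] by simp
    qed
    have "d * card J \<le> card B"
    proof (cases "d = 0")
      case False
      have "Domain (B\<inverse>) = OrGate ` J"
      proof
        show "OrGate ` J \<subseteq> Domain (B\<inverse>)"
        proof clarify
          fix j assume "j \<in> J"
          then have "0 < card (B\<inverse> `` {OrGate j})" using fib[of j] False by simp
          then have "B\<inverse> `` {OrGate j} \<noteq> {}" by auto
          then show "OrGate j \<in> Domain (B\<inverse>)" by auto
        qed
      qed (auto simp: B_def)
      then show ?thesis using card_edges_ge[of "B\<inverse>" d] fib fB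
        by (auto simp: card_image inj_on_def card_inverse)
    qed simp
    then have "d * card J \<le> 19 * card J + 24 * circuit_genus C" using up by simp
    \<comment> \<open>Uses that \<open>card J\<close> is at least 1, the list of remaining clauses
      being nonempty.\<close>
    also have "\<dots> \<le> (19 + 24 * circuit_genus C) * card J"
      using J0 fJ by (simp add: algebra_simps Suc_le_eq card_gt_0_iff)
    finally have "d \<le> 19 + 24 * circuit_genus C" using J0 fJ by (simp add: card_gt_0_iff)
    then show ?thesis by (simp add: d_def ds_def)
  qed
qed

text \<open>The fallback for circuits with few variables, where the asymptotic bound on the genus
  says nothing.\<close>

lemma length_shortest_le_num_vars:
  assumes wf: "wf_circuit C"
    and ne: "filter P (map clause_of (and_inputs C)) \<noteq> []"
  shows "length (shortest (filter P (map clause_of (and_inputs C)))) \<le> num_vars C"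
proof -
  let ?ds = "filter P (map clause_of (and_inputs C))"
  obtain i where i: "i \<in> set (and_inputs C)" "shortest ?ds = reduce ?ds (clause_of i)"
    using shortest_in[OF ne] by auto
  have "set (clause_of i) \<subseteq> Suc ` {..<num_vars C}"
  proof
    fix u assume "u \<in> set (clause_of i)"
    then obtain l where l: "l \<in> literals i" "u = Suc (var l)" by (cases i) auto
    then have "var l < num_vars C" using wf i(1) by (auto simp: wf_circuit_def circuit_literals_def)
    then show "u \<in> Suc ` {..<num_vars C}" using l by simp
  qed
  then have "set (shortest ?ds) \<subseteq> Suc ` {..<num_vars C}" using i(2) reduce_subset by fastforce
  then have "card (set (shortest ?ds)) \<le> num_vars C"
    using card_mono[of "Suc ` {..<num_vars C}"] by (simp add: card_image)
  then show ?thesis using distinct_card[OF distinct_reduce] i(2) by metis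
qed

section \<open>Computable functions\<close>

text \<open>With \<open>T\<close> arbitrary, this only asserts halting on every tree, along with the
  scratch convention.\<close>

definition tcomp :: "(tree \<Rightarrow> tree) \<Rightarrow> bool" where
  "tcomp F \<longleftrightarrow> (\<exists>p V T. impl p V F T)"

lemma ptime_imp_tcomp: "ptime F \<Longrightarrow> tcomp F"
  by (auto simp: ptime_def tcomp_def)

lemma tcomp_comp: "tcomp G \<Longrightarrow> tcomp F \<Longrightarrow> tcomp (\<lambda>x. G (F x))"
  unfolding tcomp_def by (elim exE) (rule exI, rule exI, rule exI, rule impl_comp)

lemma tcomp_Node: "tcomp F \<Longrightarrow> tcomp G \<Longrightarrow> tcomp (\<lambda>x. Node (F x) (G x))"
  unfolding tcomp_def by (elim exE) (drule (1) impl_Node, blast)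

lemma tcomp_loop:
  assumes "tcomp P" "tcomp B"
    and "\<And>x. hd_tree ((B ^^ n x) (P x)) = Leaf" "\<And>x i. i < n x \<Longrightarrow> hd_tree ((B ^^ i) (P x)) \<noteq> Leaf"
  shows "tcomp (\<lambda>x. (B ^^ n x) (P x))"
proof -
  obtain q W U p V T where i: "impl q W P U" "impl p V B T" using assms(1,2) by (auto simp: tcomp_def)
  show ?thesis unfolding tcomp_def using impl_loop[where n = n, OF i assms(3,4)] by blast
qed

lemma tcomp_id: "tcomp (\<lambda>x. x)"
  by (rule ptime_imp_tcomp[OF ptime_id])

lemma tcomp_Leaf: "tcomp (\<lambda>x. Leaf)"
  by (rule ptime_imp_tcomp[OF ptime_Leaf])

lemma tcomp_hd: "tcomp F \<Longrightarrow> tcomp (\<lambda>x. hd_tree (F x))"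
  by (rule tcomp_comp[of hd_tree]) (auto intro: ptime_imp_tcomp ptime_hd[OF ptime_id])

lemma tcomp_tl: "tcomp F \<Longrightarrow> tcomp (\<lambda>x. tl_tree (F x))"
  by (rule tcomp_comp[of tl_tree]) (auto intro: ptime_imp_tcomp ptime_tl[OF ptime_id])

lemma tcomp_dropt: "tcomp F \<Longrightarrow> tcomp G \<Longrightarrow> tcomp (\<lambda>x. dropt (F x) (G x))"
proof -
  assume "tcomp F" "tcomp G"
  moreover have "tcomp (\<lambda>z. dropt (hd_tree z) (tl_tree z))"
    by (intro ptime_imp_tcomp ptime_dropt ptime_hd ptime_tl ptime_id)
  ultimately show ?thesis
    using tcomp_comp[of "\<lambda>z. dropt (hd_tree z) (tl_tree z)" "\<lambda>x. Node (F x) (G x)"] by (simp add: tcomp_Node)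
qed

lemma tcomp_foldt:
  assumes G: "tcomp G" and X: "tcomp X" and A: "tcomp A" and E: "tcomp E"
  shows "tcomp (\<lambda>u. foldt G (E u) (X u) (A u))"
proof -
  define P where "P u = Node (X u) (Node (A u) (E u))" for u
  have "tcomp (\<lambda>u. (foldt_step G ^^ spine (X u)) (P u))"
  proof (rule tcomp_loop)
    show "tcomp P" unfolding P_def by (intro tcomp_Node X A E)
    show "tcomp (foldt_step G)"
      by (intro tcomp_Node tcomp_tl tcomp_hd tcomp_id tcomp_comp[OF G])
    show "hd_tree ((foldt_step G ^^ spine (X u)) (P u)) = Leaf" for u
      by (simp add: foldt_step_funpow_hd P_def funpow_tl_eq_Leaf)
    show "hd_tree ((foldt_step G ^^ i) (P u)) \<noteq> Leaf" if "i < spine (X u)" for u i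
      using that by (simp add: foldt_step_funpow_hd P_def funpow_tl_eq_Leaf)
  qed
  then have "tcomp (\<lambda>u. hd_tree (tl_tree ((foldt_step G ^^ spine (X u)) (P u))))"
    by (intro tcomp_hd tcomp_tl)
  then show ?thesis by (simp add: P_def foldt_step_funpow)
qed

text \<open>A computable function is only known to be computed on unary numerals. Composing with the
  spine makes it total on trees.\<close>

definition ncomp :: "(nat \<Rightarrow> nat) \<Rightarrow> bool" where
  "ncomp f \<longleftrightarrow> tcomp (\<lambda>x. enc_nat (f (spine x)))"

lemma ncomp_imp_computable:
  assumes "ncomp f"
  shows "computable f"
proof -
  obtain p V T where p: "impl p V (\<lambda>x. enc_nat (f (spine x))) T" using assms by (auto simp: ncomp_def tcomp_def)
  have "\<exists>t. runs p (enc_nat n) t (enc_nat (f n))" for n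
  proof -
    let ?s = "(\<lambda>_. Leaf)(0 := enc_nat n)"
    obtain t where "exec p ?s t (?s(0 := enc_nat (f (spine (?s 0)))))"
      by (rule implE[OF p, of ?s]) auto
    then show ?thesis unfolding runs_def
      by (intro exI[of _ t] exI[of _ "?s(0 := enc_nat (f (spine (?s 0))))"] conjI) (simp_all add: spine_enc_nat)
  qed
  then show ?thesis unfolding computable_def by blast
qed

lemma foldt_enc_nat:
  assumes "\<And>a. G (Node Leaf (Node (E a) env)) = E (g a)"
  shows "foldt G env (enc_nat n) (E a) = E ((g ^^ n) a)"
  by (induction n arbitrary: a) (simp_all add: assms funpow_Suc_right del: funpow.simps(2))

section \<open>Arithmetic on unary numerals\<close>

definition addt :: "tree \<Rightarrow> tree \<Rightarrow> tree" where
  "addt a b = foldt (\<lambda>z. Node Leaf (hd_tree (tl_tree z))) Leaf a b"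

lemma tcomp_addt: "tcomp F \<Longrightarrow> tcomp G \<Longrightarrow> tcomp (\<lambda>x. addt (F x) (G x))"
  unfolding addt_def by (intro tcomp_foldt tcomp_Node tcomp_hd tcomp_tl tcomp_Leaf tcomp_id)

lemma addt_eq: "addt x (enc_nat n) = enc_nat (spine x + n)"
proof -
  have "foldt (\<lambda>z. Node Leaf (hd_tree (tl_tree z))) Leaf x (enc_nat n) = enc_nat (spine x + n)" for n
  proof (induction x arbitrary: n)
    case (Node x xs)
    show ?case using Node.IH(2)[of "Suc n"] by simp
  qed simp
  then show ?thesis by (simp add: addt_def)
qed

definition multt :: "tree \<Rightarrow> tree \<Rightarrow> tree" where
  "multt a b = foldt (\<lambda>z. addt (tl_tree (tl_tree z)) (hd_tree (tl_tree z))) b a Leaf"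

lemma tcomp_multt: "tcomp F \<Longrightarrow> tcomp G \<Longrightarrow> tcomp (\<lambda>x. multt (F x) (G x))"
  unfolding multt_def by (intro tcomp_foldt tcomp_addt tcomp_hd tcomp_tl tcomp_Leaf tcomp_id)

lemma multt_eq: "multt (enc_nat m) (enc_nat n) = enc_nat (m * n)"
proof -
  have "multt (enc_nat m) (enc_nat n) = enc_nat (((+) n ^^ m) 0)"
    unfolding multt_def
    using foldt_enc_nat[where E = enc_nat and env = "enc_nat n" and g = "(+) n" and n = m and a = 0]
    by (simp add: addt_eq spine_enc_nat)
  moreover have "((+) n ^^ m) a = m * n + a" for a
    by (induction m) auto
  ultimately show ?thesis by simp
qed

definition powt :: "tree \<Rightarrow> tree \<Rightarrow> tree" where
  "powt b e = foldt (\<lambda>z. multt (tl_tree (tl_tree z)) (hd_tree (tl_tree z))) b e (Node Leaf Leaf)"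

lemma tcomp_powt: "tcomp F \<Longrightarrow> tcomp G \<Longrightarrow> tcomp (\<lambda>x. powt (F x) (G x))"
  unfolding powt_def by (intro tcomp_foldt tcomp_multt tcomp_hd tcomp_tl tcomp_Leaf tcomp_id tcomp_Node)

lemma powt_eq: "powt (enc_nat b) (enc_nat e) = enc_nat (b ^ e)"
proof -
  have "powt (enc_nat b) (enc_nat e) = enc_nat (((*) b ^^ e) 1)"
    unfolding powt_def
    using foldt_enc_nat[where E = enc_nat and env = "enc_nat b" and g = "(*) b" and n = e and a = 1]
    by (simp add: multt_eq)
  moreover have "((*) b ^^ e) 1 = b ^ e"
    by (induction e) auto
  ultimately show ?thesis by simp
qed

lemma ncomp_const: "ncomp (\<lambda>_. c)"
proof -
  have "tcomp (\<lambda>_. enc_nat c)" by (induction c) (auto intro: tcomp_Leaf tcomp_Node)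
  then show ?thesis by (simp add: ncomp_def)
qed

text \<open>Adding zero turns an arbitrary tree into the numeral of its spine.\<close>

lemma ncomp_id: "ncomp (\<lambda>n. n)"
proof -
  have "tcomp (\<lambda>x. addt x (enc_nat 0))" by (simp add: tcomp_addt tcomp_id tcomp_Leaf)
  then show ?thesis by (simp add: ncomp_def addt_eq del: enc_nat.simps)
qed

lemma ncomp_add: "ncomp f \<Longrightarrow> ncomp g \<Longrightarrow> ncomp (\<lambda>n. f n + g n)"
  unfolding ncomp_def using tcomp_addt[of "\<lambda>x. enc_nat (f (spine x))" "\<lambda>x. enc_nat (g (spine x))"]
  by (simp add: addt_eq spine_enc_nat)

lemma ncomp_mult: "ncomp f \<Longrightarrow> ncomp g \<Longrightarrow> ncomp (\<lambda>n. f n * g n)"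
  unfolding ncomp_def using tcomp_multt[of "\<lambda>x. enc_nat (f (spine x))" "\<lambda>x. enc_nat (g (spine x))"]
  by (simp add: multt_eq)

lemma ncomp_power: "ncomp f \<Longrightarrow> ncomp g \<Longrightarrow> ncomp (\<lambda>n. f n ^ g n)"
  unfolding ncomp_def using tcomp_powt[of "\<lambda>x. enc_nat (f (spine x))" "\<lambda>x. enc_nat (g (spine x))"]
  by (simp add: powt_eq)

section \<open>Running a given program as a subroutine\<close>

fun expr_vars_below :: "nat \<Rightarrow> expr \<Rightarrow> bool" where
  "expr_vars_below m (Var v) \<longleftrightarrow> v < m"
| "expr_vars_below m LeafE \<longleftrightarrow> True"
| "expr_vars_below m (ConsE a b) \<longleftrightarrow> expr_vars_below m a \<and> expr_vars_below m b"
| "expr_vars_below m (HdE a) \<longleftrightarrow> expr_vars_below m a"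
| "expr_vars_below m (TlE a) \<longleftrightarrow> expr_vars_below m a"

fun vars_below :: "nat \<Rightarrow> com \<Rightarrow> bool" where
  "vars_below m Skip \<longleftrightarrow> True"
| "vars_below m (Assign v e) \<longleftrightarrow> v < m \<and> expr_vars_below m e"
| "vars_below m (Seq c d) \<longleftrightarrow> vars_below m c \<and> vars_below m d"
| "vars_below m (If e c d) \<longleftrightarrow> expr_vars_below m e \<and> vars_below m c \<and> vars_below m d"
| "vars_below m (While e c) \<longleftrightarrow> expr_vars_below m e \<and> vars_below m c"

lemma expr_vars_below_mono: "expr_vars_below m e \<Longrightarrow> m \<le> n \<Longrightarrow> expr_vars_below n e"
  by (induction e) auto

lemma vars_below_mono: "vars_below m c \<Longrightarrow> m \<le> n \<Longrightarrow> vars_below n c"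
  by (induction c) (auto intro: expr_vars_below_mono)

lemma ex_expr_vars_below: "\<exists>m. expr_vars_below m e"
proof (induction e)
  case (ConsE a b)
  then show ?case by (meson expr_vars_below.simps(3) expr_vars_below_mono max.cobounded1 max.cobounded2)
qed auto

lemma ex_vars_below: "\<exists>m. vars_below m c"
proof (induction c)
  case (Assign v e)
  obtain m where "expr_vars_below m e" using ex_expr_vars_below by blast
  then have "expr_vars_below (max m (Suc v)) e" by (rule expr_vars_below_mono) simp
  then show ?case by (intro exI[of _ "max m (Suc v)"]) simp
next
  case (Seq c d)
  then obtain m n where "vars_below m c" "vars_below n d" by blast
  then have "vars_below (max m n) c" "vars_below (max m n) d" by (auto elim: vars_below_mono)
  then show ?case by auto
next
  case (If e c d)
  then obtain m n l where "vars_below m c" "vars_below n d" "expr_vars_below l e"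
    using ex_expr_vars_below by blast
  then have "vars_below (max l (max m n)) c" "vars_below (max l (max m n)) d" "expr_vars_below (max l (max m n)) e"
    by (auto elim!: vars_below_mono expr_vars_below_mono)
  then show ?case by auto
next
  case (While e c)
  then obtain m l where "vars_below m c" "expr_vars_below l e"
    using ex_expr_vars_below by blast
  then have "vars_below (max l m) c" "expr_vars_below (max l m) e"
    by (auto elim!: vars_below_mono expr_vars_below_mono)
  then show ?case by auto
qed auto

lemma eval_expr_cong:
  "expr_vars_below m e \<Longrightarrow> (\<And>v. v < m \<Longrightarrow> s v = r v) \<Longrightarrow> eval_expr e s = eval_expr e r"
  by (induction e) auto

text \<open>\<open>computable\<close> speaks only about stores that are leaves outside variable 0. A
  program sees finitely many variables, so it runs alike in any store that agrees on those.\<close>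

lemma exec_frame:
  assumes "exec c s t s'" "vars_below m c" "\<And>v. v < m \<Longrightarrow> s v = r v"
  shows "exec c r t (\<lambda>v. if v < m then s' v else r v)"
  using assms
proof (induction arbitrary: r rule: exec.induct)
  case (exec_Skip s)
  have "(\<lambda>v. if v < m then s v else r v) = r" using exec_Skip by auto
  then show ?case using exec.exec_Skip[of r] by simp
next
  case (exec_Assign v e s)
  have "eval_expr e s = eval_expr e r" using exec_Assign by (intro eval_expr_cong[of m]) auto
  then have "(\<lambda>u. if u < m then (s(v := eval_expr e s)) u else r u) = r(v := eval_expr e r)"
    using exec_Assign by auto
  then show ?case using exec.exec_Assign[of v e r] by simp
next
  case (exec_Seq c1 s1 t1 s2 c2 t2 s3)
  let ?r = "\<lambda>v. if v < m then s2 v else r v"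
  have "exec c1 r t1 ?r" using exec_Seq by auto
  moreover have "exec c2 ?r t2 (\<lambda>v. if v < m then s3 v else ?r v)" using exec_Seq.prems by (intro exec_Seq.IH) auto
  moreover have "(\<lambda>v. if v < m then s3 v else ?r v) = (\<lambda>v. if v < m then s3 v else r v)" by auto
  ultimately show ?case using exec.exec_Seq by metis
next
  case (exec_IfTrue e s c1 t s' c2)
  have "eval_expr e s = eval_expr e r" using exec_IfTrue.prems by (intro eval_expr_cong[of m]) auto
  then show ?case using exec_IfTrue by (intro exec.exec_IfTrue) auto
next
  case (exec_IfFalse e s c2 t s' c1)
  have "eval_expr e s = eval_expr e r" using exec_IfFalse.prems by (intro eval_expr_cong[of m]) auto
  then show ?case using exec_IfFalse by (intro exec.exec_IfFalse) auto
next
  case (exec_WhileFalse e s c)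
  have "eval_expr e s = eval_expr e r" using exec_WhileFalse.prems by (intro eval_expr_cong[of m]) auto
  moreover have "(\<lambda>v. if v < m then s v else r v) = r" using exec_WhileFalse by auto
  ultimately show ?case using exec.exec_WhileFalse[of e r c] exec_WhileFalse.hyps by simp
next
  case (exec_WhileTrue e s1 c t1 s2 t2 s3)
  let ?r = "\<lambda>v. if v < m then s2 v else r v"
  have e: "eval_expr e s1 = eval_expr e r" using exec_WhileTrue.prems by (intro eval_expr_cong[of m]) auto
  have "exec c r t1 ?r" using exec_WhileTrue.prems by (intro exec_WhileTrue.IH) auto
  moreover have "exec (While e c) ?r t2 (\<lambda>v. if v < m then s3 v else ?r v)"
    using exec_WhileTrue.prems by (intro exec_WhileTrue.IH) auto
  moreover have "(\<lambda>v. if v < m then s3 v else ?r v) = (\<lambda>v. if v < m then s3 v else r v)" by auto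
  ultimately show ?case using exec.exec_WhileTrue exec_WhileTrue.hyps(1) e by metis
qed

fun clear :: "nat \<Rightarrow> com" where
  "clear 0 = Skip"
| "clear (Suc v) = Seq (clear v) (Assign (Suc v) LeafE)"

lemma exec_clear: "exec (clear n) s (1 + 3 * n) (\<lambda>v. if 0 < v \<and> v \<le> n then Leaf else s v)"
proof (induction n)
  case 0
  have "(\<lambda>v. if 0 < v \<and> v \<le> 0 then Leaf else s v) = s" by auto
  then show ?case using exec_Skip[of s] by (simp only: clear.simps) simp
next
  case (Suc n)
  have "exec (Assign (Suc n) LeafE) (\<lambda>v. if 0 < v \<and> v \<le> n then Leaf else s v) 2
    (\<lambda>v. if 0 < v \<and> v \<le> Suc n then Leaf else s v)"
    by (rule exec_Assign') (auto simp: fun_eq_iff)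
  with Suc show ?case unfolding clear.simps by (rule exec_Seq') simp
qed

text \<open>The given program is only specified on numerals and may leave rubbish behind. So its
  input is normalised first and its variables are cleared afterwards.\<close>

lemma computable_imp_ncomp:
  assumes "computable f"
  shows "ncomp f"
proof -
  obtain p where p: "\<And>n. \<exists>t. runs p (enc_nat n) t (enc_nat (f n))" using assms by (auto simp: computable_def)
  obtain m where "vars_below m p" using ex_vars_below by blast
  \<comment> \<open>With \<open>Suc m\<close> the range contains the output variable 0, and the
    variables other than 0 are exactly those that \<open>clear m\<close> resets.\<close>
  then have m: "vars_below (Suc m) p" by (rule vars_below_mono) simp
  obtain q V T where q: "impl q V (\<lambda>x. enc_nat (spine x)) T" using ncomp_id by (auto simp: ncomp_def tcomp_def)
  define W where "W = max V (Suc m)"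
  let ?p = "Seq q (Seq p (clear m))"
  obtain \<tau> r where \<tau>: "\<And>n. exec p ((\<lambda>_. Leaf)(0 := enc_nat n)) (\<tau> n) (r n)" "\<And>n. r n 0 = enc_nat (f n)"
    using p unfolding runs_def by metis
  have run: "\<exists>t \<le> 3 + T (s 0) + \<tau> (spine (s 0)) + 3 * m. exec ?p s t (s(0 := enc_nat (f (spine (s 0)))))"
    if s: "\<And>v. 0 < v \<Longrightarrow> v < W \<Longrightarrow> s v = Leaf" for s
  proof -
    let ?n = "spine (s 0)"
    let ?r = "s(0 := enc_nat ?n)"
    obtain t0 where t0: "t0 \<le> T (s 0)" "exec q s t0 ?r"
      by (rule implE[OF q, of s]) (use s in \<open>auto simp: W_def\<close>)
    have t1: "exec p ?r (\<tau> ?n) (\<lambda>v. if v < Suc m then r ?n v else ?r v)"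
      by (rule exec_frame[OF \<tau>(1) m]) (use s in \<open>auto simp: W_def\<close>)
    have "(\<lambda>v. if 0 < v \<and> v \<le> m then Leaf else if v < Suc m then r ?n v else ?r v) = s(0 := enc_nat (f ?n))"
      using s \<tau>(2) by (auto simp: fun_eq_iff W_def)
    then have t2: "exec (clear m) (\<lambda>v. if v < Suc m then r ?n v else ?r v) (1 + 3 * m) (s(0 := enc_nat (f ?n)))"
      using exec_clear[of m "\<lambda>v. if v < Suc m then r ?n v else ?r v"] by simp
    show ?thesis using exec_Seq[OF t0(2) exec_Seq[OF t1 t2]] t0(1)
      by (intro exI[of _ "1 + t0 + (1 + \<tau> ?n + (1 + 3 * m))"]) simp
  qed
  have "impl ?p W (\<lambda>x. enc_nat (f (spine x))) (\<lambda>x. 3 + T x + \<tau> (spine x) + 3 * m)"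
    by (rule implI) (use run in \<open>auto simp: W_def\<close>)
  then show ?thesis unfolding ncomp_def tcomp_def by blast
qed

text \<open>The state holds the outcome of the test for the current candidate, the candidate and the
  target \<open>x\<close>. The candidate counts up from \<open>a\<close> until the head becomes a
  leaf.\<close>

lemma ncomp_minimization:
  assumes f: "ncomp f" and unbounded: "\<And>k. \<exists>i. k \<le> f (a + i)"
  shows "ncomp (\<lambda>k. a + (LEAST i. k \<le> f (a + i)))"
proof -
  define M where "M x = enc_nat (f (spine x))" for x
  define P where "P x = Node (dropt (M (enc_nat a)) x) (Node (enc_nat a) x)" for x
  define B where "B z = Node (dropt (M (Node Leaf (hd_tree (tl_tree z)))) (tl_tree (tl_tree z)))
    (Node (Node Leaf (hd_tree (tl_tree z))) (tl_tree (tl_tree z)))" for z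
  define n where "n x = (LEAST i. spine x \<le> f (a + i))" for x
  have M: "tcomp M" using f unfolding ncomp_def M_def[abs_def] .
  have a: "tcomp (\<lambda>_. enc_nat a)" using ncomp_const by (simp add: ncomp_def)
  have it: "(B ^^ i) (P x) = Node (dropt (M (enc_nat (a + i))) x) (Node (enc_nat (a + i)) x)" for i x
    by (induction i) (simp_all add: P_def B_def)
  have hd: "hd_tree ((B ^^ i) (P x)) = Leaf \<longleftrightarrow> spine x \<le> f (a + i)" for i x
    unfolding it by (simp add: dropt_eq_Leaf M_def spine_enc_nat)
  have "tcomp (\<lambda>x. (B ^^ n x) (P x))"
  proof (rule tcomp_loop)
    show "tcomp P" unfolding P_def by (intro tcomp_Node tcomp_dropt tcomp_comp[OF M] a tcomp_id)
    show "tcomp B" unfolding B_def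
      by (intro tcomp_Node tcomp_dropt tcomp_comp[OF M] tcomp_id tcomp_hd tcomp_tl tcomp_Leaf)
    show "hd_tree ((B ^^ n x) (P x)) = Leaf" for x
      unfolding hd n_def using LeastI_ex[OF unbounded] .
    show "hd_tree ((B ^^ i) (P x)) \<noteq> Leaf" if "i < n x" for x i
      unfolding hd using that not_less_Least unfolding n_def by blast
  qed
  then have "tcomp (\<lambda>x. hd_tree (tl_tree ((B ^^ n x) (P x))))" by (intro tcomp_hd tcomp_tl)
  then show ?thesis unfolding ncomp_def it n_def by simp
qed

section \<open>Fixed-parameter tractability\<close>

theorem theorem6:
  fixes g :: "nat \<Rightarrow> real"
  assumes "n_to_the_o1 g"
  shows "fpt_on (instances_of_genus g) wsat_plus"
proof -
  obtain h where h: "effective_smallo h (\<lambda>_. 1)" "\<forall>\<^sub>F n in sequentially. g n \<le> real n powr h n"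
    using assms by (auto simp: n_to_the_o1_def)
  obtain \<mu> :: "nat \<Rightarrow> nat" where \<mu>: "computable \<mu>" "mono \<mu>" "\<And>b. \<exists>n. b < \<mu> n"
    "\<forall>\<^sub>F n in sequentially. h n \<le> 1 / real (\<mu> n)"
    using h(1) by (auto simp: effective_smallo_def)
  obtain N where N: "\<And>n. N \<le> n \<Longrightarrow> g n \<le> real n powr h n \<and> h n \<le> 1 / real (\<mu> n) \<and> 1 \<le> n"
    using eventually_conj[OF h(2) eventually_conj[OF \<mu>(4) eventually_ge_at_top[of 1]]]
    unfolding eventually_sequentially by blast
  \<comment> \<open>An inverse of \<open>\<mu>\<close> that starts at \<open>N\<close>, so that
    \<open>\<nu> k \<le> n\<close> implies both \<open>k \<le> \<mu> n\<close> and that the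
    estimates valid from \<open>N\<close> on apply to \<open>n\<close>.\<close>
  define \<nu> where "\<nu> k = N + (LEAST i. k \<le> \<mu> (N + i))" for k
  have unbounded: "\<exists>i. k \<le> \<mu> (N + i)" for k
  proof -
    obtain n where "k < \<mu> n" using \<mu>(3) by blast
    also have "\<mu> n \<le> \<mu> (N + n)" by (rule monoD[OF \<mu>(2)]) simp
    finally show ?thesis by (intro exI[of _ n]) simp
  qed
  have \<nu>: "ncomp \<nu>" unfolding \<nu>_def
    by (rule ncomp_minimization[OF computable_imp_ncomp[OF \<mu>(1)] unbounded])
  have \<mu>_ge: "k \<le> \<mu> n" if "\<nu> k \<le> n" for k n
  proof -
    have "k \<le> \<mu> (\<nu> k)" unfolding \<nu>_def using LeastI_ex[OF unbounded] .
    also have "\<dots> \<le> \<mu> n" using \<mu>(2) that by (rule monoD)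
    finally show ?thesis .
  qed
  obtain p c where prog: "\<And>C k b. monotone_circuit C \<Longrightarrow>
     (\<And>P. filter P (map clause_of (and_inputs C)) \<noteq> [] \<Longrightarrow>
        length (shortest (filter P (map clause_of (and_inputs C)))) \<le> b) \<Longrightarrow>
     \<exists>t y. runs p (Node (enc_circuit C) (enc_nat k)) t y \<and>
        t \<le> c * ((b + 1) ^ k * tree_size (Node (enc_circuit C) (enc_nat k))) ^ c \<and>
        (y \<noteq> Leaf \<longleftrightarrow> k \<le> num_vars C \<and> hittable k (map clause_of (and_inputs C)))"
    using search_program by blast
  \<comment> \<open>For many variables the base is
    \<open>19 + 24 * ?G + 1 \<le> 44 * max 1 ?G\<close>, which gives 44; the factor
    \<open>\<nu> k + 1\<close> covers the case of fewer than \<open>\<nu> k\<close>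
    variables.\<close>
  define f1 where "f1 k = (44 * (\<nu> k + 1)) ^ k" for k
  \<comment> \<open>The factor \<open>2 * k + 3\<close> pays for the unary parameter in the input of
    the program.\<close>
  define f where "f k = c * (f1 k * (2 * k + 3)) ^ c" for k
  have "computable f" unfolding f_def f1_def
    by (intro ncomp_imp_computable ncomp_mult ncomp_power ncomp_add ncomp_const ncomp_id \<nu>)
  \<comment> \<open>One factor \<open>tree_size x\<close> pays for the number of search nodes and
    one for the length of the input, hence the exponent \<open>2 * c\<close>.\<close>
  moreover have "\<exists>t y. runs p (Node x (enc_nat k)) t y \<and> t \<le> f k * tree_size x ^ (2 * c) \<and>
      (y \<noteq> Leaf \<longleftrightarrow> (x, k) \<in> wsat_plus)" if xk: "(x, k) \<in> instances_of_genus g" for x k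
  proof -
    obtain C where x: "x = enc_circuit C" and wf: "wf_circuit C" and mono: "monotone_circuit C"
      and gC: "real (circuit_genus C) \<le> g (num_vars C)"
      using xk by (auto simp: instances_of_genus_def)
    let ?n = "num_vars C" and ?G = "circuit_genus C" and ?s = "tree_size x"
    have ns: "?n \<le> ?s" unfolding x enc_circuit_def by (simp add: tree_size_enc_nat)
    have s0: "1 \<le> ?s" using tree_size_pos[of x] by simp
    have "\<exists>b. (\<forall>P. filter P (map clause_of (and_inputs C)) \<noteq> [] \<longrightarrow>
        length (shortest (filter P (map clause_of (and_inputs C)))) \<le> b) \<and> (b + 1) ^ k \<le> f1 k * ?s"
    proof (cases "?n < \<nu> k")
      case True
      have "(?n + 1) ^ k \<le> f1 k" unfolding f1_def using True by (intro power_mono) auto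
      also have "\<dots> \<le> f1 k * ?s" using s0 by simp
      finally show ?thesis using length_shortest_le_num_vars[OF wf] by blast
    next
      case False
      have n: "N \<le> ?n" using False by (simp add: \<nu>_def)
      have k: "k \<le> \<mu> ?n" using False by (intro \<mu>_ge) simp
      \<comment> \<open>\<open>max\<close> covers planar circuits. In the main case
        \<open>0 < k \<le> \<mu> ?n\<close>, so the quotient \<open>real k / real (\<mu> ?n)\<close>
        has a positive denominator and is at most 1.\<close>
      have genus: "max 1 ?G ^ k \<le> ?s"
      proof (cases "k = 0 \<or> ?G \<le> 1")
        case True
        then have "max 1 ?G ^ k = 1" by (auto simp: max_def)
        then show ?thesis using s0 by linarith
      next
        case F: False
        have n1: "1 \<le> real ?n" using N[OF n] by simp
        have "real ?G \<le> real ?n powr h ?n" using gC N[OF n] by linarith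
        also have "\<dots> \<le> real ?n powr (1 / real (\<mu> ?n))" using N[OF n] n1 by (intro powr_mono) auto
        finally have "real ?G ^ k \<le> (real ?n powr (1 / real (\<mu> ?n))) ^ k" by (intro power_mono) auto
        also have "\<dots> = real ?n powr (real k / real (\<mu> ?n))"
          using n1 by (simp add: powr_powr powr_realpow[symmetric])
        also have "\<dots> \<le> real ?n powr 1" using n1 k F by (intro powr_mono) (auto simp: divide_le_eq)
        also have "\<dots> = real ?n" using n1 by simp
        finally have "?G ^ k \<le> ?n" by (metis of_nat_le_iff of_nat_power)
        then show ?thesis using F ns by (simp add: max_def)
      qed
      have "(19 + 24 * ?G + 1) ^ k \<le> (44 * max 1 ?G) ^ k" by (intro power_mono) auto
      also have "\<dots> = 44 ^ k * max 1 ?G ^ k" by (simp add: power_mult_distrib)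
      also have "\<dots> \<le> f1 k * ?s" unfolding f1_def using genus by (intro mult_le_mono power_mono) auto
      finally show ?thesis using length_shortest_le_genus[OF mono] by blast
    qed
    then obtain b where b: "\<And>P. filter P (map clause_of (and_inputs C)) \<noteq> [] \<Longrightarrow>
        length (shortest (filter P (map clause_of (and_inputs C)))) \<le> b" "(b + 1) ^ k \<le> f1 k * ?s"
      by blast
    obtain t y where ty: "runs p (Node x (enc_nat k)) t y"
      "t \<le> c * ((b + 1) ^ k * tree_size (Node x (enc_nat k))) ^ c"
      "y \<noteq> Leaf \<longleftrightarrow> k \<le> ?n \<and> hittable k (map clause_of (and_inputs C))"
      using prog[OF mono b(1)] unfolding x by blast
    have "tree_size (Node x (enc_nat k)) \<le> (2 * k + 3) * ?s"
    proof -
      have "(2 * k + 2) * 1 \<le> (2 * k + 2) * ?s" using s0 by (intro mult_le_mono2)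
      then show ?thesis by (simp add: tree_size_enc_nat algebra_simps)
    qed
    then have "(b + 1) ^ k * tree_size (Node x (enc_nat k)) \<le> (f1 k * ?s) * ((2 * k + 3) * ?s)"
      using b(2) by (intro mult_le_mono)
    also have "\<dots> = f1 k * (2 * k + 3) * ?s ^ 2" by (simp add: power2_eq_square)
    finally have "((b + 1) ^ k * tree_size (Node x (enc_nat k))) ^ c \<le> (f1 k * (2 * k + 3) * ?s ^ 2) ^ c"
      by (intro power_mono) auto
    also have "\<dots> = (f1 k * (2 * k + 3)) ^ c * ?s ^ (2 * c)"
      by (simp only: power_mult_distrib power_mult)
    finally have "t \<le> f k * ?s ^ (2 * c)"
      using ty(2) unfolding f_def by (metis (no_types, lifting) mult.assoc mult_le_mono2 order_trans)
    moreover have "(x, k) \<in> wsat_plus \<longleftrightarrow> (\<exists>A \<subseteq> {..<?n}. card A = k \<and> satisfies A C)"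
      using wf mono injD[OF inj_enc_circuit] unfolding wsat_plus_def x by blast
    then have "y \<noteq> Leaf \<longleftrightarrow> (x, k) \<in> wsat_plus"
      using ty(3) satisfiable_iff_hittable[OF wf mono] by simp
    ultimately show ?thesis using ty(1) by blast
  qed
  ultimately show ?thesis unfolding fpt_on_def by blast
qed

end
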